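(* There exists an absolute constant $C_1>0$ such that for all $p\in(0,1)$ and all integers $n\ge 16$, \[ \mathcal{E}_p(\mathrm{Tam}_n) \ge \zeta_p^- \, n \exp\Big(-p^8 \exp(C_1/p^2)(\log\log n)^4\Big). \]
   Context: For a finite lattice $L$ and $x\in L$, let $\mathrm{cov}_L(x)$ be the set of elements covered by $x$. For $p\in(0,1]$, the Ungarian Markov chain $\mathbf{U}_L$ has state space $L$; from state $x$ it picks a random subset $T\subseteq \mathrm{cov}_L(x)$ by including each element independently with probability $p$ and moves to $\bigwedge(\{x\}\cup T)$. $\mathcal{E}_p(L)$ is the expected number of steps for this chain started at the maximum $\hat 1$ to reach the minimum $\hat 0$. The Tamari lattice $\mathrm{Tam}_n$ is (isomorphic to) the set $\mathrm{Av}_n(312)$ of permutations $\sigma\in S_n$ with no indices $i_1<i_2<i_3$ having $\sigma(i_1)>\sigma(i_3)>\sigma(i_2)$, ordered as a subposet of $S_n$ under the right weak order (the order generated by $\sigma\circ(i\ i{+}1) \lessdot \sigma$ whenever $\sigma(i)>\sigma(i+1)$); it is a sublattice of $S_n$. Let $\zeta_p(n)$ be the probability that the maximum of $n$ independent geometric random variables each with mean $1/p$ is attained uniquely, and $\zeta_p^-=\liminf_{n\to\infty}\zeta_p(n)$. Logarithms are natural. *)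

theory Defs
  imports "HOL-Probability.Probability" "HOL-Combinatorics.Permutations"
begin

definition lat_lt :: "('a \<Rightarrow> 'a \<Rightarrow> bool) \<Rightarrow> 'a \<Rightarrow> 'a \<Rightarrow> bool" where
  "lat_lt le x y \<longleftrightarrow> le x y \<and> x \<noteq> y"

definition lat_cov :: "'a set \<Rightarrow> ('a \<Rightarrow> 'a \<Rightarrow> bool) \<Rightarrow> 'a \<Rightarrow> 'a set" where
  "lat_cov L le x = {y \<in> L. lat_lt le y x \<and> \<not> (\<exists>z\<in>L. lat_lt le y z \<and> lat_lt le z x)}"

definition lat_meet :: "'a set \<Rightarrow> ('a \<Rightarrow> 'a \<Rightarrow> bool) \<Rightarrow> 'a set \<Rightarrow> 'a" where
  "lat_meet L le S = (THE m. m \<in> L \<and> (\<forall>s\<in>S. le m s) \<and> (\<forall>z\<in>L. (\<forall>s\<in>S. le z s) \<longrightarrow> le z m))"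

definition lat_top :: "'a set \<Rightarrow> ('a \<Rightarrow> 'a \<Rightarrow> bool) \<Rightarrow> 'a" where
  "lat_top L le = (THE t. t \<in> L \<and> (\<forall>x\<in>L. le x t))"

definition lat_bot :: "'a set \<Rightarrow> ('a \<Rightarrow> 'a \<Rightarrow> bool) \<Rightarrow> 'a" where
  "lat_bot L le = (THE b. b \<in> L \<and> (\<forall>x\<in>L. le b x))"

definition ungarian_step :: "'a set \<Rightarrow> ('a \<Rightarrow> 'a \<Rightarrow> bool) \<Rightarrow> real \<Rightarrow> 'a \<Rightarrow> 'a pmf" where
  "ungarian_step L le p x =
     map_pmf (\<lambda>f. lat_meet L le (insert x {y \<in> lat_cov L le x. f y}))
             (Pi_pmf (lat_cov L le x) False (\<lambda>_. bernoulli_pmf p))"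

definition ungarian_dist :: "'a set \<Rightarrow> ('a \<Rightarrow> 'a \<Rightarrow> bool) \<Rightarrow> real \<Rightarrow> nat \<Rightarrow> 'a pmf" where
  "ungarian_dist L le p t =
     ((\<lambda>D. bind_pmf D (ungarian_step L le p)) ^^ t) (return_pmf (lat_top L le))"

text \<open>E_p(L): expected number of steps to reach the (absorbing) minimum, written as
  the tail sum  E[tau] = sum_{t>=0} P(tau > t) = sum_{t>=0} P(X_t \<noteq> 0).\<close>
definition ungarian_expect :: "'a set \<Rightarrow> ('a \<Rightarrow> 'a \<Rightarrow> bool) \<Rightarrow> real \<Rightarrow> real" where
  "ungarian_expect L le p =
     (\<Sum>t. measure_pmf.prob (ungarian_dist L le p t) {x. x \<noteq> lat_bot L le})"

section \<open>The Tamari lattice as Av_n(312) under the right weak order\<close>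

definition perms :: "nat \<Rightarrow> (nat \<Rightarrow> nat) set" where
  "perms n = {\<sigma>. \<sigma> permutes {1..n}}"

definition avoids312 :: "nat \<Rightarrow> (nat \<Rightarrow> nat) \<Rightarrow> bool" where
  "avoids312 n \<sigma> \<longleftrightarrow> \<not> (\<exists>i1 i2 i3. 1 \<le> i1 \<and> i1 < i2 \<and> i2 < i3 \<and> i3 \<le> n \<and>
                                   \<sigma> i1 > \<sigma> i3 \<and> \<sigma> i3 > \<sigma> i2)"

definition weak_cover :: "nat \<Rightarrow> (nat \<Rightarrow> nat) \<Rightarrow> (nat \<Rightarrow> nat) \<Rightarrow> bool" where
  "weak_cover n \<sigma> \<tau> \<longleftrightarrow> (\<exists>i. 1 \<le> i \<and> i < n \<and> \<tau> i > \<tau> (Suc i) \<and>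
                              \<sigma> = \<tau> \<circ> Transposition.transpose i (Suc i))"

definition weak_le :: "nat \<Rightarrow> (nat \<Rightarrow> nat) \<Rightarrow> (nat \<Rightarrow> nat) \<Rightarrow> bool" where
  "weak_le n \<sigma> \<tau> \<longleftrightarrow> \<sigma> \<in> perms n \<and> \<tau> \<in> perms n \<and> (weak_cover n)\<^sup>*\<^sup>* \<sigma> \<tau>"

definition tamari :: "nat \<Rightarrow> (nat \<Rightarrow> nat) set" where
  "tamari n = {\<sigma> \<in> perms n. avoids312 n \<sigma>}"

text \<open>Geometric random variable with mean 1/p, supported on {1,2,...}.\<close>
definition geom1_pmf :: "real \<Rightarrow> nat pmf" where
  "geom1_pmf p = map_pmf Suc (geometric_pmf p)"

definition zeta :: "real \<Rightarrow> nat \<Rightarrow> real" where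
  "zeta p n = measure_pmf.prob (Pi_pmf {..<n} 0 (\<lambda>_. geom1_pmf p))
                {f. \<exists>!i. i < n \<and> f i = Max (f ` {..<n})}"

definition zeta_minus :: "real \<Rightarrow> real" where
  "zeta_minus p = real_of_ereal (liminf (\<lambda>n. ereal (zeta p n)))"

end

theory Submission
  imports Defs
begin

text \<open>
  A \<open>312\<close>-avoiding permutation is encoded by the intervals \<open>[b, R b]\<close>, where \<open>R b\<close> is the largest
  value \<open>c \<ge> b\<close> that does not occur after \<open>b\<close>; these intervals form a forest, and in one step of the chain
  every activated node ejects its last child (with its whole subtree), which becomes its right
  sibling. The start is a path. A node \<open>b\<close> that is activated for the first time strictly later than all
  nodes to its right owns everything to its right, and it loses only one node per activation as long
  as all nodes between it and the front have already passed the front. A last node \<open>\<alpha>\<close> among those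
  to the right of \<open>b\<close> shields a fresh copy of the system: everything between \<open>b\<close> and \<open>\<alpha>\<close> jumps over
  the nodes right of \<open>\<alpha>\<close> at its first activation. In each of consecutively shielded regions
  \<open>b\<close> spends some time, and so its head start grows: first by a factor \<open>1 + c / log log n\<close> per
  region, until it exceeds \<open>C log n\<close>, then by squaring (Hoeffding). Hence \<open>O((log log n)\<^sup>2)\<close>
  regions of equal length suffice until \<open>b\<close> survives a whole region without being caught up, and
  finding the required late nodes costs only a factor \<open>exp (- C (log log n)\<^sup>3)\<close>.
\<close>


section \<open>Bracket vectors\<close>

text \<open>The bound must hold uniformly for p in (0,1), and both ends of this range shape the
  proof. Write q = 1 - p. The regions have length h, and h q^T may be at most about 1 over the
  number of regions, so that nodes silent up to time T stay rare. Since T is an integer, q^T can be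
  matched to 1/n only up to a factor q, so the argument yields n q rather than n, up to further
  small losses. For p near 1 this loss is severe. It is recovered from \<open>zeta_minus p\<close>,
  which is at most 5 q (1 + ln(1/q)); \<open>zeta_minus\<close> enters only through upper bounds.
  For small p, the parameters fit once ln n is at least (10000/p)^8. Below this threshold the
  exponent in the claim exceeds ln n, so the right-hand side is at most 1, and C1 is chosen to make
  this so. All other losses are powers of ln n or factors exp(-40 (log log n)^3 / p), and the fourth
  power of log log n absorbs them; hence the constants can be generous.\<close>

definition bvec :: "nat \<Rightarrow> (nat \<Rightarrow> nat) set" where
  "bvec n = {R. (\<forall>b\<in>{1..n}. b \<le> R b \<and> R b \<le> n) \<and> (\<forall>b. b \<notin> {1..n} \<longrightarrow> R b = b) \<and>
                (\<forall>b c. b < c \<longrightarrow> c \<le> R b \<longrightarrow> R c \<le> R b)}"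

text \<open>The children of \<open>b\<close> are the maximal intervals inside
  \<open>(b, R b]\<close>. The last of them ends at \<open>R b\<close>, and maximality makes its
  left end the least one among all intervals ending there. If \<open>b < R b\<close>, one exists
  because \<open>R (R b) = R b\<close>.\<close>

definition last_child :: "(nat \<Rightarrow> nat) \<Rightarrow> nat \<Rightarrow> nat" where
  "last_child R b = (LEAST c. b < c \<and> R c = R b)"

definition eject :: "(nat \<Rightarrow> nat) \<Rightarrow> (nat \<Rightarrow> bool) \<Rightarrow> nat \<Rightarrow> nat" where
  "eject R F b = (if F b \<and> b < R b then last_child R b - 1 else R b)"

lemma bvec_ge: "R \<in> bvec n \<Longrightarrow> b \<le> R b"
  by (cases "b \<in> {1..n}") (auto simp: bvec_def)

lemma bvec_le: "R \<in> bvec n \<Longrightarrow> b \<le> n \<Longrightarrow> R b \<le> n"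
  by (cases "b \<in> {1..n}") (auto simp: bvec_def)

lemma bvec_nested: "R \<in> bvec n \<Longrightarrow> b < c \<Longrightarrow> c \<le> R b \<Longrightarrow> R c \<le> R b"
  by (auto simp: bvec_def)

lemma bvec_outside: "R \<in> bvec n \<Longrightarrow> b \<notin> {1..n} \<Longrightarrow> R b = b"
  by (auto simp: bvec_def)

lemma bvec_fixed: "R \<in> bvec n \<Longrightarrow> R (R b) = R b"
  using bvec_ge[of R n b] bvec_ge[of R n "R b"] bvec_nested[of R n b "R b"]
  by (cases "b < R b") (auto simp: le_less)

lemma last_child:
  assumes "R \<in> bvec n" "b < R b"
  shows "b < last_child R b" "R (last_child R b) = R b" "last_child R b \<le> R b"
proof -
  have *: "b < R b \<and> R (R b) = R b" using assms bvec_fixed by auto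
  from LeastI[where P = "\<lambda>c. b < c \<and> R c = R b", OF *]
  show "b < last_child R b" "R (last_child R b) = R b" by (auto simp: last_child_def)
  show "last_child R b \<le> R b" unfolding last_child_def by (rule Least_le) (use * in auto)
qed

lemma last_child_le: "b < c \<Longrightarrow> R c = R b \<Longrightarrow> last_child R b \<le> c"
  unfolding last_child_def by (rule Least_le) auto

text \<open>If the interval of \<open>c\<close> reached the last child, it would swallow it and so
  end at \<open>R b\<close>, against the minimality of the last child.\<close>

lemma nested_below_last_child:
  assumes "R \<in> bvec n" "b < R b" "b < c" "c < last_child R b"
  shows "R c < last_child R b"
proof (rule ccontr)
  assume "\<not> R c < last_child R b"
  hence "R (last_child R b) \<le> R c" using bvec_nested[OF assms(1)] assms(4) by auto
  moreover have "R c \<le> R b"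
    using bvec_nested[OF assms(1,3)] assms(4) last_child(3)[OF assms(1,2)] by linarith
  ultimately have "R c = R b" using last_child(2)[OF assms(1,2)] by simp
  thus False using last_child_le[OF assms(3), of R] assms(4) by simp
qed

lemma eject_le: "R \<in> bvec n \<Longrightarrow> eject R F b \<le> R b"
  using last_child(3)[of R n b] by (auto simp: eject_def)

lemma eject_less: "R \<in> bvec n \<Longrightarrow> F b \<Longrightarrow> b < R b \<Longrightarrow> eject R F b < R b"
  using last_child(1,3)[of R n b] by (auto simp: eject_def)

lemma eject_ge: "R \<in> bvec n \<Longrightarrow> b \<le> eject R F b"
  using last_child(1)[of R n b] bvec_ge[of R n b] by (auto simp: eject_def)

lemma eject_bvec:
  assumes "R \<in> bvec n" shows "eject R F \<in> bvec n"
proof -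
  have "eject R F c \<le> eject R F b" if bc: "b < c" "c \<le> eject R F b" for b c
  proof (cases "F b \<and> b < R b")
    case True
    hence "c < last_child R b" using bc last_child(1)[OF assms] by (auto simp: eject_def)
    with nested_below_last_child[OF assms] True bc have "R c < last_child R b" by blast
    thus ?thesis using True eject_le[OF assms, of F c] by (auto simp: eject_def)
  next
    case False
    hence "R c \<le> R b" using bvec_nested[OF assms bc(1)] bc(2) by (auto simp: eject_def)
    thus ?thesis using False eject_le[OF assms, of F c] by (auto simp: eject_def)
  qed
  moreover have "eject R F b \<le> n" if "b \<le> n" for b
    using eject_le[OF assms, of F b] bvec_le[OF assms that] by simp
  moreover have "eject R F b = b" if "b \<notin> {1..n}" for b
    using eject_le[OF assms, of F b] eject_ge[OF assms, of b F] bvec_outside[OF assms that] by simp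
  ultimately show ?thesis using eject_ge[OF assms, of _ F] unfolding bvec_def by auto
qed

lemma eject_single: "eject R (\<lambda>c. c = b) = (if b < R b then R(b := last_child R b - 1) else R)"
  by (auto simp: eject_def fun_eq_iff)

text \<open>\<open>S b\<close> cannot reach the last child of \<open>b\<close> in \<open>R\<close>:
  nestedness of \<open>S\<close> would then force \<open>S b\<close> up to the end of that child,
  which is \<open>R b\<close> because \<open>S\<close> and \<open>R\<close> agree to the right of
  \<open>b\<close>. This makes single ejections the only lower covers.\<close>

lemma below_single_eject:
  assumes R: "R \<in> bvec n" and S: "S \<in> bvec n" and le: "S \<le> R" and b: "S b < R b"
    and max: "\<And>c. b < c \<Longrightarrow> S c = R c"
  shows "S \<le> eject R (\<lambda>c. c = b)"
proof -
  have bR: "b < R b" using bvec_ge[OF S, of b] b by linarith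
  note lc = last_child[OF R bR]
  have "S b < last_child R b"
  proof (rule ccontr)
    assume "\<not> ?thesis"
    hence "S (last_child R b) \<le> S b" using bvec_nested[OF S lc(1)] by simp
    thus False using max[OF lc(1)] lc(2) b by simp
  qed
  thus ?thesis using le bR by (auto simp: eject_single le_fun_def)
qed

lemma bvec_cov:
  assumes R: "R \<in> bvec n"
  shows "lat_cov (bvec n) (\<le>) R = (\<lambda>b. eject R (\<lambda>c. c = b)) ` {b. b < R b}"
proof (intro equalityI subsetI)
  fix S assume "S \<in> lat_cov (bvec n) (\<le>) R"
  hence S: "S \<in> bvec n" "S \<le> R" "S \<noteq> R"
    and no: "\<And>Z. Z \<in> bvec n \<Longrightarrow> S \<le> Z \<Longrightarrow> Z \<le> R \<Longrightarrow> S = Z \<or> Z = R"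
    by (auto simp: lat_cov_def lat_lt_def)
  define D where "D = {b. S b \<noteq> R b}"
  have fin: "D \<subseteq> {1..n}"
  proof
    fix b assume "b \<in> D"
    thus "b \<in> {1..n}" using bvec_outside[OF R, of b] bvec_outside[OF S(1), of b] unfolding D_def by fastforce
  qed
  hence finD: "finite D" by (rule finite_subset) simp
  have "D \<noteq> {}" using S(3) by (auto simp: D_def)
  define b where "b = Max D"
  have "b \<in> D" using finD \<open>D \<noteq> {}\<close> by (simp add: b_def)
  hence b: "S b < R b" using S(2) by (auto simp: D_def le_fun_def order.strict_iff_order)
  have max: "S c = R c" if "b < c" for c
    using that Max_ge[OF finD, of c] by (force simp: b_def D_def)
  have le: "S \<le> eject R (\<lambda>c. c = b)" by (rule below_single_eject[OF R S(1,2) b max])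
  have bR: "b < R b" using bvec_ge[OF S(1), of b] b by linarith
  have "eject R (\<lambda>c. c = b) \<noteq> R" using eject_less[OF R, of "\<lambda>c. c = b" b] bR by (metis less_irrefl)
  hence "S = eject R (\<lambda>c. c = b)"
    using no[OF eject_bvec[OF R] le] eject_le[OF R] by (auto simp: le_fun_def)
  thus "S \<in> (\<lambda>b. eject R (\<lambda>c. c = b)) ` {b. b < R b}" using bR by auto
next
  fix S assume "S \<in> (\<lambda>b. eject R (\<lambda>c. c = b)) ` {b. b < R b}"
  then obtain b where bR: "b < R b" and S: "S = eject R (\<lambda>c. c = b)" by auto
  have "S \<noteq> R" using eject_less[OF R, of "\<lambda>c. c = b" b] bR S by (metis less_irrefl)
  \<comment> \<open>Anything between \<open>S\<close> and \<open>R\<close> agrees with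
    \<open>R\<close> away from \<open>b\<close>, so \<open>b\<close> is again the largest place of
    difference and the same lemma pushes it down to \<open>S\<close>.\<close>
  moreover have False if Z: "Z \<in> bvec n" "S \<le> Z" "S \<noteq> Z" "Z \<le> R" "Z \<noteq> R" for Z
  proof -
    have eq: "Z c = R c" if "c \<noteq> b" for c
    proof (rule antisym)
      show "Z c \<le> R c" using Z(4) by (simp add: le_fun_def)
      have "S c \<le> Z c" using Z(2) by (simp add: le_fun_def)
      thus "R c \<le> Z c" using that by (simp add: S eject_def)
    qed
    moreover have "Z b < R b" using eq Z(4,5) by (metis le_fun_def ext order.strict_iff_order)
    ultimately have "Z \<le> S" using below_single_eject[OF R Z(1,4), of b] S by auto
    thus False using Z by auto
  qed
  moreover have "S \<in> bvec n" "S \<le> R"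
    using eject_bvec[OF R] eject_le[OF R] by (auto simp: S le_fun_def)
  ultimately show "S \<in> lat_cov (bvec n) (\<le>) R"
    unfolding lat_cov_def lat_lt_def by blast
qed

definition is_glb :: "'a set \<Rightarrow> ('a \<Rightarrow> 'a \<Rightarrow> bool) \<Rightarrow> 'a set \<Rightarrow> 'a \<Rightarrow> bool" where
  "is_glb L le S m \<longleftrightarrow> m \<in> L \<and> (\<forall>s\<in>S. le m s) \<and> (\<forall>z\<in>L. (\<forall>s\<in>S. le z s) \<longrightarrow> le z m)"

text \<open>Single ejections change different coordinates, so the simultaneous ejection is their
  pointwise minimum; since this minimum is nested again, it is the meet.\<close>

lemma bvec_glb:
  assumes R: "R \<in> bvec n"
  shows "is_glb (bvec n) (\<le>) (insert R {eject R (\<lambda>c. c = b) | b. b < R b \<and> F b}) (eject R F)"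
  unfolding is_glb_def
proof (intro conjI ballI impI)
  fix s assume "s \<in> insert R {eject R (\<lambda>c. c = b) | b. b < R b \<and> F b}"
  thus "eject R F \<le> s"
  proof (elim insertE CollectE exE conjE)
    fix b assume "s = eject R (\<lambda>c. c = b)" "b < R b" "F b"
    thus ?thesis using eject_le[OF R, of F] by (auto simp: le_fun_def eject_def)
  qed (use eject_le[OF R] in \<open>auto simp: le_fun_def\<close>)
next
  fix z assume "z \<in> bvec n"
    and *: "\<forall>s\<in>insert R {eject R (\<lambda>c. c = b) | b. b < R b \<and> F b}. z \<le> s"
  have "z b \<le> eject R F b" for b
  proof (cases "b < R b \<and> F b")
    case True
    hence "z \<le> eject R (\<lambda>c. c = b)" using * by blast
    hence "z b \<le> eject R (\<lambda>c. c = b) b" by (simp add: le_fun_def)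
    thus ?thesis using True by (auto simp: eject_def)
  next
    case False
    have "z \<le> R" using * by blast
    thus ?thesis using False by (auto simp: eject_def le_fun_def)
  qed
  thus "z \<le> eject R F" by (simp add: le_fun_def)
qed (rule eject_bvec[OF R])


section \<open>The Tamari lattice as the lattice of bracket vectors\<close>

definition invs :: "(nat \<Rightarrow> nat) \<Rightarrow> (nat \<times> nat) set" where
  "invs \<sigma> = {(a, b). a < b \<and> inv \<sigma> b < inv \<sigma> a}"

lemma invs_subset:
  assumes "\<sigma> \<in> perms n" shows "invs \<sigma> \<subseteq> {1..n} \<times> {1..n}"
proof -
  have p: "inv \<sigma> permutes {1..n}" using assms by (simp add: perms_def permutes_inv)
  have "a \<in> {1..n} \<and> b \<in> {1..n}" if "a < b" "inv \<sigma> b < inv \<sigma> a" for a b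
  proof -
    have out: "x \<notin> {1..n} \<Longrightarrow> inv \<sigma> x = x" for x using permutes_not_in[OF p] by blast
    have ins: "x \<in> {1..n} \<Longrightarrow> inv \<sigma> x \<in> {1..n}" for x using permutes_in_image[OF p] by blast
    show ?thesis using that out[of a] out[of b] ins[of a] ins[of b]
      by (cases "a \<in> {1..n}"; cases "b \<in> {1..n}") auto
  qed
  thus ?thesis by (auto simp: invs_def)
qed

lemma finite_invs: "\<sigma> \<in> perms n \<Longrightarrow> finite (invs \<sigma>)"
  by (rule finite_subset[OF invs_subset]) auto

lemma invs_swap:
  assumes \<tau>: "\<tau> \<in> perms n" and i: "1 \<le> i" "i < n" "\<tau> i > \<tau> (Suc i)"
  defines "\<sigma> \<equiv> \<tau> \<circ> Transposition.transpose i (Suc i)"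
  shows "\<sigma> \<in> perms n" "invs \<sigma> = invs \<tau> - {(\<tau> (Suc i), \<tau> i)}" "(\<tau> (Suc i), \<tau> i) \<in> invs \<tau>"
proof -
  have p: "\<tau> permutes {1..n}" using \<tau> by (simp add: perms_def)
  have "\<sigma> permutes {1..n}" unfolding \<sigma>_def
    by (intro permutes_compose permutes_swap_id p) (use i in auto)
  thus "\<sigma> \<in> perms n" by (simp add: perms_def)
  have bij: "bij \<tau>" using p by (rule permutes_bij)
  have inv: "inv \<sigma> = Transposition.transpose i (Suc i) \<circ> inv \<tau>"
    unfolding \<sigma>_def using bij by (subst o_inv_distrib) auto
  have i1: "inv \<tau> x = j \<longleftrightarrow> x = \<tau> j" for x j
    using bij by (metis bij_inv_eq_iff)
  have ii: "inv \<tau> (\<tau> j) = j" for j using i1 by blast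
  have t: "(Transposition.transpose i (Suc i) x < Transposition.transpose i (Suc i) y) \<longleftrightarrow>
      (x = Suc i \<and> y = i) \<or> (x < y \<and> \<not> (x = i \<and> y = Suc i))" for x y
    by (auto simp: Transposition.transpose_def)
  have "(a, b) \<in> invs \<sigma> \<longleftrightarrow> (a, b) \<in> invs \<tau> - {(\<tau> (Suc i), \<tau> i)}" for a b
  proof -
    have "(a, b) \<in> invs \<sigma> \<longleftrightarrow> a < b \<and> ((inv \<tau> b = Suc i \<and> inv \<tau> a = i) \<or>
      (inv \<tau> b < inv \<tau> a \<and> \<not> (inv \<tau> b = i \<and> inv \<tau> a = Suc i)))"
      by (simp only: invs_def inv o_apply t mem_Collect_eq case_prod_conv)
    also have "\<dots> \<longleftrightarrow> a < b \<and> inv \<tau> b < inv \<tau> a \<and> \<not> (b = \<tau> i \<and> a = \<tau> (Suc i))"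
      unfolding i1 using i(3) by (metis less_asym)
    also have "\<dots> \<longleftrightarrow> (a, b) \<in> invs \<tau> - {(\<tau> (Suc i), \<tau> i)}"
      by (auto simp: invs_def)
    finally show ?thesis .
  qed
  thus "invs \<sigma> = invs \<tau> - {(\<tau> (Suc i), \<tau> i)}" by auto
  show "(\<tau> (Suc i), \<tau> i) \<in> invs \<tau>"
    using i(3) by (simp add: invs_def ii)
qed

lemma weak_cover_down:
  assumes "weak_cover n \<sigma> \<tau>" "\<tau> \<in> perms n"
  shows "\<sigma> \<in> perms n" "invs \<sigma> \<subseteq> invs \<tau>"
  using assms invs_swap[of \<tau> n] unfolding weak_cover_def by auto

text \<open>Otherwise \<open>inv \<sigma> \<circ> \<tau>\<close> increases at every adjacent pair:
  at descents of \<open>\<tau>\<close> by assumption, at ascents because \<open>\<sigma>\<close> has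
  no inversion that \<open>\<tau>\<close> lacks. Such a permutation is the identity.\<close>

lemma exists_free_descent:
  assumes \<sigma>: "\<sigma> \<in> perms n" and \<tau>: "\<tau> \<in> perms n" and sub: "invs \<sigma> \<subseteq> invs \<tau>" and ne: "\<sigma> \<noteq> \<tau>"
  shows "\<exists>i. 1 \<le> i \<and> i < n \<and> \<tau> i > \<tau> (Suc i) \<and> (\<tau> (Suc i), \<tau> i) \<notin> invs \<sigma>"
proof (rule ccontr)
  assume no: "\<not> ?thesis"
  have ps: "\<sigma> permutes {1..n}" and pt: "\<tau> permutes {1..n}" using \<sigma> \<tau> by (auto simp: perms_def)
  define g where "g = inv \<sigma> \<circ> \<tau>"
  have pg: "g permutes {1..n}" unfolding g_def by (intro permutes_compose pt permutes_inv ps)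
  have invt: "inv \<tau> (\<tau> j) = j" for j using pt by (simp add: permutes_inverses)
  have injs: "inj (inv \<sigma>)" using ps by (meson permutes_inj permutes_inv)
  have inc: "g i < g (Suc i)" if i: "1 \<le> i" "i < n" for i
  proof (cases "\<tau> i > \<tau> (Suc i)")
    case True
    hence "(\<tau> (Suc i), \<tau> i) \<in> invs \<sigma>" using no i by auto
    thus ?thesis by (auto simp: invs_def g_def)
  next
    case False
    moreover have "\<tau> i \<noteq> \<tau> (Suc i)" using permutes_inj[OF pt] by (metis injD n_not_Suc_n)
    ultimately have lt: "\<tau> i < \<tau> (Suc i)" by simp
    have "(\<tau> i, \<tau> (Suc i)) \<notin> invs \<tau>" by (simp add: invs_def invt)
    hence "(\<tau> i, \<tau> (Suc i)) \<notin> invs \<sigma>" using sub by auto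
    hence "\<not> g (Suc i) < g i" using lt by (auto simp: invs_def g_def)
    moreover have "g i \<noteq> g (Suc i)" using permutes_inj[OF pg] by (metis injD n_not_Suc_n)
    ultimately show ?thesis by simp
  qed
  have ge: "Suc i \<le> n \<Longrightarrow> Suc i \<le> g (Suc i)" for i
  proof (induction i)
    case 0
    thus ?case using permutes_in_image[OF pg, of 1] by auto
  next
    case (Suc i)
    thus ?case using inc[of "Suc i"] by simp
  qed
  have "\<forall>i\<in>{1..n}. i \<le> g i"
  proof
    fix i assume "i \<in> {1..n}" thus "i \<le> g i" using ge[of "i - 1"] by (cases i) auto
  qed
  hence "g = id" by (intro permutes_natset_ge[OF pg]) auto
  hence "inv \<sigma> (\<tau> x) = x" for x by (metis g_def comp_apply id_apply)
  hence "\<tau> x = \<sigma> x" for x using ps by (metis permutes_inverses(1))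
  thus False using ne by auto
qed

lemma weak_le_iff_invs:
  assumes \<sigma>: "\<sigma> \<in> perms n" and \<tau>: "\<tau> \<in> perms n"
  shows "weak_le n \<sigma> \<tau> \<longleftrightarrow> invs \<sigma> \<subseteq> invs \<tau>"
proof
  assume "weak_le n \<sigma> \<tau>"
  hence "(weak_cover n)\<^sup>*\<^sup>* \<sigma> \<tau>" by (simp add: weak_le_def)
  hence "\<sigma> \<in> perms n \<and> invs \<sigma> \<subseteq> invs \<tau>"
  proof (induction rule: converse_rtranclp_induct)
    case base thus ?case using \<tau> by simp
  next
    case (step y z) thus ?case using weak_cover_down[of n y z] by blast
  qed
  thus "invs \<sigma> \<subseteq> invs \<tau>" by simp
next
  assume "invs \<sigma> \<subseteq> invs \<tau>"
  hence "(weak_cover n)\<^sup>*\<^sup>* \<sigma> \<tau>" using \<tau>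
  proof (induction "card (invs \<tau>)" arbitrary: \<tau> rule: less_induct)
    case less
    show ?case
    proof (cases "\<sigma> = \<tau>")
      case False
      then obtain i where i: "1 \<le> i" "i < n" "\<tau> i > \<tau> (Suc i)" "(\<tau> (Suc i), \<tau> i) \<notin> invs \<sigma>"
        using exists_free_descent[OF \<sigma> less.prems(2,1)] by blast
      define \<rho> where "\<rho> = \<tau> \<circ> Transposition.transpose i (Suc i)"
      note sw = invs_swap[OF less.prems(2) i(1-3), folded \<rho>_def]
      have "card (invs \<rho>) < card (invs \<tau>)"
        unfolding sw(2) using sw(3) finite_invs[OF less.prems(2)] by (intro psubset_card_mono) auto
      moreover have "invs \<sigma> \<subseteq> invs \<rho>" using less.prems(1) i(4) sw(2) by auto
      ultimately have "(weak_cover n)\<^sup>*\<^sup>* \<sigma> \<rho>" using less.hyps sw(1) by blast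
      moreover have "weak_cover n \<rho> \<tau>" using i by (auto simp: weak_cover_def \<rho>_def)
      ultimately show ?thesis by auto
    qed auto
  qed
  thus "weak_le n \<sigma> \<tau>" using \<sigma> \<tau> by (simp add: weak_le_def)
qed

section \<open>The bracket vector of a 312-avoiding permutation\<close>

definition bvec_of :: "nat \<Rightarrow> (nat \<Rightarrow> nat) \<Rightarrow> nat \<Rightarrow> nat" where
  "bvec_of n \<sigma> b = (if b \<in> {1..n} then Max {c \<in> {1..n}. c = b \<or> (b, c) \<in> invs \<sigma>} else b)"

lemma bvec_of_outside: "b \<notin> {1..n} \<Longrightarrow> bvec_of n \<sigma> b = b"
  unfolding bvec_of_def by (rule if_not_P)

lemma bvec_of_props:
  assumes "b \<in> {1..n}"
  shows "b \<le> bvec_of n \<sigma> b" "bvec_of n \<sigma> b \<le> n"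
        "bvec_of n \<sigma> b = b \<or> (b, bvec_of n \<sigma> b) \<in> invs \<sigma>"
proof -
  let ?S = "{c \<in> {1..n}. c = b \<or> (b, c) \<in> invs \<sigma>}"
  have "b \<in> ?S" using assms by auto
  hence "Max ?S \<in> ?S" "b \<le> Max ?S" by (intro Max_in Max_ge; force)+
  thus "b \<le> bvec_of n \<sigma> b" "bvec_of n \<sigma> b \<le> n"
        "bvec_of n \<sigma> b = b \<or> (b, bvec_of n \<sigma> b) \<in> invs \<sigma>"
    using assms unfolding bvec_of_def by auto
qed

lemma tamari_perms: "\<sigma> \<in> tamari n \<Longrightarrow> \<sigma> \<in> perms n"
  by (simp add: tamari_def)

text \<open>The larger values preceding \<open>a\<close> form an initial segment: if
  \<open>c\<close> precedes \<open>a\<close>, but some \<open>b\<close> between \<open>a\<close> and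
  \<open>c\<close> in value comes after \<open>a\<close>, then \<open>c\<close>, \<open>a\<close>,
  \<open>b\<close> is a 312 pattern.\<close>

lemma invs_iff_bvec_of:
  assumes \<sigma>: "\<sigma> \<in> tamari n" and ab: "a < b" and a: "1 \<le> a"
  shows "(a, b) \<in> invs \<sigma> \<longleftrightarrow> b \<le> bvec_of n \<sigma> a"
proof
  assume in1: "(a, b) \<in> invs \<sigma>"
  hence r: "a \<in> {1..n}" "b \<in> {1..n}" using invs_subset[OF tamari_perms[OF \<sigma>]] by auto
  have "b \<le> Max {c \<in> {1..n}. c = a \<or> (a, c) \<in> invs \<sigma>}"
    using in1 r by (intro Max_ge) auto
  thus "b \<le> bvec_of n \<sigma> a" using r by (simp add: bvec_of_def)
next
  assume le: "b \<le> bvec_of n \<sigma> a"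
  hence r: "a \<in> {1..n}" using ab a by (auto simp: bvec_of_def split: if_splits)
  define c where "c = bvec_of n \<sigma> a"
  have cn: "c \<le> n" and in1: "(a, c) \<in> invs \<sigma>"
    using bvec_of_props[OF r, of \<sigma>] le ab by (auto simp: c_def)
  show "(a, b) \<in> invs \<sigma>"
  proof (cases "b = c")
    case False
    hence bc: "b < c" using le by (simp add: c_def)
    have p: "\<sigma> permutes {1..n}" using \<sigma> by (simp add: tamari_def perms_def)
    have inv: "\<sigma> (inv \<sigma> x) = x" for x using p by (simp add: permutes_inverses)
    have rng: "inv \<sigma> x \<in> {1..n}" if "x \<in> {1..n}" for x
      using permutes_in_image[OF permutes_inv[OF p]] that by blast
    have "\<not> inv \<sigma> a < inv \<sigma> b"
    proof
      assume "inv \<sigma> a < inv \<sigma> b"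
      moreover have "inv \<sigma> c < inv \<sigma> a" using in1 by (simp add: invs_def)
      moreover have "1 \<le> inv \<sigma> c" "inv \<sigma> b \<le> n" using rng[of c] rng[of b] ab bc cn a by auto
      moreover have "\<sigma> (inv \<sigma> c) > \<sigma> (inv \<sigma> b)" "\<sigma> (inv \<sigma> b) > \<sigma> (inv \<sigma> a)"
        unfolding inv by (fact bc, fact ab)
      ultimately show False using \<sigma> unfolding tamari_def avoids312_def by blast
    qed
    moreover have "inv \<sigma> a \<noteq> inv \<sigma> b" using inv ab by (metis less_irrefl)
    ultimately show ?thesis using ab by (simp add: invs_def)
  qed (use in1 in auto)
qed

lemma bvec_of_in:
  assumes \<sigma>: "\<sigma> \<in> tamari n" shows "bvec_of n \<sigma> \<in> bvec n"
proof -
  have "bvec_of n \<sigma> c \<le> bvec_of n \<sigma> b" if bc: "b < c" "c \<le> bvec_of n \<sigma> b" for b c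
  proof -
    have b: "b \<in> {1..n}" using bc by (auto simp: bvec_of_def split: if_splits)
    hence c: "c \<in> {1..n}" using bc bvec_of_props(2)[OF b, of \<sigma>] by auto
    have i1: "(b, c) \<in> invs \<sigma>" using invs_iff_bvec_of[OF \<sigma> bc(1)] bc b by auto
    show ?thesis
    proof (cases "bvec_of n \<sigma> c = c")
      case False
      hence "(c, bvec_of n \<sigma> c) \<in> invs \<sigma>" using bvec_of_props(3)[OF c] by auto
      hence "(b, bvec_of n \<sigma> c) \<in> invs \<sigma>" using i1 by (auto simp: invs_def)
      moreover have "b < bvec_of n \<sigma> c" using bc bvec_of_props(1)[OF c, of \<sigma>] by simp
      ultimately show ?thesis using invs_iff_bvec_of[OF \<sigma>, of b "bvec_of n \<sigma> c"] b by auto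
    qed (use bc in simp)
  qed
  thus ?thesis using bvec_of_props unfolding bvec_def by (auto simp: bvec_of_outside simp del: atLeastAtMost_iff)
qed

lemma weak_le_iff_bvec_of:
  assumes \<sigma>: "\<sigma> \<in> tamari n" and \<tau>: "\<tau> \<in> tamari n"
  shows "weak_le n \<sigma> \<tau> \<longleftrightarrow> bvec_of n \<sigma> \<le> bvec_of n \<tau>"
  unfolding weak_le_iff_invs[OF tamari_perms[OF \<sigma>] tamari_perms[OF \<tau>]]
proof
  assume sub: "invs \<sigma> \<subseteq> invs \<tau>"
  have "bvec_of n \<sigma> b \<le> bvec_of n \<tau> b" for b
  proof (cases "b \<in> {1..n}")
    case b: True
    show ?thesis
    proof (cases "bvec_of n \<sigma> b = b")
      case False
      hence "(b, bvec_of n \<sigma> b) \<in> invs \<tau>" "b < bvec_of n \<sigma> b"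
        using bvec_of_props[OF b, of \<sigma>] sub by auto
      thus ?thesis using invs_iff_bvec_of[OF \<tau>, of b "bvec_of n \<sigma> b"] b by auto
    qed (use bvec_of_props(1)[OF b] in simp)
  qed (simp add: bvec_of_outside del: atLeastAtMost_iff)
  thus "bvec_of n \<sigma> \<le> bvec_of n \<tau>" by (simp add: le_fun_def)
next
  assume le: "bvec_of n \<sigma> \<le> bvec_of n \<tau>"
  show "invs \<sigma> \<subseteq> invs \<tau>"
  proof
    fix x assume x: "x \<in> invs \<sigma>"
    obtain a b where ab: "x = (a, b)" by force
    have "a < b" "1 \<le> a" using x invs_subset[OF tamari_perms[OF \<sigma>]] by (auto simp: ab invs_def)
    thus "x \<in> invs \<tau>"
      using x invs_iff_bvec_of[OF \<sigma>, of a b] invs_iff_bvec_of[OF \<tau>, of a b] le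
      by (auto simp: ab le_fun_def intro: le_trans)
  qed
qed

text \<open>The position of the value \<open>a\<close> in the permutation to be built. Before
  \<open>a\<close> stand the \<open>R a - a\<close> larger values up to \<open>R a\<close>, and the
  \<open>a - 1\<close> smaller values except those \<open>x\<close> with \<open>a \<le> R x\<close>;
  adding 1 for \<open>a\<close> itself gives the formula.\<close>

definition pos_of :: "nat \<Rightarrow> (nat \<Rightarrow> nat) \<Rightarrow> nat \<Rightarrow> nat" where
  "pos_of n R a = (if a \<in> {1..n} then R a - card {x \<in> {1..<a}. a \<le> R x} else a)"

text \<open>If \<open>b \<le> R a\<close>, all intervals counted for \<open>a\<close>, and that of
  \<open>a\<close> itself, are counted for \<open>b\<close>, while \<open>R b \<le> R a\<close>.
  Otherwise an interval counted for \<open>b\<close> but not for \<open>a\<close> starts strictly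
  between \<open>R a\<close> and \<open>b\<close>; there are at most \<open>b - R a - 1\<close> of
  these, and \<open>b \<le> R b\<close> makes up for them.\<close>

lemma pos_of_less_iff:
  assumes R: "R \<in> bvec n" and ab: "a \<in> {1..n}" "b \<in> {1..n}" "a < b"
  shows "if b \<le> R a then pos_of n R b < pos_of n R a else pos_of n R a < pos_of n R b"
proof -
  define C where "C = (\<lambda>a. {x \<in> {1..<a}. a \<le> R x})"
  have pos: "pos_of n R x = R x - card (C x)" if "x \<in> {1..n}" for x
    using that by (auto simp: pos_of_def C_def)
  have fin: "finite (C x)" for x by (auto simp: C_def)
  have cl: "card (C x) < R x" if "x \<in> {1..n}" for x
  proof -
    have "card (C x) \<le> card {1..<x}" by (intro card_mono) (auto simp: C_def)
    thus ?thesis using bvec_ge[OF R, of x] that by auto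
  qed
  show ?thesis
  proof (cases "b \<le> R a")
    case True
    have "insert a (C a) \<subseteq> C b"
    proof
      fix x assume "x \<in> insert a (C a)"
      thus "x \<in> C b" using True ab bvec_nested[OF R, of x a] by (auto simp: C_def)
    qed
    hence "card (insert a (C a)) \<le> card (C b)" using fin by (intro card_mono) auto
    moreover have "a \<notin> C a" by (auto simp: C_def)
    ultimately have "Suc (card (C a)) \<le> card (C b)" using fin by simp
    moreover have "R b \<le> R a" using bvec_nested[OF R] ab True by auto
    ultimately show ?thesis using True cl[OF ab(1)] cl[OF ab(2)] unfolding pos[OF ab(1)] pos[OF ab(2)] by auto
  next
    case False
    have "C b \<subseteq> C a \<union> {R a<..<b}"
    proof
      fix x assume x: "x \<in> C b"
      have "x \<noteq> a" using x False by (auto simp: C_def)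
      moreover have "\<not> (a < x \<and> x \<le> R a)" using x False bvec_nested[OF R, of a x] by (auto simp: C_def)
      ultimately show "x \<in> C a \<union> {R a<..<b}" using x ab by (auto simp: C_def)
    qed
    hence "card (C b) \<le> card (C a \<union> {R a<..<b})" using fin by (intro card_mono) auto
    also have "\<dots> \<le> card (C a) + card {R a<..<b}" by (rule card_Un_le)
    finally have "card (C b) \<le> card (C a) + (b - Suc (R a))" by simp
    moreover have "b \<le> R b" by (rule bvec_ge[OF R])
    ultimately show ?thesis using False cl[OF ab(1)] cl[OF ab(2)] unfolding pos[OF ab(1)] pos[OF ab(2)] by auto
  qed
qed

lemma bvec_of_surj:
  assumes R: "R \<in> bvec n" shows "\<exists>\<sigma>\<in>tamari n. bvec_of n \<sigma> = R"
proof -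
  let ?p = "pos_of n R"
  note lt = pos_of_less_iff[OF R]
  have rng: "?p a \<in> {1..n}" if a: "a \<in> {1..n}" for a
  proof -
    have "card {x \<in> {1..<a}. a \<le> R x} \<le> card {1..<a}" by (intro card_mono) auto
    thus ?thesis using a bvec_ge[OF R, of a] bvec_le[OF R, of a] by (auto simp: pos_of_def)
  qed
  have inj: "inj_on ?p {1..n}"
  proof (rule linorder_inj_onI)
    fix a b assume "a < b" "a \<in> {1..n}" "b \<in> {1..n}"
    thus "?p a \<noteq> ?p b" using lt[of a b] by (auto split: if_splits)
  qed auto
  have "?p ` {1..n} = {1..n}" by (rule endo_inj_surj) (use rng inj in auto)
  have pp: "?p permutes {1..n}"
  proof (rule bij_imp_permutes)
    show "bij_betw ?p {1..n} {1..n}" using inj \<open>?p ` {1..n} = {1..n}\<close> by (simp only: bij_betw_def simp_thms)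
    show "?p a = a" if "a \<notin> {1..n}" for a unfolding pos_of_def using that by (rule if_not_P)
  qed
  define \<sigma> where "\<sigma> = inv ?p"
  have ps: "\<sigma> permutes {1..n}" unfolding \<sigma>_def by (rule permutes_inv[OF pp])
  have inv: "inv \<sigma> = ?p" unfolding \<sigma>_def by (rule permutes_inv_inv[OF pp])
  have pos\<sigma>: "?p (\<sigma> i) = i" for i using permutes_inverses(2)[OF ps, of i] by (simp only: inv)
  have "avoids312 n \<sigma>" unfolding avoids312_def
  proof (rule notI, elim exE conjE)
    fix i1 i2 i3 assume i: "1 \<le> i1" "i1 < i2" "i2 < i3" "i3 \<le> n" "\<sigma> i3 < \<sigma> i1" "\<sigma> i2 < \<sigma> i3"
    have r: "\<sigma> i1 \<in> {1..n}" "\<sigma> i2 \<in> {1..n}" "\<sigma> i3 \<in> {1..n}"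
      unfolding permutes_in_image[OF ps] using i by auto
    \<comment> \<open>The larger value \<open>\<sigma> i1\<close> precedes
      \<open>\<sigma> i2\<close>, so it lies in the interval of \<open>\<sigma> i2\<close>. Then so
      does \<open>\<sigma> i3\<close>, which would have to precede \<open>\<sigma> i2\<close> as
      well.\<close>
    have "\<sigma> i1 \<le> R (\<sigma> i2)"
      using lt[OF r(2,1)] i unfolding pos\<sigma> by (metis less_asym order.strict_trans)
    thus False
      using lt[OF r(2,3)] i unfolding pos\<sigma> by (metis less_asym less_or_eq_imp_le order.strict_trans2)
  qed
  hence \<sigma>: "\<sigma> \<in> tamari n" using ps by (simp add: tamari_def perms_def)
  have "bvec_of n \<sigma> b = R b" for b
  proof (cases "b \<in> {1..n}")
    case b: True
    have iff: "c = b \<or> (b, c) \<in> invs \<sigma> \<longleftrightarrow> b \<le> c \<and> c \<le> R b" if "c \<in> {1..n}" for c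
      using lt[OF b that] bvec_ge[OF R, of b] by (auto simp: invs_def inv split: if_splits)
    have "Max {c \<in> {1..n}. c = b \<or> (b, c) \<in> invs \<sigma>} = R b"
      using iff bvec_ge[OF R, of b] bvec_le[OF R, of b] b by (intro Max_eqI) auto
    thus ?thesis using b by (simp add: bvec_of_def)
  qed (use bvec_outside[OF R] in \<open>simp add: bvec_of_outside del: atLeastAtMost_iff\<close>)
  thus ?thesis using \<sigma> by auto
qed


lemma bij_betw_bvec_of: "bij_betw (bvec_of n) (tamari n) (bvec n)"
proof -
  have "inj_on (bvec_of n) (tamari n)"
  proof (rule inj_onI)
    fix \<sigma> \<tau> assume *: "\<sigma> \<in> tamari n" "\<tau> \<in> tamari n" "bvec_of n \<sigma> = bvec_of n \<tau>"
    have "weak_le n \<sigma> \<tau>" "weak_le n \<tau> \<sigma>" using weak_le_iff_bvec_of * by auto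
    hence eq: "invs \<sigma> = invs \<tau>" using weak_le_iff_invs tamari_perms * by blast
    show "\<sigma> = \<tau>"
    proof (rule ccontr)
      assume "\<sigma> \<noteq> \<tau>"
      then obtain i where "1 \<le> i" "i < n" "\<tau> i > \<tau> (Suc i)" "(\<tau> (Suc i), \<tau> i) \<notin> invs \<sigma>"
        using exists_free_descent[of \<sigma> n \<tau>] tamari_perms * eq by blast
      thus False using invs_swap(3)[of \<tau> n i] tamari_perms[OF *(2)] eq by blast
    qed
  qed
  moreover have "bvec_of n ` tamari n = bvec n"
    using bvec_of_in bvec_of_surj by (auto simp: image_iff) metis
  ultimately show ?thesis by (simp add: bij_betw_def)
qed

section \<open>Transport of the chain along the order isomorphism\<close>

lemma lat_cov_iso:
  assumes f: "bij_betw f L L'" and le: "\<And>x y. x \<in> L \<Longrightarrow> y \<in> L \<Longrightarrow> le x y \<longleftrightarrow> le' (f x) (f y)" and x: "x \<in> L"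
  shows "f ` lat_cov L le x = lat_cov L' le' (f x)"
proof -
  have eq: "f y = f z \<longleftrightarrow> y = z" if "y \<in> L" "z \<in> L" for y z
    using f that by (auto simp: bij_betw_def inj_on_def)
  have lt: "lat_lt le y z \<longleftrightarrow> lat_lt le' (f y) (f z)" if "y \<in> L" "z \<in> L" for y z
    using that le eq by (auto simp: lat_lt_def)
  have L': "L' = f ` L" using f by (simp add: bij_betw_def)
  have "y \<in> lat_cov L le x \<longleftrightarrow> f y \<in> lat_cov L' le' (f x)" if "y \<in> L" for y
    using that x by (auto simp: lat_cov_def lt L')
  thus ?thesis by (auto simp: L') (auto simp: lat_cov_def)
qed

lemma lat_meet_iso:
  assumes f: "bij_betw f L L'" and le: "\<And>x y. x \<in> L \<Longrightarrow> y \<in> L \<Longrightarrow> le x y \<longleftrightarrow> le' (f x) (f y)"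
    and S: "S \<subseteq> L" and m: "is_glb L' le' (f ` S) m"
    and anti: "\<And>x y. x \<in> L' \<Longrightarrow> y \<in> L' \<Longrightarrow> le' x y \<Longrightarrow> le' y x \<Longrightarrow> x = y"
  shows "lat_meet L le S \<in> L" "f (lat_meet L le S) = m"
proof -
  have L': "L' = f ` L" using f by (simp add: bij_betw_def)
  obtain k where k: "k \<in> L" "f k = m" using m L' by (auto simp: is_glb_def)
  have "lat_meet L le S = k" unfolding lat_meet_def
  proof (rule the_equality)
    show P: "k \<in> L \<and> (\<forall>s\<in>S. le k s) \<and> (\<forall>z\<in>L. (\<forall>s\<in>S. le z s) \<longrightarrow> le z k)"
    proof (intro conjI ballI impI)
      show "le k s" if "s \<in> S" for s
        using that m k le[of k s] S by (auto simp: is_glb_def)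
      show "le z k" if "z \<in> L" "\<forall>s\<in>S. le z s" for z
      proof -
        have "\<forall>s\<in>f ` S. le' (f z) s" using that le S by blast
        hence "le' (f z) m" using m L' that(1) unfolding is_glb_def by blast
        thus ?thesis using le[of z k] that k by simp
      qed
    qed (rule k)
    fix l assume l: "l \<in> L \<and> (\<forall>s\<in>S. le l s) \<and> (\<forall>z\<in>L. (\<forall>s\<in>S. le z s) \<longrightarrow> le z l)"
    hence "le l k" "le k l" using P by blast+
    hence "f l = f k" using anti[of "f l" "f k"] le l k L' by auto
    thus "l = k" using f l k by (auto simp: bij_betw_def inj_on_def)
  qed
  thus "lat_meet L le S \<in> L" "f (lat_meet L le S) = m" using k by auto
qed

definition bvec_top :: "nat \<Rightarrow> nat \<Rightarrow> nat" where
  "bvec_top n b = (if b \<in> {1..n} then n else b)"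

lemma bvec_top_in: "bvec_top n \<in> bvec n"
  by (auto simp: bvec_def bvec_top_def split: if_splits)

lemma bvec_top_ge: "R \<in> bvec n \<Longrightarrow> R \<le> bvec_top n"
  using bvec_le[of R n] bvec_outside[of R n] by (simp add: le_fun_def bvec_top_def)

lemma bvec_bot_in: "(\<lambda>b. b) \<in> bvec n"
  by (auto simp: bvec_def)

lemma tamari_top: "lat_top (tamari n) (weak_le n) \<in> tamari n" "bvec_of n (lat_top (tamari n) (weak_le n)) = bvec_top n"
proof -
  obtain t where t: "t \<in> tamari n" "bvec_of n t = bvec_top n" using bvec_of_surj[OF bvec_top_in] by auto
  have ge: "weak_le n x t" if "x \<in> tamari n" for x
    using weak_le_iff_bvec_of[OF that t(1)] bvec_top_ge[OF bvec_of_in[OF that]] t(2) by simp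
  have "lat_top (tamari n) (weak_le n) = t" unfolding lat_top_def
  proof (rule the_equality)
    fix s assume s: "s \<in> tamari n \<and> (\<forall>x\<in>tamari n. weak_le n x s)"
    hence "bvec_of n s = bvec_of n t" using ge[of s] t weak_le_iff_bvec_of[of s n t] weak_le_iff_bvec_of[of t n s]
      by (intro antisym) auto
    thus "s = t" using bij_betw_bvec_of s t by (auto simp: bij_betw_def inj_on_def)
  qed (use ge t in auto)
  thus "lat_top (tamari n) (weak_le n) \<in> tamari n" "bvec_of n (lat_top (tamari n) (weak_le n)) = bvec_top n"
    using t by auto
qed

lemma tamari_bot: "lat_bot (tamari n) (weak_le n) \<in> tamari n" "bvec_of n (lat_bot (tamari n) (weak_le n)) = (\<lambda>b. b)"
proof -
  obtain t where t: "t \<in> tamari n" "bvec_of n t = (\<lambda>b. b)" using bvec_of_surj[OF bvec_bot_in] by auto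
  have ge: "weak_le n t x" if "x \<in> tamari n" for x
    using weak_le_iff_bvec_of[OF t(1) that] bvec_ge[OF bvec_of_in[OF that]] t(2) by (simp add: le_fun_def)
  have "lat_bot (tamari n) (weak_le n) = t" unfolding lat_bot_def
  proof (rule the_equality)
    fix s assume s: "s \<in> tamari n \<and> (\<forall>x\<in>tamari n. weak_le n s x)"
    hence "bvec_of n s = bvec_of n t" using ge[of s] t weak_le_iff_bvec_of[of s n t] weak_le_iff_bvec_of[of t n s]
      by (intro antisym) auto
    thus "s = t" using bij_betw_bvec_of s t by (auto simp: bij_betw_def inj_on_def)
  qed (use ge t in auto)
  thus "lat_bot (tamari n) (weak_le n) \<in> tamari n" "bvec_of n (lat_bot (tamari n) (weak_le n)) = (\<lambda>b. b)"
    using t by auto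
qed

text \<open>The chain draws a bit for every lower cover. Lower covers correspond to the nodes with
  \<open>b < R b\<close>, and \<open>eject\<close> ignores the bits of the others, so a bit may be
  drawn for every node.\<close>

lemma tamari_step:
  assumes x: "x \<in> tamari n"
  shows "map_pmf (bvec_of n) (ungarian_step (tamari n) (weak_le n) p x) =
           map_pmf (eject (bvec_of n x)) (Pi_pmf {1..n} False (\<lambda>_. bernoulli_pmf p))"
    and "set_pmf (ungarian_step (tamari n) (weak_le n) p x) \<subseteq> tamari n"
proof -
  define R where "R = bvec_of n x"
  have R: "R \<in> bvec n" unfolding R_def by (rule bvec_of_in[OF x])
  define A where "A = {b. b < R b}"
  define C where "C = lat_cov (tamari n) (weak_le n) x"
  have A: "A \<subseteq> {1..n}" using bvec_outside[OF R] by (force simp: A_def)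
  hence finA: "finite A" by (rule finite_subset) simp
  have C: "C \<subseteq> tamari n" by (auto simp: C_def lat_cov_def)
  have xC: "x \<notin> C" by (auto simp: C_def lat_cov_def lat_lt_def)
  have inj\<phi>: "inj_on (bvec_of n) (tamari n)" using bij_betw_bvec_of by (simp add: bij_betw_def)
  have im: "bvec_of n ` C = (\<lambda>b. eject R (\<lambda>c. c = b)) ` A"
    unfolding C_def A_def R_def bvec_cov[OF bvec_of_in[OF x], symmetric]
    by (rule lat_cov_iso[where le = "weak_le n" and le' = "(\<le>)", OF bij_betw_bvec_of weak_le_iff_bvec_of x])
  \<comment> \<open>The value \<open>x\<close> outside \<open>A\<close> is not one of the covers, as
    the reindexing rule \<open>Pi_pmf_bij_betw\<close> demands.\<close>
  define h where "h = (\<lambda>b. if b \<in> A then inv_into (tamari n) (bvec_of n) (eject R (\<lambda>c. c = b)) else x)"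
  have h: "bvec_of n (h b) = eject R (\<lambda>c. c = b)" if "b \<in> A" for b
    using that eject_bvec[OF R] bij_betw_bvec_of[of n] unfolding h_def bij_betw_def
    by (simp add: f_inv_into_f[of _ "bvec_of n" "tamari n"])
  have htam: "h b \<in> tamari n" for b
    using eject_bvec[OF R] bij_betw_bvec_of[of n] x unfolding h_def
    by (auto simp: bij_betw_def intro!: inv_into_into)
  have hC: "h ` A = C"
  proof -
    have "bvec_of n ` (h ` A) = bvec_of n ` C"
      unfolding im image_image using h by (intro image_cong) auto
    thus ?thesis using inj_on_image_eq_iff[OF inj\<phi>] htam C by (metis image_subsetI)
  qed
  have "inj_on h A"
  proof (rule inj_onI)
    fix b c assume bc: "b \<in> A" "c \<in> A" "h b = h c"
    hence "eject R (\<lambda>d. d = b) b = eject R (\<lambda>d. d = c) b" using h by metis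
    moreover have "eject R (\<lambda>d. d = b) b < R b" using bc by (intro eject_less[OF R]) (auto simp: A_def)
    ultimately show "b = c" by (auto simp: eject_def split: if_splits)
  qed
  hence bij: "bij_betw h A C" using hC by (simp add: bij_betw_def)
  have Pi: "Pi_pmf A False (\<lambda>_. bernoulli_pmf p) = map_pmf (\<lambda>g. g \<circ> h) (Pi_pmf C False (\<lambda>_. bernoulli_pmf p))"
    by (rule Pi_pmf_bij_betw[OF finA bij]) (use xC in \<open>auto simp: h_def\<close>)
  have meet: "lat_meet (tamari n) (weak_le n) (insert x {y \<in> C. f y}) \<in> tamari n"
    "bvec_of n (lat_meet (tamari n) (weak_le n) (insert x {y \<in> C. f y})) = eject R (f \<circ> h)" for f
  proof -
    have "bvec_of n ` {y \<in> C. f y} = {eject R (\<lambda>c. c = b) | b. b < R b \<and> (f \<circ> h) b}"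
    proof -
      have "{y \<in> C. f y} = h ` {b \<in> A. f (h b)}" using hC by auto
      hence "bvec_of n ` {y \<in> C. f y} = (\<lambda>b. eject R (\<lambda>c. c = b)) ` {b \<in> A. f (h b)}"
        using h by (auto simp: image_image)
      thus ?thesis by (auto simp: A_def)
    qed
    hence glb: "is_glb (bvec n) (\<le>) (bvec_of n ` insert x {y \<in> C. f y}) (eject R (f \<circ> h))"
      using bvec_glb[OF R, of "f \<circ> h"] by (simp add: R_def)
    have "insert x {y \<in> C. f y} \<subseteq> tamari n" using C x by auto
    note lat_meet_iso[where le = "weak_le n" and le' = "(\<le>)", OF bij_betw_bvec_of weak_le_iff_bvec_of this glb]
    thus "lat_meet (tamari n) (weak_le n) (insert x {y \<in> C. f y}) \<in> tamari n"
    "bvec_of n (lat_meet (tamari n) (weak_le n) (insert x {y \<in> C. f y})) = eject R (f \<circ> h)" by auto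
  qed
  show "set_pmf (ungarian_step (tamari n) (weak_le n) p x) \<subseteq> tamari n"
    unfolding ungarian_step_def using meet(1) by (auto simp: C_def)
  have "map_pmf (bvec_of n) (ungarian_step (tamari n) (weak_le n) p x) =
      map_pmf (\<lambda>f. eject R (f \<circ> h)) (Pi_pmf C False (\<lambda>_. bernoulli_pmf p))"
    unfolding ungarian_step_def map_pmf_comp C_def[symmetric] meet(2) ..
  also have "\<dots> = map_pmf (eject R) (Pi_pmf A False (\<lambda>_. bernoulli_pmf p))"
    unfolding Pi map_pmf_comp by simp
  also have "\<dots> = map_pmf (\<lambda>f. eject R (\<lambda>b. if b \<in> A then f b else False)) (Pi_pmf {1..n} False (\<lambda>_. bernoulli_pmf p))"
    by (subst Pi_pmf_subset[OF _ A]) (simp_all add: map_pmf_comp)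
  also have "(\<lambda>f. eject R (\<lambda>b. if b \<in> A then f b else False)) = eject R"
    by (auto simp: eject_def A_def fun_eq_iff)
  finally show "map_pmf (bvec_of n) (ungarian_step (tamari n) (weak_le n) p x) =
           map_pmf (eject (bvec_of n x)) (Pi_pmf {1..n} False (\<lambda>_. bernoulli_pmf p))"
    by (simp add: R_def)
qed

section \<open>The chain as a function of independent bits\<close>

text \<open>The bit \<open>\<omega> (b, t)\<close> is the coin of node \<open>b\<close> at time
  \<open>t\<close>. One array of coins drives all times, so events about different times live on one
  probability space.\<close>

primrec run :: "nat \<Rightarrow> (nat \<times> nat \<Rightarrow> bool) \<Rightarrow> nat \<Rightarrow> nat \<Rightarrow> nat" where
  "run n \<omega> 0 = bvec_top n"
| "run n \<omega> (Suc t) = eject (run n \<omega> t) (\<lambda>b. \<omega> (b, t))"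

definition bits_pmf :: "real \<Rightarrow> 'a set \<Rightarrow> ('a \<Rightarrow> bool) pmf" where
  "bits_pmf p I = Pi_pmf I False (\<lambda>_. bernoulli_pmf p)"

lemma run_cong:
  assumes "\<And>b s. s < t \<Longrightarrow> b \<in> {1..n} \<Longrightarrow> \<omega> (b, s) = \<omega>' (b, s)"
  shows "run n \<omega> t = run n \<omega>' t"
  using assms
proof (induction t)
  case (Suc t)
  have "run n \<omega> t \<in> bvec n" for \<omega> t by (induction t) (simp_all add: bvec_top_in eject_bvec)
  hence out: "\<not> b < run n \<omega>' t b" if "b \<notin> {1..n}" for b using bvec_outside[OF _ that] by (metis less_irrefl)
  have "eject (run n \<omega>' t) (\<lambda>b. \<omega> (b, t)) b = eject (run n \<omega>' t) (\<lambda>b. \<omega>' (b, t)) b" for b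
    using out[of b] Suc.prems[of t b] by (cases "b \<in> {1..n}") (simp_all add: eject_def)
  thus ?case using Suc by auto
qed simp

lemma dist_eq_run:
  "map_pmf (bvec_of n) (ungarian_dist (tamari n) (weak_le n) p t) =
     map_pmf (\<lambda>\<omega>. run n \<omega> t) (bits_pmf p ({1..n} \<times> {..<t})) \<and>
   set_pmf (ungarian_dist (tamari n) (weak_le n) p t) \<subseteq> tamari n"
proof (induction t)
  case 0
  thus ?case using tamari_top[of n] by (simp add: ungarian_dist_def bits_pmf_def)
next
  case (Suc t)
  let ?D = "ungarian_dist (tamari n) (weak_le n) p"
  let ?S = "ungarian_step (tamari n) (weak_le n) p"
  let ?P = "\<lambda>I. Pi_pmf I False (\<lambda>_. bernoulli_pmf p)"
  have D: "?D (Suc t) = bind_pmf (?D t) ?S" by (simp add: ungarian_dist_def)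
  have sub: "set_pmf (?D t) \<subseteq> tamari n" using Suc by simp
  have "set_pmf (?D (Suc t)) \<subseteq> tamari n" unfolding D using sub tamari_step(2)[of _ n p] by fastforce
  have U: "{1..n} \<times> {..<Suc t} = {1..n} \<times> {..<t} \<union> {1..n} \<times> {t}" by auto
  have bij: "?P {1..n} = map_pmf (\<lambda>g. g \<circ> (\<lambda>b. (b, t))) (?P ({1..n} \<times> {t}))"
    by (rule Pi_pmf_bij_betw) (auto simp: bij_betw_def inj_on_def)
  have "map_pmf (bvec_of n) (?D (Suc t)) = bind_pmf (?D t) (\<lambda>x. map_pmf (bvec_of n) (?S x))"
    unfolding D by (simp add: map_bind_pmf)
  also have "\<dots> = bind_pmf (?D t) (\<lambda>x. map_pmf (eject (bvec_of n x)) (?P {1..n}))"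
    using tamari_step(1) sub by (intro bind_pmf_cong) auto
  also have "\<dots> = bind_pmf (map_pmf (bvec_of n) (?D t)) (\<lambda>R. map_pmf (eject R) (?P {1..n}))"
    by (simp add: bind_map_pmf)
  also have "\<dots> = bind_pmf (?P ({1..n} \<times> {..<t})) (\<lambda>\<omega>. map_pmf (eject (run n \<omega> t)) (?P {1..n}))"
    using Suc by (simp add: bind_map_pmf bits_pmf_def)
  also have "\<dots> = bind_pmf (?P ({1..n} \<times> {..<t})) (\<lambda>\<omega>. bind_pmf (?P ({1..n} \<times> {t}))
      (\<lambda>g. return_pmf (eject (run n \<omega> t) (\<lambda>b. g (b, t)))))"
    unfolding bij by (simp add: map_pmf_comp map_pmf_def[symmetric] o_def)
  also have "\<dots> = bind_pmf (?P ({1..n} \<times> {..<t})) (\<lambda>\<omega>. bind_pmf (?P ({1..n} \<times> {t}))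
      (\<lambda>g. return_pmf (run n (\<lambda>x. if x \<in> {1..n} \<times> {..<t} then \<omega> x else g x) (Suc t))))"
  proof (intro bind_pmf_cong refl)
    fix \<omega> g :: "nat \<times> nat \<Rightarrow> bool"
    let ?c = "\<lambda>x. if x \<in> {1..n} \<times> {..<t} then \<omega> x else g x"
    have "run n ?c t = run n \<omega> t" by (rule run_cong) auto
    thus "return_pmf (eject (run n \<omega> t) (\<lambda>b. g (b, t))) = return_pmf (run n ?c (Suc t))" by simp
  qed
  also have "\<dots> = map_pmf (\<lambda>\<omega>. run n \<omega> (Suc t)) (?P ({1..n} \<times> {..<Suc t}))"
    unfolding U by (subst Pi_pmf_union)
      (auto simp: pair_pmf_def map_bind_pmf map_pmf_def bind_assoc_pmf bind_return_pmf simp del: run.simps)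
  finally show ?case using \<open>set_pmf (?D (Suc t)) \<subseteq> tamari n\<close> by (simp only: bits_pmf_def simp_thms)
qed

text \<open>The horizon \<open>H\<close> does not depend on \<open>t\<close>; thus a single event
  over the coins up to \<open>H\<close> can bound the probabilities for all
  \<open>t \<le> H\<close>.\<close>

lemma prob_not_bot:
  assumes "t \<le> H"
  shows "measure_pmf.prob (ungarian_dist (tamari n) (weak_le n) p t) {x. x \<noteq> lat_bot (tamari n) (weak_le n)} =
         measure_pmf.prob (bits_pmf p ({1..n} \<times> {..<H})) {\<omega>. \<exists>b. b < run n \<omega> t b}"
proof -
  let ?D = "ungarian_dist (tamari n) (weak_le n) p t"
  let ?b = "lat_bot (tamari n) (weak_le n)"
  have sub: "set_pmf ?D \<subseteq> tamari n" and eq: "map_pmf (bvec_of n) ?D = map_pmf (\<lambda>\<omega>. run n \<omega> t) (bits_pmf p ({1..n} \<times> {..<t}))"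
    using dist_eq_run by auto
  have "measure_pmf.prob ?D {x. x \<noteq> ?b} = measure_pmf.prob ?D {x. \<exists>b. b < bvec_of n x b}"
  proof (rule measure_pmf.finite_measure_eq_AE)
    show "AE x in ?D. (x \<in> {x. x \<noteq> ?b}) = (x \<in> {x. \<exists>b. b < bvec_of n x b})"
    proof (rule AE_pmfI)
      fix x assume "x \<in> set_pmf ?D"
      hence x: "x \<in> tamari n" using sub by auto
      have "x = ?b \<longleftrightarrow> bvec_of n x = bvec_of n ?b"
        using bij_betw_bvec_of x tamari_bot(1) by (auto simp: bij_betw_def inj_on_def)
      also have "\<dots> \<longleftrightarrow> \<not> (\<exists>b. b < bvec_of n x b)"
        unfolding tamari_bot(2) using bvec_ge[OF bvec_of_in[OF x]] by (force simp: fun_eq_iff order.order_iff_strict)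
      finally show "(x \<in> {x. x \<noteq> ?b}) = (x \<in> {x. \<exists>b. b < bvec_of n x b})" by simp
    qed
  qed auto
  also have "\<dots> = measure_pmf.prob (map_pmf (bvec_of n) ?D) {R. \<exists>b. b < R b}" by simp
  also have "\<dots> = measure_pmf.prob (bits_pmf p ({1..n} \<times> {..<t})) {\<omega>. \<exists>b. b < run n \<omega> t b}"
    unfolding eq by simp
  also have "bits_pmf p ({1..n} \<times> {..<t}) =
      map_pmf (\<lambda>f x. if x \<in> {1..n} \<times> {..<t} then f x else False) (bits_pmf p ({1..n} \<times> {..<H}))"
    unfolding bits_pmf_def by (rule Pi_pmf_subset) (use assms in auto)
  also have "measure_pmf.prob \<dots> {\<omega>. \<exists>b. b < run n \<omega> t b} =
      measure_pmf.prob (bits_pmf p ({1..n} \<times> {..<H})) {\<omega>. \<exists>b. b < run n \<omega> t b}"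
  proof -
    have "run n (\<lambda>x. if x \<in> {1..n} \<times> {..<t} then f x else False) t = run n f t" for f
      by (rule run_cong) auto
    thus ?thesis by simp
  qed
  finally show ?thesis .
qed


section \<open>A deterministic condition for survival\<close>

definition cnt :: "(nat \<times> nat \<Rightarrow> bool) \<Rightarrow> nat \<Rightarrow> nat \<Rightarrow> nat \<Rightarrow> nat" where
  "cnt \<omega> c s t = card {u \<in> {s..<t}. \<omega> (c, u)}"

lemma cnt_Suc: "s \<le> t \<Longrightarrow> cnt \<omega> c s (Suc t) = cnt \<omega> c s t + (if \<omega> (c, t) then 1 else 0)"
proof -
  assume "s \<le> t"
  hence "{u \<in> {s..<Suc t}. \<omega> (c, u)} = {u \<in> {s..<t}. \<omega> (c, u)} \<union> (if \<omega> (c, t) then {t} else {})"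
    by (auto simp: less_Suc_eq)
  thus ?thesis by (auto simp: cnt_def card_insert_if)
qed

lemma cnt_self [simp]: "cnt \<omega> c s s = 0"
  by (simp add: cnt_def)

lemma cnt_mono: "t \<le> t' \<Longrightarrow> cnt \<omega> c s t \<le> cnt \<omega> c s t'"
  unfolding cnt_def by (intro card_mono) auto

lemma cnt_split: "s \<le> t \<Longrightarrow> t \<le> u \<Longrightarrow> cnt \<omega> c s u = cnt \<omega> c s t + cnt \<omega> c t u"
proof (induction u)
  case (Suc u)
  thus ?case by (cases "t \<le> u") (auto simp: cnt_Suc le_Suc_eq)
qed auto

lemma cnt_le: "cnt \<omega> c s t \<le> t - s"
proof -
  have "cnt \<omega> c s t \<le> card {s..<t}" unfolding cnt_def by (intro card_mono) auto
  thus ?thesis by simp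
qed

lemma cnt_pos_iff: "cnt \<omega> c s t \<ge> 1 \<longleftrightarrow> (\<exists>u. s \<le> u \<and> u < t \<and> \<omega> (c, u))"
  unfolding cnt_def by (auto simp: Suc_le_eq card_gt_0_iff)

lemma run_bvec: "run n \<omega> t \<in> bvec n"
  by (induction t) (simp_all add: bvec_top_in eject_bvec)

lemma run_inactive: "b \<in> {1..n} \<Longrightarrow> (\<And>s. s < t \<Longrightarrow> \<not> \<omega> (b, s)) \<Longrightarrow> run n \<omega> t b = n"
  by (induction t) (auto simp: bvec_top_def eject_def)

lemma run_last: "1 \<le> n \<Longrightarrow> run n \<omega> t n = n"
  using bvec_ge[OF run_bvec, of n n] bvec_le[OF run_bvec, of n n] by (metis le_antisym order_refl)

lemma run_Suc_le: "run n \<omega> (Suc t) b \<le> run n \<omega> t b"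
  using eject_le[OF run_bvec] by simp

text \<open>Every activation costs at least one until the node is a leaf. This limits the lifetime
  of the chain and will give summability.\<close>

lemma run_le_cnt: "b \<le> n \<Longrightarrow> run n \<omega> t b \<le> max b (n - cnt \<omega> b 0 t)"
proof (induction t)
  case 0
  thus ?case by (auto simp: bvec_top_def)
next
  case (Suc t)
  show ?case
  proof (cases "\<omega> (b, t) \<and> b < run n \<omega> t b")
    case True
    hence "run n \<omega> (Suc t) b < run n \<omega> t b" using eject_less[OF run_bvec] by simp
    thus ?thesis using Suc True by (auto simp: cnt_Suc)
  next
    case False
    thus ?thesis using Suc run_Suc_le[of n \<omega> t b] by (auto simp: cnt_Suc simp del: run.simps)
  qed
qed

text \<open>As long as \<open>\<alpha>\<close> has not been activated, the last child of every \<open>c < \<alpha>\<close> that was never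
  activated either is at most \<open>\<alpha>\<close>, so the first ejection by \<open>c\<close> skips everything from \<open>\<alpha>\<close> on.\<close>

lemma run_le_stage:
  assumes c: "1 \<le> c" "c < \<alpha>" "\<alpha> \<le> n" and \<alpha>: "\<And>t. t < T \<Longrightarrow> run n \<omega> t \<alpha> = n"
    and act: "s < T" "\<omega> (c, s)"
  shows "cnt \<omega> c 0 t \<ge> 1 \<Longrightarrow> run n \<omega> t c \<le> max c (\<alpha> - cnt \<omega> c 0 t)"
proof (induction t)
  case 0
  thus ?case by (simp add: cnt_def)
next
  case (Suc t)
  show ?case
  proof (cases "\<omega> (c, t)")
    case False
    thus ?thesis using Suc run_Suc_le[of n \<omega> t c] by (auto simp: cnt_Suc simp del: run.simps)
  next
    case True
    show ?thesis
    proof (cases "cnt \<omega> c 0 t \<ge> 1")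
      case ge: True
      show ?thesis
      proof (cases "c < run n \<omega> t c")
        case True
        hence "run n \<omega> (Suc t) c < run n \<omega> t c" using \<open>\<omega> (c, t)\<close> eject_less[OF run_bvec] by simp
        thus ?thesis using Suc.IH[OF ge] by (auto simp: cnt_Suc \<open>\<omega> (c, t)\<close> simp del: run.simps)
      next
        case False
        thus ?thesis using run_Suc_le[of n \<omega> t c] by auto
      qed
    next
      case lt: False
      hence no: "\<not> \<omega> (c, u)" if "u < t" for u using that cnt_pos_iff[of \<omega> c 0 t] by auto
      hence "t < T" using act by (meson le_less_trans not_less)
      have rc: "run n \<omega> t c = n" by (rule run_inactive) (use no c in auto)
      have "last_child (run n \<omega> t) c \<le> \<alpha>"
        by (rule last_child_le) (use c rc \<alpha>[OF \<open>t < T\<close>] in auto)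
      hence "run n \<omega> (Suc t) c \<le> \<alpha> - 1" using True rc c by (auto simp: eject_def)
      thus ?thesis using lt True by (auto simp: cnt_Suc simp del: run.simps)
    qed
  qed
qed

text \<open>The clock is the number of activations of \<open>b\<close>, not time: only activations
  of \<open>b\<close> can lower its end, so bounds in terms of them carry over from one region to
  the next.\<close>

definition reach :: "nat \<Rightarrow> (nat \<times> nat \<Rightarrow> bool) \<Rightarrow> nat \<Rightarrow> nat \<Rightarrow> nat \<Rightarrow> bool" where
  "reach n \<omega> b m y \<longleftrightarrow> (\<forall>t. cnt \<omega> b 0 t \<le> m \<longrightarrow> y \<le> run n \<omega> t b)"

lemma reach_weaken: "reach n \<omega> b m y \<Longrightarrow> m' \<le> m \<Longrightarrow> y' \<le> y \<Longrightarrow> reach n \<omega> b m' y'"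
  unfolding reach_def using le_trans by blast

text \<open>The ejected child ends where \<open>b\<close> does, at \<open>y\<close> or beyond. When
  all nodes strictly between \<open>b\<close> and \<open>y\<close> end before \<open>y\<close>, that
  child starts at \<open>y\<close> or later, and so the new end is at least
  \<open>y - 1\<close>.\<close>

lemma reach_Suc:
  assumes r: "reach n \<omega> b m y"
    and av: "\<And>t c. cnt \<omega> b 0 t = m \<Longrightarrow> \<omega> (b, t) \<Longrightarrow> b < c \<Longrightarrow> c < y \<Longrightarrow> run n \<omega> t c < y"
  shows "reach n \<omega> b (Suc m) (y - 1)"
  unfolding reach_def
proof (intro allI impI)
  fix t assume "cnt \<omega> b 0 t \<le> Suc m"
  thus "y - 1 \<le> run n \<omega> t b"
  proof (induction t)
    case 0
    have "y \<le> run n \<omega> 0 b" using r cnt_self[of \<omega> b 0] unfolding reach_def by (metis le0)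
    thus ?case by simp
  next
    case (Suc t)
    show ?case
    proof (cases "\<omega> (b, t) \<and> b < run n \<omega> t b")
      case True
      hence le: "cnt \<omega> b 0 t \<le> m" using Suc.prems by (simp add: cnt_Suc)
      hence y: "y \<le> run n \<omega> t b" using r by (auto simp: reach_def)
      show ?thesis
      proof (cases "cnt \<omega> b 0 t = m")
        case eq: True
        note lc = last_child[OF run_bvec, of b n \<omega> t]
        have "\<not> last_child (run n \<omega> t) b < y"
          using av[OF eq, of "last_child (run n \<omega> t) b"] lc True y by auto
        thus ?thesis using True by (auto simp: eject_def)
      next
        case False
        hence "cnt \<omega> b 0 (Suc t) \<le> m" using le by (simp add: cnt_Suc)
        hence "y \<le> run n \<omega> (Suc t) b" using r unfolding reach_def by blast
        thus ?thesis by simp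
      qed
    next
      case False
      have "cnt \<omega> b 0 t \<le> Suc m" using Suc.prems cnt_mono[of t "Suc t" \<omega> b 0] by simp
      thus ?thesis using False Suc.IH by (auto simp: eject_def)
    qed
  qed
qed

text \<open>By \<open>run_le_stage\<close>, a node between \<open>b\<close> and
  \<open>\<alpha>\<close> with \<open>i + 1\<close> activations has fallen behind
  \<open>\<alpha> - i\<close> or started there. The times in \<open>race\<close>, with monotonicity
  of \<open>cnt\<close>, ensure that all have reached this count when \<open>b\<close> spends its
  activation number \<open>\<mu> + i + 1\<close>, which then costs only one node.\<close>

lemma reach_stage:
  assumes r: "reach n \<omega> b \<mu> \<alpha>" and b: "1 \<le> b" and an: "\<alpha> \<le> n"
    and \<alpha>: "\<And>t. t < T \<Longrightarrow> run n \<omega> t \<alpha> = n"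
    and act: "\<And>c. b < c \<Longrightarrow> c < \<alpha> \<Longrightarrow> \<exists>s<T. \<omega> (c, s)"
    and race: "\<And>i. i < r \<Longrightarrow> \<exists>s. cnt \<omega> b 0 s \<le> \<mu> + i \<and> (\<forall>c. b < c \<longrightarrow> c < \<alpha> \<longrightarrow> i + 1 \<le> cnt \<omega> c 0 s)"
  shows "reach n \<omega> b (\<mu> + r) (\<alpha> - r)"
  using race
proof (induction r)
  case (Suc r)
  have IH: "reach n \<omega> b (\<mu> + r) (\<alpha> - r)" using Suc by auto
  obtain s where s: "cnt \<omega> b 0 s \<le> \<mu> + r" "\<And>c. b < c \<Longrightarrow> c < \<alpha> \<Longrightarrow> r + 1 \<le> cnt \<omega> c 0 s"
    using Suc.prems[of r] by auto
  have "reach n \<omega> b (Suc (\<mu> + r)) (\<alpha> - r - 1)"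
  proof (rule reach_Suc[OF IH])
    fix t c assume t: "cnt \<omega> b 0 t = \<mu> + r" "\<omega> (b, t)" and c: "b < c" "c < \<alpha> - r"
    have "s \<le> t"
    proof (rule ccontr)
      assume "\<not> s \<le> t"
      hence "cnt \<omega> b 0 (Suc t) \<le> cnt \<omega> b 0 s" by (intro cnt_mono) simp
      thus False using t s(1) by (simp add: cnt_Suc)
    qed
    hence ge: "r + 1 \<le> cnt \<omega> c 0 t" using s(2)[of c] cnt_mono[of s t \<omega> c 0] c \<open>s \<le> t\<close> by linarith
    have "c < \<alpha>" using c by linarith
    then obtain s' where "s' < T" "\<omega> (c, s')" using act[of c] c by auto
    hence "run n \<omega> t c \<le> max c (\<alpha> - cnt \<omega> c 0 t)"
      using b c an ge by (intro run_le_stage[where T = T] \<alpha>) auto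
    thus "run n \<omega> t c < \<alpha> - r" using ge c by auto
  qed
  thus ?case by (simp add: algebra_simps)
qed (use r in simp)

text \<open>If the others need at most \<open>A\<close> steps per further activation,
  \<open>b\<close> with head start \<open>m\<close> wins a region for \<open>m div A + 1\<close>
  more activations: one because they all started before \<open>T\<close>, the rest because
  \<open>b\<close> needs at least one step for each of its \<open>m\<close> activations.\<close>

primrec head_start :: "nat \<Rightarrow> nat \<Rightarrow> nat" where
  "head_start A 0 = 0"
| "head_start A (Suc k) = head_start A k + head_start A k div A + 1"

lemma head_start_add:
  assumes "A > 0"
  shows "head_start A k + j * (head_start A k div A + 1) \<le> head_start A (k + j)"
proof (induction j)
  case (Suc j)
  have "head_start A k \<le> head_start A (k + j)" using Suc by simp
  hence "head_start A k div A \<le> head_start A (k + j) div A" by (rule div_le_mono)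
  thus ?case using Suc by simp
qed simp

text \<open>\<open>A\<close> regions double the head start, since the \<open>A\<close> increments
  are at least \<open>m div A + 1\<close> each.\<close>

lemma head_start_ge:
  assumes "A > 0" shows "2 ^ e \<le> head_start A (Suc (A * e))"
proof (induction e)
  case (Suc e)
  let ?m = "head_start A (Suc (A * e))"
  have "?m + A * (?m div A + 1) \<le> head_start A (Suc (A * e) + A)"
    by (rule head_start_add[OF assms])
  moreover have "?m \<le> A * (?m div A + 1)"
    using dividend_less_times_div[OF assms, of ?m] by simp
  ultimately have "2 * ?m \<le> head_start A (Suc (A * e) + A)" by linarith
  thus ?case using Suc by (simp add: algebra_simps)
qed simp

text \<open>The late nodes \<open>\<alpha> 1 > \<alpha> 2 > \<dots>\<close> separate the regions, and \<open>b\<close> may enter region \<open>k\<close> after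
  \<open>\<mu>\<close> activations. The race in that region is won for \<open>i\<close> nodes if some time is too early for
  \<open>\<mu> + i + 1\<close> activations of \<open>b\<close>, but late enough for \<open>i + 1\<close> activations of all others. For
  \<open>\<mu> < 2D\<close> this time is \<open>T + \<mu> + i\<close>, where \<open>b\<close> is trivially not too fast; afterwards it is
  \<open>T + \<sigma> \<mu> i\<close> with \<open>\<sigma> \<mu> i \<approx> (i + \<mu>/2) / p\<close>.\<close>

lemma survival:
  assumes b: "1 \<le> b" "b < \<alpha> K" and \<alpha>0: "\<alpha> 0 = n" and gap: "\<And>k. k < K \<Longrightarrow> \<alpha> (Suc k) + h \<le> \<alpha> k"
    and late_b: "\<And>s. s < T \<Longrightarrow> \<not> \<omega> (b, s)"
    and late_\<alpha>: "\<And>k s. 0 < k \<Longrightarrow> k \<le> K \<Longrightarrow> Suc s < T \<Longrightarrow> \<not> \<omega> (\<alpha> k, s)"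
    and act: "\<And>c. b < c \<Longrightarrow> c \<le> n \<Longrightarrow> \<exists>s<T. \<omega> (c, s)"
    and early: "\<And>c i. b < c \<Longrightarrow> c \<le> n \<Longrightarrow> 1 \<le> i \<Longrightarrow> i \<le> 2 * D div A \<Longrightarrow> i + 1 \<le> cnt \<omega> c 0 (T + A * i)"
    and late: "\<And>c \<mu> i. b < c \<Longrightarrow> c \<le> n \<Longrightarrow> D \<le> \<mu> \<Longrightarrow> \<mu> \<le> h \<Longrightarrow> i \<le> h \<Longrightarrow> (i + \<mu>) * D \<le> \<mu>\<^sup>2 \<Longrightarrow>
        i + 1 \<le> cnt \<omega> c T (T + \<sigma> \<mu> i)"
    and late': "\<And>\<mu> i. D \<le> \<mu> \<Longrightarrow> \<mu> \<le> h \<Longrightarrow> i \<le> h \<Longrightarrow> (i + \<mu>) * D \<le> \<mu>\<^sup>2 \<Longrightarrow>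
        cnt \<omega> b T (T + \<sigma> \<mu> i) \<le> \<mu> + i"
    and A: "A > 0" and D: "2 * D \<le> 2 ^ e" "2 * D + 1 \<le> h" and K: "K = Suc (A * e) + e'"
    and h: "h \<le> D * 2 ^ (2 ^ e')" and t: "t \<le> h"
  shows "b < run n \<omega> t b"
proof -
  have \<alpha>_le: "j \<le> K \<Longrightarrow> i \<le> j \<Longrightarrow> \<alpha> j \<le> \<alpha> i" for i j
  proof (induction j)
    case (Suc j)
    show ?case
    proof (cases "i = Suc j")
      case False
      hence "\<alpha> j \<le> \<alpha> i" using Suc by auto
      thus ?thesis using gap[of j] Suc.prems by auto
    qed simp
  qed simp
  have \<alpha>n: "\<alpha> k \<le> n" "b < \<alpha> k" if "k \<le> K" for k
    using \<alpha>_le[OF that, of 0] \<alpha>_le[of K k] that \<alpha>0 b by auto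
  \<comment> \<open>The state at a time \<open>s < T\<close> depends on coins up to time
    \<open>T - 2\<close> only. This is why the separators may be activated at time
    \<open>T - 1\<close>, one step before \<open>b\<close>.\<close>
  have top: "run n \<omega> s (\<alpha> k) = n" if "k \<le> K" "s < T" for k s
  proof (cases "k = 0")
    case True
    thus ?thesis using \<alpha>0 \<alpha>n[OF that(1)] b run_last by simp
  next
    case False
    show ?thesis
      by (rule run_inactive) (use that False late_\<alpha>[of k] \<alpha>n[OF that(1)] b in auto)
  qed
  \<comment> \<open>A region costs \<open>b\<close> at most \<open>h\<close> nodes, the guaranteed
    distance to the next separator, so \<open>b\<close> still reaches that separator when it leaves
    the region.\<close>
  have stage: "reach n \<omega> b \<mu>' (\<alpha> (Suc k))"
    if r: "reach n \<omega> b \<mu> (\<alpha> k)" and k: "k < K" and \<mu>': "\<mu>' - \<mu> \<le> h"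
      and race: "\<And>i. \<mu> + i < \<mu>' \<Longrightarrow> \<exists>s. cnt \<omega> b 0 s \<le> \<mu> + i \<and> (\<forall>c. b < c \<longrightarrow> c < \<alpha> k \<longrightarrow> i + 1 \<le> cnt \<omega> c 0 s)"
    for \<mu> \<mu>' k
  proof -
    have "reach n \<omega> b (\<mu> + (\<mu>' - \<mu>)) (\<alpha> k - (\<mu>' - \<mu>))"
    proof (rule reach_stage[OF r b(1), where T = T])
      show "\<alpha> k \<le> n" using \<alpha>n[of k] k by auto
      show "run n \<omega> t (\<alpha> k) = n" if "t < T" for t using top[of k t] that k by auto
      show "\<exists>s<T. \<omega> (c, s)" if "b < c" "c < \<alpha> k" for c using act[of c] that \<alpha>n[of k] k by auto
      show "\<exists>s. cnt \<omega> b 0 s \<le> \<mu> + i \<and> (\<forall>c. b < c \<longrightarrow> c < \<alpha> k \<longrightarrow> i + 1 \<le> cnt \<omega> c 0 s)"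
        if "i < \<mu>' - \<mu>" for i using race[of i] that by auto
    qed
    thus ?thesis by (rule reach_weaken) (use gap[OF k] \<mu>' in auto)
  qed
  have zero: "cnt \<omega> b 0 T = 0" using cnt_pos_iff[of \<omega> b 0 T] late_b by force
  have phase1: "k \<le> Suc (A * e) \<Longrightarrow> reach n \<omega> b (min (2 * D) (head_start A k)) (\<alpha> k)" for k
  proof (induction k)
    case 0
    show ?case unfolding reach_def
    proof (intro allI impI)
      fix t assume "cnt \<omega> b 0 t \<le> min (2 * D) (head_start A 0)"
      hence "\<not> (\<exists>u. 0 \<le> u \<and> u < t \<and> \<omega> (b, u))" using cnt_pos_iff[of \<omega> b 0 t] by simp
      hence "run n \<omega> t b = n" using \<alpha>n[of 0] \<alpha>0 b by (intro run_inactive) auto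
      thus "\<alpha> 0 \<le> run n \<omega> t b" using \<alpha>0 by simp
    qed
  next
    case (Suc k)
    define \<mu> where "\<mu> = min (2 * D) (head_start A k)"
    have IH: "reach n \<omega> b \<mu> (\<alpha> k)" and kK: "k < K" using Suc K by (auto simp: \<mu>_def)
    have md: "\<mu> div A \<le> 2 * D div A" by (rule div_le_mono) (simp add: \<mu>_def)
    also have "2 * D div A \<le> 2 * D" by simp
    finally have md': "\<mu> div A \<le> 2 * D" .
    have head: "\<mu> = 2 * D \<or> \<mu> = head_start A k" by (auto simp: \<mu>_def)
    show ?case
    proof (rule stage[OF IH kK])
      show "min (2 * D) (head_start A (Suc k)) - \<mu> \<le> h"
        using head md' D(2) by auto
      fix i assume i: "\<mu> + i < min (2 * D) (head_start A (Suc k))"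
      hence "\<mu> = head_start A k" by (auto simp: \<mu>_def)
      hence "i \<le> \<mu> div A" using i by auto
      hence i2: "i \<le> 2 * D div A" using md by simp
      \<comment> \<open>Hence the time \<open>T + \<mu> + i\<close>, trivially early enough for
        \<open>b\<close>, is not before \<open>T + A * i\<close>, when the others are known to have
        \<open>i + 1\<close> activations.\<close>
      have Ai: "A * i \<le> \<mu>" using \<open>i \<le> \<mu> div A\<close> A by (simp add: less_eq_div_iff_mult_less_eq mult.commute)
      have "cnt \<omega> b 0 (T + \<mu> + i) \<le> \<mu> + i"
        using cnt_split[of 0 T "T + \<mu> + i" \<omega> b] zero cnt_le[of \<omega> b T "T + \<mu> + i"] by simp
      moreover have "i + 1 \<le> cnt \<omega> c 0 (T + \<mu> + i)" if c: "b < c" "c < \<alpha> k" for c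
      proof -
        have cn: "c \<le> n" using c \<alpha>n[of k] kK by auto
        have "i + 1 \<le> cnt \<omega> c 0 (T + A * i)"
        proof (cases "i = 0")
          case True
          thus ?thesis using act[OF c(1) cn] cnt_pos_iff[of \<omega> c 0 T] by auto
        next
          case False
          thus ?thesis using early[OF c(1) cn _ i2] by auto
        qed
        also have "\<dots> \<le> cnt \<omega> c 0 (T + \<mu> + i)" using Ai by (intro cnt_mono) auto
        finally show ?thesis .
      qed
      ultimately show "\<exists>s. cnt \<omega> b 0 s \<le> \<mu> + i \<and> (\<forall>c. b < c \<longrightarrow> c < \<alpha> k \<longrightarrow> i + 1 \<le> cnt \<omega> c 0 s)"
        by blast
    qed
  qed
  have phase2: "j \<le> e' \<Longrightarrow> reach n \<omega> b (min h (D * 2 ^ (2 ^ j))) (\<alpha> (Suc (A * e) + j))" for j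
  proof (induction j)
    case 0
    have "2 * D \<le> head_start A (Suc (A * e))" using head_start_ge[OF A, of e] D(1) by simp
    thus ?case using phase1[of "Suc (A * e)"] D(2) by (simp add: mult.commute min_def split: if_splits)
  next
    case (Suc j)
    let ?k = "Suc (A * e) + j"
    define \<mu> where "\<mu> = min h (D * 2 ^ (2 ^ j))"
    define \<mu>' where "\<mu>' = min h (D * 2 ^ (2 ^ Suc j))"
    have IH: "reach n \<omega> b \<mu> (\<alpha> ?k)" and kK: "?k < K" using Suc K by (auto simp: \<mu>_def)
    have "reach n \<omega> b \<mu>' (\<alpha> (Suc ?k))"
    proof (rule stage[OF IH kK])
      show "\<mu>' - \<mu> \<le> h" by (auto simp: \<mu>'_def)
      fix i assume i: "\<mu> + i < \<mu>'"
      hence \<mu>: "\<mu> = D * 2 ^ (2 ^ j)" by (auto simp: \<mu>_def \<mu>'_def)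
      \<comment> \<open>The sequence \<open>D * 2 ^ (2 ^ j)\<close> is the orbit of squaring and
        dividing by \<open>D\<close>, the largest growth that the deviation bounds of one region
        allow.\<close>
      have "(i + \<mu>) * D \<le> (D * 2 ^ (2 ^ Suc j)) * D"
        using i by (intro mult_right_mono) (auto simp: \<mu>'_def)
      also have "\<dots> = \<mu>\<^sup>2" unfolding \<mu> by (simp add: power2_eq_square power_mult mult_ac power_add[symmetric] mult_2)
      finally have le: "(i + \<mu>) * D \<le> \<mu>\<^sup>2" .
      have rng: "D \<le> \<mu>" "\<mu> \<le> h" "i \<le> h" using i \<mu> by (auto simp: \<mu>'_def)
      have "cnt \<omega> b 0 (T + \<sigma> \<mu> i) \<le> \<mu> + i"
        using cnt_split[of 0 T "T + \<sigma> \<mu> i" \<omega> b] zero late'[OF rng le] by simp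
      moreover have "i + 1 \<le> cnt \<omega> c 0 (T + \<sigma> \<mu> i)" if c: "b < c" "c < \<alpha> ?k" for c
      proof -
        have "c \<le> n" using c \<alpha>n[of ?k] kK by auto
        from late[OF c(1) this rng le] show ?thesis
          using cnt_split[of 0 T "T + \<sigma> \<mu> i" \<omega> c] by simp
      qed
      ultimately show "\<exists>s. cnt \<omega> b 0 s \<le> \<mu> + i \<and> (\<forall>c. b < c \<longrightarrow> c < \<alpha> ?k \<longrightarrow> i + 1 \<le> cnt \<omega> c 0 s)"
        by blast
    qed
    thus ?case by (simp add: \<mu>'_def)
  qed
  \<comment> \<open>There is at most one activation per step, so \<open>h\<close> activations
    suffice for all times up to \<open>h\<close>.\<close>
  have "reach n \<omega> b h (\<alpha> K)" using phase2[of e'] h K by (simp add: min_absorb1)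
  moreover have "cnt \<omega> b 0 t \<le> h" using cnt_le[of \<omega> b 0 t] t by simp
  ultimately have "\<alpha> K \<le> run n \<omega> t b" by (auto simp: reach_def)
  thus ?thesis using b by simp
qed


section \<open>Independent bits\<close>

text \<open>Measurability with respect to the coordinates in \<open>A\<close>, stated pointwise. The
  set \<open>A\<close> may reach beyond the index set of \<open>bits_pmf\<close>, where all bits are
  \<open>False\<close>; so events of a node can be given all times at once.\<close>

definition depends_on :: "'a set \<Rightarrow> ('a \<Rightarrow> bool) set \<Rightarrow> bool" where
  "depends_on A E \<longleftrightarrow> (\<forall>f g. (\<forall>x\<in>A. f x = g x) \<longrightarrow> (f \<in> E \<longleftrightarrow> g \<in> E))"

lemma depends_onD: "depends_on A E \<Longrightarrow> (\<And>x. x \<in> A \<Longrightarrow> f x = g x) \<Longrightarrow> f \<in> E \<longleftrightarrow> g \<in> E"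
  unfolding depends_on_def by blast

lemma depends_onI: "(\<And>f g. (\<And>x. x \<in> A \<Longrightarrow> f x = g x) \<Longrightarrow> f \<in> E \<longleftrightarrow> g \<in> E) \<Longrightarrow> depends_on A E"
  unfolding depends_on_def by blast

lemma depends_on_mono:
  assumes "depends_on A E" "A \<subseteq> B" shows "depends_on B E"
proof (rule depends_onI)
  fix f g :: "'a \<Rightarrow> bool" assume "\<And>x. x \<in> B \<Longrightarrow> f x = g x"
  thus "f \<in> E \<longleftrightarrow> g \<in> E" using assms(2) by (intro depends_onD[OF assms(1)]) auto
qed

lemma depends_on_INT:
  fixes A :: "'b set"
  assumes "\<And>j. j \<in> J \<Longrightarrow> depends_on A (E j)" shows "depends_on A (\<Inter>j\<in>J. E j)"
proof (rule depends_onI)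
  fix f g :: "'b \<Rightarrow> bool" assume *: "\<And>x. x \<in> A \<Longrightarrow> f x = g x"
  have "f \<in> E j \<longleftrightarrow> g \<in> E j" if "j \<in> J" for j by (rule depends_onD[OF assms[OF that] *])
  thus "f \<in> (\<Inter>j\<in>J. E j) \<longleftrightarrow> g \<in> (\<Inter>j\<in>J. E j)" by auto
qed

lemma depends_on_UN:
  fixes A :: "'b set"
  assumes "\<And>j. j \<in> J \<Longrightarrow> depends_on A (E j)" shows "depends_on A (\<Union>j\<in>J. E j)"
proof (rule depends_onI)
  fix f g :: "'b \<Rightarrow> bool" assume *: "\<And>x. x \<in> A \<Longrightarrow> f x = g x"
  have "f \<in> E j \<longleftrightarrow> g \<in> E j" if "j \<in> J" for j by (rule depends_onD[OF assms[OF that] *])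
  thus "f \<in> (\<Union>j\<in>J. E j) \<longleftrightarrow> g \<in> (\<Union>j\<in>J. E j)" by auto
qed

lemma depends_on_Compl:
  assumes "depends_on A E" shows "depends_on A (- E)"
proof (rule depends_onI)
  fix f g :: "'a \<Rightarrow> bool" assume "\<And>x. x \<in> A \<Longrightarrow> f x = g x"
  hence "f \<in> E \<longleftrightarrow> g \<in> E" by (rule depends_onD[OF assms])
  thus "f \<in> - E \<longleftrightarrow> g \<in> - E" by simp
qed

lemma depends_on_Int:
  assumes "depends_on A E" "depends_on A F" shows "depends_on A (E \<inter> F)"
proof (rule depends_onI)
  fix f g :: "'a \<Rightarrow> bool" assume *: "\<And>x. x \<in> A \<Longrightarrow> f x = g x"
  have "f \<in> E \<longleftrightarrow> g \<in> E" by (rule depends_onD[OF assms(1) *])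
  moreover have "f \<in> F \<longleftrightarrow> g \<in> F" by (rule depends_onD[OF assms(2) *])
  ultimately show "f \<in> E \<inter> F \<longleftrightarrow> g \<in> E \<inter> F" by simp
qed

lemma depends_on_Diff: "depends_on A E \<Longrightarrow> depends_on A F \<Longrightarrow> depends_on A (E - F)"
  unfolding Diff_eq by (intro depends_on_Int depends_on_Compl)

lemma depends_on_Un:
  assumes "depends_on A E" "depends_on A F" shows "depends_on A (E \<union> F)"
proof -
  have "depends_on A (- (- E \<inter> - F))" by (intro depends_on_Compl depends_on_Int assms)
  thus ?thesis by simp
qed

text \<open>The product rule \<open>measure_pmf_prob_product\<close> is about countable sets, so
  both events are first cut down to the supports.\<close>

lemma prob_pair_times:
  "measure_pmf.prob (pair_pmf P Q) (E \<times> F) = measure_pmf.prob P E * measure_pmf.prob Q F"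
proof -
  have "measure_pmf.prob (pair_pmf P Q) (E \<times> F) =
      measure_pmf.prob (pair_pmf P Q) ((E \<inter> set_pmf P) \<times> (F \<inter> set_pmf Q))"
    by (rule measure_prob_cong_0) (auto simp: pmf_pair set_pmf_iff)
  also have "\<dots> = measure_pmf.prob P (E \<inter> set_pmf P) * measure_pmf.prob Q (F \<inter> set_pmf Q)"
    by (rule measure_pmf_prob_product) (auto intro: countable_subset[OF _ countable_set_pmf])
  finally show ?thesis by (simp add: measure_Int_set_pmf)
qed

text \<open>The bits are glued from independent pieces on \<open>I \<inter> A\<close> and
  \<open>I - A\<close>; \<open>E\<close> sees only the first piece and, by disjointness,
  \<open>F\<close> only the second.\<close>

lemma bits_indep:
  assumes I: "finite I" and A: "depends_on A E" and B: "depends_on B F" and disj: "A \<inter> B = {}"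
  shows "measure_pmf.prob (bits_pmf p I) (E \<inter> F) =
         measure_pmf.prob (bits_pmf p I) E * measure_pmf.prob (bits_pmf p I) F"
proof -
  let ?P = "Pi_pmf (I \<inter> A) False (\<lambda>_. bernoulli_pmf p)"
  let ?Q = "Pi_pmf (I - A) False (\<lambda>_. bernoulli_pmf p)"
  have "Pi_pmf (I \<inter> A \<union> (I - A)) False (\<lambda>_. bernoulli_pmf p) =
      map_pmf (\<lambda>(f, g) x. if x \<in> I \<inter> A then f x else g x) (pair_pmf ?P ?Q)"
    by (rule Pi_pmf_union) (use I in auto)
  moreover have "I \<inter> A \<union> (I - A) = I" by auto
  ultimately have M: "bits_pmf p I = map_pmf (\<lambda>(f, g) x. if x \<in> I \<inter> A then f x else g x) (pair_pmf ?P ?Q)"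
    by (simp add: bits_pmf_def)
  have *: "measure_pmf.prob (bits_pmf p I) (E' \<inter> F') = measure_pmf.prob ?P E' * measure_pmf.prob ?Q F'"
    if E': "depends_on A E'" and F': "depends_on B F'" for E' F'
  proof -
    have "measure_pmf.prob (bits_pmf p I) (E' \<inter> F') = measure_pmf.prob (pair_pmf ?P ?Q)
        ((\<lambda>(f, g) x. if x \<in> I \<inter> A then f x else g x) -` (E' \<inter> F'))"
      unfolding M by simp
    also have "\<dots> = measure_pmf.prob (pair_pmf ?P ?Q) (E' \<times> F')"
    proof (rule measure_pmf.finite_measure_eq_AE)
      show "AE x in pair_pmf ?P ?Q. (x \<in> (\<lambda>(f, g) x. if x \<in> I \<inter> A then f x else g x) -` (E' \<inter> F')) = (x \<in> E' \<times> F')"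
      proof (rule AE_pmfI)
        fix x assume "x \<in> set_pmf (pair_pmf ?P ?Q)"
        then obtain f g where x: "x = (f, g)" "f \<in> set_pmf ?P" "g \<in> set_pmf ?Q" by auto
        let ?h = "\<lambda>x. if x \<in> I \<inter> A then f x else g x"
        have f: "f y = False" if "y \<notin> I \<inter> A" for y
          using x(2) set_Pi_pmf_subset[of "I \<inter> A" False "\<lambda>_. bernoulli_pmf p"] that I by auto
        have g: "g y = False" if "y \<notin> I - A" for y
          using x(3) set_Pi_pmf_subset[of "I - A" False "\<lambda>_. bernoulli_pmf p"] that I by auto
        have "?h \<in> E' \<longleftrightarrow> f \<in> E'" by (rule depends_onD[OF E']) (use f g in auto)
        moreover have "?h \<in> F' \<longleftrightarrow> g \<in> F'" by (rule depends_onD[OF F']) (use disj in auto)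
        ultimately show "(x \<in> (\<lambda>(f, g) x. if x \<in> I \<inter> A then f x else g x) -` (E' \<inter> F')) = (x \<in> E' \<times> F')"
          using x by auto
      qed
    qed auto
    finally show ?thesis by (simp add: prob_pair_times)
  qed
  have U: "depends_on X UNIV" for X :: "'a set" by (simp add: depends_on_def)
  show ?thesis using *[OF A B] *[OF A U] *[OF U B] by simp
qed

lemma bits_indep_INT:
  assumes I: "finite I" and J: "finite J" and E: "\<And>j. j \<in> J \<Longrightarrow> depends_on (A j) (E j)"
    and disj: "\<And>i j. i \<in> J \<Longrightarrow> j \<in> J \<Longrightarrow> i \<noteq> j \<Longrightarrow> A i \<inter> A j = {}"
  shows "measure_pmf.prob (bits_pmf p I) (\<Inter>j\<in>J. E j) = (\<Prod>j\<in>J. measure_pmf.prob (bits_pmf p I) (E j))"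
  using J E disj
proof (induction J rule: finite_induct)
  case (insert j J)
  have "measure_pmf.prob (bits_pmf p I) (E j \<inter> (\<Inter>j\<in>J. E j)) =
      measure_pmf.prob (bits_pmf p I) (E j) * measure_pmf.prob (bits_pmf p I) (\<Inter>j\<in>J. E j)"
  proof (rule bits_indep[OF I])
    show "depends_on (A j) (E j)" using insert by auto
    show "depends_on (\<Union>j\<in>J. A j) (\<Inter>j\<in>J. E j)"
      by (intro depends_on_INT depends_on_mono[OF insert.prems(1)]) auto
    show "A j \<inter> (\<Union>j\<in>J. A j) = {}" using insert.prems(2)[of j] insert.hyps by fastforce
  qed
  moreover have "measure_pmf.prob (bits_pmf p I) (\<Inter>j\<in>J. E j) = (\<Prod>j\<in>J. measure_pmf.prob (bits_pmf p I) (E j))"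
    by (rule insert.IH) (use insert.prems in auto)
  ultimately show ?case using insert.hyps by simp
qed simp

text \<open>Inside the intersection of all \<open>U c\<close>, the event that no \<open>V c\<close>
  occurs is again a product event, with factors \<open>U c - V c\<close> on \<open>L\<close>. Such a
  factor has probability P(U c) - P(V c), at most P(U c) (1 - P(V c)).\<close>

lemma prob_block:
  assumes I: "finite I" and B: "finite B" "L \<subseteq> B"
    and U: "\<And>c. c \<in> B \<Longrightarrow> depends_on (A c) (U c)" and V: "\<And>c. c \<in> L \<Longrightarrow> depends_on (A c) (V c)"
    and sub: "\<And>c. c \<in> L \<Longrightarrow> V c \<subseteq> U c"
    and disj: "\<And>i j. i \<in> B \<Longrightarrow> j \<in> B \<Longrightarrow> i \<noteq> j \<Longrightarrow> A i \<inter> A j = {}"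
  shows "(\<Prod>c\<in>B. measure_pmf.prob (bits_pmf p I) (U c)) *
           (1 - (\<Prod>c\<in>L. 1 - measure_pmf.prob (bits_pmf p I) (V c)))
         \<le> measure_pmf.prob (bits_pmf p I) ((\<Inter>c\<in>B. U c) \<inter> (\<Union>c\<in>L. V c))"
proof -
  let ?P = "measure_pmf.prob (bits_pmf p I)"
  let ?W = "\<lambda>c. if c \<in> L then U c - V c else U c"
  have W: "x \<in> ?W c \<longleftrightarrow> x \<in> U c \<and> (c \<in> L \<longrightarrow> x \<notin> V c)" for x c by simp
  have "(\<Inter>c\<in>B. U c) \<inter> (\<Union>c\<in>L. V c) = (\<Inter>c\<in>B. U c) - (\<Inter>c\<in>B. ?W c)"
    unfolding set_eq_iff Diff_iff Int_iff INT_iff UN_iff W using B(2) by blast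
  hence "?P ((\<Inter>c\<in>B. U c) \<inter> (\<Union>c\<in>L. V c)) = ?P ((\<Inter>c\<in>B. U c) - (\<Inter>c\<in>B. ?W c))"
    by (rule arg_cong)
  also have "\<dots> = ?P (\<Inter>c\<in>B. U c) - ?P (\<Inter>c\<in>B. ?W c)"
  proof (rule measure_pmf.finite_measure_Diff)
    show "(\<Inter>c\<in>B. ?W c) \<subseteq> (\<Inter>c\<in>B. U c)"
      unfolding subset_iff INT_iff W by blast
  qed simp_all
  also have "?P (\<Inter>c\<in>B. U c) = (\<Prod>c\<in>B. ?P (U c))"
    by (rule bits_indep_INT[OF I B(1) U disj])
  also have "?P (\<Inter>c\<in>B. ?W c) = (\<Prod>c\<in>B. ?P (?W c))"
  proof (rule bits_indep_INT[OF I B(1) _ disj])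
    fix c assume c: "c \<in> B"
    show "depends_on (A c) (?W c)"
    proof (cases "c \<in> L")
      case True
      thus ?thesis using depends_on_Diff[OF U[OF c] V[OF True]] by simp
    next
      case False
      thus ?thesis using U[OF c] by simp
    qed
  qed
  finally have eq: "?P ((\<Inter>c\<in>B. U c) \<inter> (\<Union>c\<in>L. V c)) = (\<Prod>c\<in>B. ?P (U c)) - (\<Prod>c\<in>B. ?P (?W c))" .
  have "(\<Prod>c\<in>B. ?P (?W c)) \<le> (\<Prod>c\<in>B. ?P (U c) * (if c \<in> L then 1 - ?P (V c) else 1))"
  proof (intro prod_mono conjI)
    fix c assume c: "c \<in> B"
    show "?P (?W c) \<le> ?P (U c) * (if c \<in> L then 1 - ?P (V c) else 1)"
    proof (cases "c \<in> L")
      case True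
      have "?P (U c - V c) = ?P (U c) - ?P (V c)"
        by (rule measure_pmf.finite_measure_Diff) (use sub True in auto)
      also have "\<dots> \<le> ?P (U c) - ?P (U c) * ?P (V c)"
        using mult_left_le_one_le[of "?P (V c)" "?P (U c)"] by simp
      finally show ?thesis using True by (simp add: algebra_simps)
    qed simp
  qed auto
  also have "\<dots> = (\<Prod>c\<in>B. ?P (U c)) * (\<Prod>c\<in>B. if c \<in> L then 1 - ?P (V c) else 1)"
    by (simp add: prod.distrib)
  also have "(\<Prod>c\<in>B. if c \<in> L then 1 - ?P (V c) else 1) = (\<Prod>c\<in>L. 1 - ?P (V c))"
    using B by (simp add: prod.inter_restrict[symmetric] Int_absorb1)
  finally show ?thesis unfolding eq by (simp add: algebra_simps)
qed

section \<open>Binomial counts and their lower tail\<close>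

lemma prob_cnt:
  assumes I: "finite I" "{c} \<times> {s..<t} \<subseteq> I" and p: "p \<in> {0..1}"
  shows "measure_pmf.prob (bits_pmf p I) {\<omega>. P (cnt \<omega> c s t)} = measure_pmf.prob (binomial_pmf (t - s) p) {k. P k}"
proof -
  let ?A = "{c} \<times> {s..<t}"
  have c: "card {x \<in> ?A. \<omega> x} = cnt \<omega> c s t" for \<omega> :: "nat \<times> nat \<Rightarrow> bool"
  proof -
    have "{x \<in> ?A. \<omega> x} = Pair c ` {u \<in> {s..<t}. \<omega> (c, u)}" by auto
    thus ?thesis by (simp add: cnt_def card_image inj_on_def)
  qed
  have "binomial_pmf (t - s) p = map_pmf (\<lambda>f. card {x\<in>?A. f x}) (Pi_pmf ?A False (\<lambda>_. bernoulli_pmf p))"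
    by (rule binomial_pmf_altdef') (use p in auto)
  also have "Pi_pmf ?A False (\<lambda>_. bernoulli_pmf p) = map_pmf (\<lambda>f x. if x \<in> ?A then f x else False) (bits_pmf p I)"
    unfolding bits_pmf_def by (rule Pi_pmf_subset[OF I])
  also have "map_pmf (\<lambda>f. card {x\<in>?A. f x}) \<dots> = map_pmf (\<lambda>\<omega>. cnt \<omega> c s t) (bits_pmf p I)"
    unfolding map_pmf_comp
  proof (intro map_pmf_cong refl)
    fix \<omega>
    have "{x \<in> ?A. if x \<in> ?A then \<omega> x else False} = {x \<in> ?A. \<omega> x}" by auto
    thus "card {x \<in> ?A. if x \<in> ?A then \<omega> x else False} = cnt \<omega> c s t" by (simp only: c)
  qed
  finally show ?thesis by simp
qed

lemma depends_on_cnt: "depends_on ({c} \<times> {s..<t}) {\<omega>. P (cnt \<omega> c s t)}"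
proof -
  have "cnt f c s t = cnt g c s t" if "\<forall>x\<in>{c} \<times> {s..<t}. f x = g x" for f g
    using that unfolding cnt_def by (intro arg_cong[where f = card]) auto
  thus ?thesis by (intro depends_onI) (metis mem_Collect_eq)
qed

text \<open>Termwise comparison with the expansion of \<open>(s + 1) ^ i\<close>, whose terms
  \<open>(i choose l) * s ^ l\<close> dominate.\<close>

lemma sum_binomial_le: "(\<Sum>l\<le>i. s choose l) \<le> (s + 1) ^ i"
proof -
  have "(\<Sum>l\<le>i. s choose l) \<le> (\<Sum>l\<le>i. (i choose l) * s ^ l * 1 ^ (i - l))"
  proof (rule sum_mono)
    fix l assume "l \<in> {..i}"
    hence "1 \<le> i choose l" by (simp add: Suc_le_eq)
    moreover have "s choose l \<le> s ^ l"
      using binomial_le_pow[of l s] by (cases "l \<le> s") (auto simp: binomial_eq_0)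
    ultimately show "s choose l \<le> (i choose l) * s ^ l * 1 ^ (i - l)"
      using mult_mono[of 1 "i choose l" "s choose l" "s ^ l"] by simp
  qed
  also have "\<dots> = (s + 1) ^ i" by (subst binomial) simp
  finally show ?thesis .
qed

text \<open>A Hoeffding bound would be too weak: the result has to be compared with the probability
  \<open>(1 - p) ^ T\<close> of silence up to \<open>T\<close>, so the exact base
  \<open>1 - p\<close> must survive.\<close>

lemma binomial_lower_tail:
  assumes p: "0 < p" "p < 1" and i: "i \<le> s"
  shows "measure_pmf.prob (binomial_pmf s p) {k. k \<le> i} \<le> (1 - p) ^ (s - i) * (real s + 1) ^ i"
proof -
  have "measure_pmf.prob (binomial_pmf s p) {k. k \<le> i} = (\<Sum>k\<le>i. pmf (binomial_pmf s p) k)"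
    unfolding atMost_def[symmetric] by (rule measure_measure_pmf_finite) simp
  also have "\<dots> \<le> (\<Sum>k\<le>i. real (s choose k) * (1 - p) ^ (s - i))"
  proof (rule sum_mono)
    fix k assume k: "k \<in> {..i}"
    have "p ^ k * (1 - p) ^ (s - k) \<le> 1 * (1 - p) ^ (s - i)"
      using p k by (intro mult_mono power_decreasing power_le_one) auto
    thus "pmf (binomial_pmf s p) k \<le> real (s choose k) * (1 - p) ^ (s - i)"
      using p by (simp add: mult.assoc mult_left_mono)
  qed
  also have "\<dots> = (1 - p) ^ (s - i) * real (\<Sum>k\<le>i. s choose k)"
    by (simp add: sum_distrib_right[symmetric] mult.commute)
  also have "\<dots> \<le> (1 - p) ^ (s - i) * real ((s + 1) ^ i)"
    using p sum_binomial_le by (intro mult_left_mono of_nat_mono) auto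
  finally show ?thesis by (simp add: add.commute)
qed


section \<open>Probability of the survival event\<close>

text \<open>With x = h w, (1 - w)^h is at most exp(-x), hence at most 1/(1 + x), and this is at most
  1 - x/2 for x in [0,1]. It bounds the chance that one of \<open>h\<close> nodes is late.\<close>

lemma one_minus_power_ge:
  fixes w :: real
  assumes "0 \<le> w" "w \<le> 1" "real h * w \<le> 1"
  shows "real h * w / 2 \<le> 1 - (1 - w) ^ h"
proof -
  define x where "x = real h * w"
  have x: "0 \<le> x" "x \<le> 1" using assms by (auto simp: x_def)
  have "(1 - w) ^ h \<le> exp (- w) ^ h"
    using assms exp_ge_add_one_self[of "- w"] by (intro power_mono) auto
  also have "\<dots> = exp (- x)" by (simp add: x_def exp_of_nat_mult[symmetric])
  also have "\<dots> = 1 / exp x" by (simp add: exp_minus field_simps)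
  also have "\<dots> \<le> 1 / (1 + x)"
    using x exp_ge_add_one_self[of x] by (intro divide_left_mono mult_pos_pos) auto
  also have "\<dots> \<le> 1 - x / 2"
  proof -
    have "0 \<le> x * (1 - x)" using x by simp
    hence "1 \<le> (1 - x / 2) * (1 + x)" by (simp add: algebra_simps)
    thus ?thesis using x by (simp add: divide_le_eq)
  qed
  finally show ?thesis by (simp add: x_def)
qed

lemma sum_powers_le:
  fixes y :: real
  assumes "0 \<le> y" "y \<le> 1 / 16"
  shows "(\<Sum>i=1..m. y ^ i) \<le> 1 / 8"
proof -
  have "(\<Sum>i=1..m. y ^ i) \<le> (1/8) * (1 - (1/2) ^ m)"
  proof (induction m)
    case (Suc m)
    have "y ^ Suc m \<le> (1/16) * (1/2) ^ m"
      unfolding power_Suc using assms by (intro mult_mono power_mono) auto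
    thus ?case using Suc by (simp add: algebra_simps)
  qed simp
  also have "\<dots> \<le> 1/8" by simp
  finally show ?thesis .
qed

text \<open>\<open>K\<close> blocks of length \<open>2h\<close>, counted from the right, contain the late nodes \<open>\<alpha>\<close> in their
  left halves, so that consecutive ones are at least \<open>h\<close> apart; the next block contains \<open>b\<close>.\<close>

locale survival_parameters =
  fixes p :: real and n T A D h e e' :: nat
  assumes p: "0 < p" "p < 1" and T: "1 \<le> T" and A: "1 \<le> A"
    and D: "2 \<le> D" "2 * D \<le> 2 ^ e" "2 * D + 1 \<le> h" "h \<le> D * 2 ^ (2 ^ e')"
    and range: "2 * h * (Suc (Suc (A * e) + e')) < n"
    and eps: "real (2 * h * (Suc (Suc (A * e) + e'))) * (1 - p) ^ T \<le> 1 / 8"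
    and early: "(1 - p) ^ (A - 1) * real (T + 2 * D + 1) \<le> 1 / 16"
    and late: "2 * (real h + 1)\<^sup>2 * exp (- (real D * p / 2)) \<le> (1 - p) ^ T / 8"
begin

definition "K = Suc (A * e) + e'"
definition "\<epsilon> = (1 - p) ^ T"
text \<open>By this time the expected number of activations since \<open>T\<close> is about
  \<open>i + \<mu> / 2\<close>, midway between the \<open>i + 1\<close> required of the others and
  the \<open>i + \<mu>\<close> allowed to \<open>b\<close>.\<close>

definition "\<sigma> \<mu> i = nat \<lceil>(real i + real \<mu> / 2) / p\<rceil>"
text \<open>Large enough for all times in the events below, and for the time \<open>h\<close> up to
  which survival is claimed.\<close>

definition "H = T + 2 * D + h + nat \<lceil>2 * real h / p\<rceil> + 1"
definition "M = bits_pmf p ({1..n} \<times> {..<H})"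

definition act :: "nat \<Rightarrow> (nat \<times> nat \<Rightarrow> bool) set" where
  "act c = {\<omega>. 1 \<le> cnt \<omega> c 0 T}"

definition early_ok :: "nat \<Rightarrow> (nat \<times> nat \<Rightarrow> bool) set" where
  "early_ok c = (\<Inter>i\<in>{1..2 * D div A}. {\<omega>. i + 1 \<le> cnt \<omega> c 0 (T + A * i)})"

text \<open>A version of \<open>early_ok\<close> that is independent of the coins before
  \<open>T\<close>; with one activation before \<open>T\<close> it implies \<open>early_ok\<close>.
  It serves the late nodes, whose behaviour before \<open>T\<close> is prescribed.\<close>

definition early_ok' :: "nat \<Rightarrow> (nat \<times> nat \<Rightarrow> bool) set" where
  "early_ok' c = (\<Inter>i\<in>{1..2 * D div A}. {\<omega>. i \<le> cnt \<omega> c T (T + A * i)})"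

text \<open>The last condition keeps the Hoeffding exponent for a deviation of
  \<open>\<mu> / 2\<close> within at most \<open>(i + \<mu>) / p\<close> steps at
  \<open>D * p / 2\<close> or more.\<close>

definition pairs :: "(nat \<times> nat) set" where
  "pairs = {(\<mu>, i). D \<le> \<mu> \<and> \<mu> \<le> h \<and> i \<le> h \<and> (i + \<mu>) * D \<le> \<mu>\<^sup>2}"

text \<open>Both bounds are asked of every node, so that one event serves \<open>b\<close> as well
  as the nodes it races against.\<close>

definition late_ok :: "nat \<Rightarrow> (nat \<times> nat \<Rightarrow> bool) set" where
  "late_ok c = (\<Inter>x\<in>pairs. {\<omega>. snd x + 1 \<le> cnt \<omega> c T (T + \<sigma> (fst x) (snd x)) \<and>
                                cnt \<omega> c T (T + \<sigma> (fst x) (snd x)) \<le> fst x + snd x})"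

definition ok :: "nat \<Rightarrow> (nat \<times> nat \<Rightarrow> bool) set" where
  "ok c = act c \<inter> early_ok c \<inter> late_ok c"

text \<open>As \<open>ok\<close> contains an activation before \<open>T\<close>, the first
  activation falls exactly on time \<open>T - 1\<close>: late enough to act as a separator, yet
  before any node that is silent up to \<open>T\<close>.\<close>

definition leader :: "nat \<Rightarrow> (nat \<times> nat \<Rightarrow> bool) set" where
  "leader c = {\<omega>. cnt \<omega> c 0 (T - 1) = 0} \<inter> ok c"

definition last_one :: "nat \<Rightarrow> (nat \<times> nat \<Rightarrow> bool) set" where
  "last_one c = {\<omega>. cnt \<omega> c 0 T = 0} \<inter> late_ok c"

abbreviation P where "P \<equiv> measure_pmf.prob M"

section \<open>Probabilities of the events of a single node\<close>

lemma eps_pos: "0 < \<epsilon>" "\<epsilon> \<le> 1"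
  using p by (auto simp: \<epsilon>_def power_le_one)

lemma sigma_le: "\<mu> \<le> h \<Longrightarrow> i \<le> h \<Longrightarrow> \<sigma> \<mu> i \<le> nat \<lceil>2 * real h / p\<rceil>"
  unfolding \<sigma>_def using p by (intro nat_mono ceiling_mono divide_right_mono) auto

lemma early_le: "i \<in> {1..2 * D div A} \<Longrightarrow> A * i \<le> 2 * D"
  using A by (auto simp: less_eq_div_iff_mult_less_eq mult.commute)

lemma prob_cnt_M:
  assumes "c \<in> {1..n}" "t \<le> H"
  shows "P {\<omega>. Q (cnt \<omega> c s t)} = measure_pmf.prob (binomial_pmf (t - s) p) {k. Q k}"
  unfolding M_def by (rule prob_cnt) (use assms p in auto)

lemma prob_zero:
  assumes "c \<in> {1..n}" "t \<le> H"
  shows "P {\<omega>. cnt \<omega> c s t = 0} = (1 - p) ^ (t - s)"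
proof -
  have "P {\<omega>. cnt \<omega> c s t = 0} = measure_pmf.prob (binomial_pmf (t - s) p) {k. k = 0}"
    by (rule prob_cnt_M[OF assms])
  also have "\<dots> = pmf (binomial_pmf (t - s) p) 0" by (simp add: pmf.rep_eq)
  also have "\<dots> = (1 - p) ^ (t - s)" using p by simp
  finally show ?thesis .
qed

lemma prob_not_act: "c \<in> {1..n} \<Longrightarrow> P (- act c) = \<epsilon>"
  using prob_zero[of c T 0] by (simp add: act_def \<epsilon>_def H_def Compl_eq not_le Suc_le_eq)

text \<open>The \<open>i\<close>-th term is at most \<open>(1 - p) ^ (T - s) * y ^ i\<close>: per
  activation, \<open>A - 1\<close> surplus steps of silence pay for the choice of its time. The
  values \<open>s = 0\<close> and \<open>s = T\<close> serve \<open>early_ok\<close> and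
  \<open>early_ok'\<close>.\<close>

lemma early_sum:
  assumes c: "c \<in> {1..n}" and s: "s \<le> T"
  shows "(\<Sum>i\<in>{1..2 * D div A}. P {\<omega>. cnt \<omega> c s (T + A * i) \<le> i}) \<le> (1 - p) ^ (T - s) / 8"
proof -
  define y where "y = (1 - p) ^ (A - 1) * real (T + 2 * D + 1)"
  have "(\<Sum>i\<in>{1..2 * D div A}. P {\<omega>. cnt \<omega> c s (T + A * i) \<le> i})
      \<le> (\<Sum>i\<in>{1..2 * D div A}. (1 - p) ^ (T - s) * y ^ i)"
  proof (rule sum_mono)
    fix i assume i: "i \<in> {1..2 * D div A}"
    note Ai = early_le[OF i]
    have iA: "i \<le> A * i" using A by simp
    have H: "T + A * i \<le> H" using Ai by (simp add: H_def)
    let ?s = "T + A * i - s"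
    have "P {\<omega>. cnt \<omega> c s (T + A * i) \<le> i} = measure_pmf.prob (binomial_pmf ?s p) {k. k \<le> i}"
      by (rule prob_cnt_M[OF c H])
    also have "\<dots> \<le> (1 - p) ^ (?s - i) * (real ?s + 1) ^ i"
      by (rule binomial_lower_tail) (use p iA s in linarith)+
    also have "\<dots> \<le> (1 - p) ^ (?s - i) * real (T + 2 * D + 1) ^ i"
      using p Ai by (intro mult_left_mono power_mono) auto
    also have "?s - i = (T - s) + (A - 1) * i" using s iA by (simp add: diff_mult_distrib)
    also have "(1 - p) ^ \<dots> * real (T + 2 * D + 1) ^ i = (1 - p) ^ (T - s) * y ^ i"
      by (simp add: power_add power_mult power_mult_distrib y_def)
    finally show "P {\<omega>. cnt \<omega> c s (T + A * i) \<le> i} \<le> (1 - p) ^ (T - s) * y ^ i" .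
  qed
  also have "\<dots> = (1 - p) ^ (T - s) * (\<Sum>i=1..2 * D div A. y ^ i)" by (simp add: sum_distrib_left)
  also have "\<dots> \<le> (1 - p) ^ (T - s) * (1 / 8)"
    using p early by (intro mult_left_mono sum_powers_le) (auto simp: y_def)
  finally show ?thesis by simp
qed

lemma prob_Compl: "P (- E) = 1 - P E"
  using measure_pmf.prob_compl[of E M] by (simp add: Compl_eq_Diff_UNIV)

lemma prob_UN_Compl:
  assumes "finite J" shows "P (- (\<Inter>j\<in>J. E j)) \<le> (\<Sum>j\<in>J. P (- E j))"
proof -
  have "- (\<Inter>j\<in>J. E j) = (\<Union>j\<in>J. - E j)" by auto
  thus ?thesis using measure_pmf.finite_measure_subadditive_finite[OF assms, of "\<lambda>j. - E j" M] by auto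
qed

lemma prob_not_early_ok: "c \<in> {1..n} \<Longrightarrow> P (- early_ok c) \<le> \<epsilon> / 8"
proof -
  assume c: "c \<in> {1..n}"
  have "P (- early_ok c) \<le> (\<Sum>i\<in>{1..2 * D div A}. P (- {\<omega>. i + 1 \<le> cnt \<omega> c 0 (T + A * i)}))"
    unfolding early_ok_def by (rule prob_UN_Compl) simp
  also have "\<dots> = (\<Sum>i\<in>{1..2 * D div A}. P {\<omega>. cnt \<omega> c 0 (T + A * i) \<le> i})"
    by (intro sum.cong arg_cong[where f = P]) auto
  also have "\<dots> \<le> (1 - p) ^ (T - 0) / 8" by (rule early_sum[OF c]) simp
  finally show ?thesis by (simp add: \<epsilon>_def)
qed

lemma prob_not_early_ok': "c \<in> {1..n} \<Longrightarrow> P (- early_ok' c) \<le> 1 / 8"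
proof -
  assume c: "c \<in> {1..n}"
  have "P (- early_ok' c) \<le> (\<Sum>i\<in>{1..2 * D div A}. P (- {\<omega>. i \<le> cnt \<omega> c T (T + A * i)}))"
    unfolding early_ok'_def by (rule prob_UN_Compl) simp
  also have "\<dots> \<le> (\<Sum>i\<in>{1..2 * D div A}. P {\<omega>. cnt \<omega> c T (T + A * i) \<le> i})"
    by (intro sum_mono measure_pmf.finite_measure_mono) auto
  also have "\<dots> \<le> (1 - p) ^ (T - T) / 8" by (rule early_sum[OF c]) simp
  finally show ?thesis by simp
qed

lemma finite_pairs: "finite pairs" "card pairs \<le> (h + 1)\<^sup>2"
proof -
  have sub: "pairs \<subseteq> {..h} \<times> {..h}" by (auto simp: pairs_def)
  thus "finite pairs" by (rule finite_subset) simp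
  have "card pairs \<le> card ({..h} \<times> {..h})" by (intro card_mono sub) simp
  thus "card pairs \<le> (h + 1)\<^sup>2" by (simp add: power2_eq_square)
qed

text \<open>The mean \<open>s * p\<close> lies between \<open>i + \<mu> / 2\<close> and
  \<open>i + \<mu> / 2 + p\<close>, so either failure is a deviation from it by at least
  \<open>\<mu> / 2\<close>.\<close>

lemma prob_late_pair:
  assumes c: "c \<in> {1..n}" and x: "(\<mu>, i) \<in> pairs"
  shows "P (- {\<omega>. i + 1 \<le> cnt \<omega> c T (T + \<sigma> \<mu> i) \<and> cnt \<omega> c T (T + \<sigma> \<mu> i) \<le> \<mu> + i})
         \<le> 2 * exp (- (real D * p / 2))"
proof -
  define s where "s = \<sigma> \<mu> i"
  have \<mu>: "D \<le> \<mu>" "\<mu> \<le> h" "i \<le> h" "(i + \<mu>) * D \<le> \<mu>\<^sup>2" using x by (auto simp: pairs_def)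
  have H: "T + s \<le> H" using sigma_le[OF \<mu>(2,3)] by (simp add: H_def s_def)
  have s1: "(real i + real \<mu> / 2) / p \<le> real s"
    unfolding s_def \<sigma>_def by linarith
  have "real s < (real i + real \<mu> / 2) / p + 1"
  proof -
    have "0 \<le> (real i + real \<mu> / 2) / p" using p by simp
    thus ?thesis unfolding s_def \<sigma>_def by linarith
  qed
  hence s2: "real s * p \<le> real i + real \<mu> / 2 + p" using p by (simp add: field_simps)
  have s1': "real i + real \<mu> / 2 \<le> real s * p" using s1 p by (simp add: field_simps)
  have "0 < real i + real \<mu> / 2" using \<mu> D by simp
  hence s0: "s > 0" using s1' by (cases s) auto
  \<comment> \<open>The rounding error \<open>p\<close> is at most \<open>\<mu> / 2\<close>, because
    \<open>2 \<le> D \<le> \<mu>\<close>.\<close>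
  have "real s * p \<le> real (i + \<mu>)" using s2 p \<mu>(1) D(1) by simp
  hence "real D * (real s * p) \<le> real D * real (i + \<mu>)" by (rule mult_left_mono) simp
  also have "\<dots> = real ((i + \<mu>) * D)" by simp
  also have "\<dots> \<le> real (\<mu>\<^sup>2)" using \<mu>(4) by (rule of_nat_mono)
  finally have ex: "real D * p / 2 \<le> 2 * (real \<mu> / 2)\<^sup>2 / real s"
    using s0 by (simp add: field_simps power2_eq_square)
  have "- {\<omega>. i + 1 \<le> cnt \<omega> c T (T + s) \<and> cnt \<omega> c T (T + s) \<le> \<mu> + i} =
      {\<omega>. cnt \<omega> c T (T + s) \<le> i} \<union> {\<omega>. \<mu> + i + 1 \<le> cnt \<omega> c T (T + s)}" by auto
  hence "P (- {\<omega>. i + 1 \<le> cnt \<omega> c T (T + s) \<and> cnt \<omega> c T (T + s) \<le> \<mu> + i}) \<le>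
      P {\<omega>. cnt \<omega> c T (T + s) \<le> i} + P {\<omega>. \<mu> + i + 1 \<le> cnt \<omega> c T (T + s)}"
    by (simp add: measure_Un_le)
  also have "P {\<omega>. cnt \<omega> c T (T + s) \<le> i} = measure_pmf.prob (binomial_pmf s p) {k. k \<le> i}"
    using prob_cnt_M[OF c H, of _ T] by simp
  also have "\<dots> \<le> measure_pmf.prob (binomial_pmf s p) {k. real k \<le> real s * p - real \<mu> / 2}"
    by (intro measure_pmf.finite_measure_mono) (use s1' in auto)
  also have "\<dots> \<le> exp (- 2 * (real \<mu> / 2)\<^sup>2 / real s)"
    by (rule binomial_distribution.prob_le) (use p s0 in \<open>auto simp: binomial_distribution_def\<close>)
  also have "P {\<omega>. \<mu> + i + 1 \<le> cnt \<omega> c T (T + s)} = measure_pmf.prob (binomial_pmf s p) {k. \<mu> + i + 1 \<le> k}"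
    using prob_cnt_M[OF c H, of _ T] by simp
  also have "\<dots> \<le> measure_pmf.prob (binomial_pmf s p) {k. real k \<ge> real s * p + real \<mu> / 2}"
    by (intro measure_pmf.finite_measure_mono) (use s2 p in auto)
  also have "\<dots> \<le> exp (- 2 * (real \<mu> / 2)\<^sup>2 / real s)"
    by (rule binomial_distribution.prob_ge) (use p s0 in \<open>auto simp: binomial_distribution_def\<close>)
  also have "exp (- 2 * (real \<mu> / 2)\<^sup>2 / real s) + exp (- 2 * (real \<mu> / 2)\<^sup>2 / real s)
      \<le> 2 * exp (- (real D * p / 2))"
    using ex by simp
  finally show ?thesis by (simp add: s_def)
qed

lemma prob_not_late_ok: "c \<in> {1..n} \<Longrightarrow> P (- late_ok c) \<le> \<epsilon> / 8"
proof -
  assume c: "c \<in> {1..n}"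
  have "P (- late_ok c) \<le> (\<Sum>x\<in>pairs. 2 * exp (- (real D * p / 2)))"
    unfolding late_ok_def
  proof (rule order_trans[OF prob_UN_Compl[OF finite_pairs(1)] sum_mono])
    fix x assume "x \<in> pairs"
    thus "P (- {\<omega>. snd x + 1 \<le> cnt \<omega> c T (T + \<sigma> (fst x) (snd x)) \<and>
                 cnt \<omega> c T (T + \<sigma> (fst x) (snd x)) \<le> fst x + snd x}) \<le> 2 * exp (- (real D * p / 2))"
      using prob_late_pair[OF c, of "fst x" "snd x"] by simp
  qed
  also have "\<dots> = real (card pairs) * (2 * exp (- (real D * p / 2)))" by simp
  also have "\<dots> \<le> real ((h + 1)\<^sup>2) * (2 * exp (- (real D * p / 2)))"
    using finite_pairs(2) by (intro mult_right_mono of_nat_mono) auto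
  also have "\<dots> \<le> \<epsilon> / 8" using late by (simp add: \<epsilon>_def mult_ac add_ac)
  finally show ?thesis .
qed

lemma prob_Int_ge: "1 - P (- E) - P (- F) \<le> P (E \<inter> F)"
proof -
  have "P (E \<inter> F) = 1 - P (- (E \<inter> F))"
    using prob_Compl[of "E \<inter> F"] by linarith
  moreover have "P (- (E \<inter> F)) \<le> P (- E) + P (- F)"
    unfolding Compl_Int by (rule measure_Un_le) auto
  ultimately show ?thesis by simp
qed

lemma prob_ok: "c \<in> {1..n} \<Longrightarrow> 1 - 2 * \<epsilon> \<le> P (ok c)"
proof -
  assume c: "c \<in> {1..n}"
  have "P (- (act c \<inter> early_ok c)) \<le> P (- act c) + P (- early_ok c)"
    unfolding Compl_Int by (rule measure_Un_le) auto
  thus ?thesis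
    using prob_Int_ge[of "act c \<inter> early_ok c" "late_ok c"] prob_not_act[OF c] prob_not_early_ok[OF c]
      prob_not_late_ok[OF c] eps_pos by (simp add: ok_def)
qed

lemma finite_index: "finite ({1..n} \<times> {..<H})" by simp

lemma depends_on_late: "depends_on ({c} \<times> {T..}) (late_ok c)"
  unfolding late_ok_def by (intro depends_on_INT depends_on_mono[OF depends_on_cnt]) auto

lemma prob_last_one: "c \<in> {1..n} \<Longrightarrow> \<epsilon> / 2 \<le> P (last_one c)"
proof -
  assume c: "c \<in> {1..n}"
  have "P (last_one c) = P {\<omega>. cnt \<omega> c 0 T = 0} * P (late_ok c)"
    unfolding last_one_def M_def
    by (rule bits_indep[OF finite_index depends_on_cnt depends_on_late]) auto
  moreover have "P {\<omega>. cnt \<omega> c 0 T = 0} = \<epsilon>"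
    using prob_zero[OF c, of T 0] by (simp add: \<epsilon>_def H_def)
  moreover have "1 / 2 \<le> P (late_ok c)"
    using prob_Int_ge[of UNIV "late_ok c"] prob_not_late_ok[OF c] eps_pos by simp
  ultimately show ?thesis using eps_pos mult_left_mono[of "1/2" "P (late_ok c)" \<epsilon>] by simp
qed

text \<open>Silence before \<open>T - 1\<close>, an activation at \<open>T - 1\<close> and good
  behaviour from \<open>T\<close> on concern disjoint time windows and are independent. Counting
  from \<open>T\<close> with \<open>early_ok'\<close> is what separates the last window.\<close>

lemma prob_leader: "c \<in> {1..n} \<Longrightarrow> \<epsilon> * p / 2 \<le> P (leader c)"
proof -
  assume c: "c \<in> {1..n}"
  let ?E = "{\<omega>. cnt \<omega> c 0 (T - 1) = 0}" and ?F = "{\<omega>. \<not> cnt \<omega> c (T - 1) T = 0}"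
    and ?G = "early_ok' c \<inter> late_ok c"
  have sub: "?E \<inter> (?F \<inter> ?G) \<subseteq> leader c"
  proof
    fix \<omega> assume w: "\<omega> \<in> ?E \<inter> (?F \<inter> ?G)"
    have c1: "1 \<le> cnt \<omega> c 0 T" using w cnt_split[of 0 "T - 1" T \<omega> c] by auto
    have "i + 1 \<le> cnt \<omega> c 0 (T + A * i)" if "i \<in> {1..2 * D div A}" for i
    proof -
      have "i \<le> cnt \<omega> c T (T + A * i)" using w that by (auto simp: early_ok'_def)
      thus ?thesis using c1 cnt_split[of 0 T "T + A * i" \<omega> c] by simp
    qed
    thus "\<omega> \<in> leader c" using w c1 by (auto simp: leader_def ok_def act_def early_ok_def)
  qed
  have dF: "depends_on ({c} \<times> {T - 1..<T}) ?F" by (rule depends_on_cnt)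
  have dG: "depends_on ({c} \<times> {T..}) ?G"
    unfolding early_ok'_def
    by (intro depends_on_Int depends_on_late depends_on_INT depends_on_mono[OF depends_on_cnt]) auto
  have "P (?E \<inter> (?F \<inter> ?G)) = P ?E * P (?F \<inter> ?G)" unfolding M_def
  proof (rule bits_indep[OF finite_index depends_on_cnt])
    show "depends_on ({c} \<times> {T - 1..}) (?F \<inter> ?G)"
      by (intro depends_on_Int depends_on_mono[OF dF] depends_on_mono[OF dG]) auto
  qed auto
  also have "P (?F \<inter> ?G) = P ?F * P ?G" unfolding M_def
    by (rule bits_indep[OF finite_index dF dG]) auto
  also have "P ?E = (1 - p) ^ (T - 1)" using prob_zero[OF c, of "T - 1" 0] by (simp add: H_def)
  also have "P ?F = 1 - P {\<omega>. cnt \<omega> c (T - 1) T = 0}"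
    unfolding Collect_neg_eq by (rule prob_Compl)
  also have "\<dots> = p" using prob_zero[OF c, of T "T - 1"] T by (simp add: H_def)
  finally have eq: "P (?E \<inter> (?F \<inter> ?G)) = (1 - p) ^ (T - 1) * (p * P ?G)" .
  have "1 / 2 \<le> P ?G"
    using prob_Int_ge[of "early_ok' c" "late_ok c"] prob_not_late_ok[OF c] prob_not_early_ok'[OF c] eps_pos by simp
  hence "p * (1 / 2) \<le> p * P ?G" using p by (intro mult_left_mono) auto
  moreover have "\<epsilon> \<le> (1 - p) ^ (T - 1)" unfolding \<epsilon>_def using p by (intro power_decreasing) auto
  ultimately have "\<epsilon> * (p * (1 / 2)) \<le> (1 - p) ^ (T - 1) * (p * P ?G)"
    using p eps_pos by (intro mult_mono) auto
  thus ?thesis using eq measure_pmf.finite_measure_mono[OF sub, of M] by simp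
qed

section \<open>Blocks of nodes\<close>

definition block :: "nat \<Rightarrow> nat set" where
  "block k = {n - 2 * h * Suc k<..n - 2 * h * k}"

definition left_half :: "nat \<Rightarrow> nat set" where
  "left_half k = {n - 2 * h * Suc k<..n - 2 * h * k - h}"

text \<open>In block \<open>K\<close> the node \<open>b\<close> will be the rightmost
  \<open>last_one\<close>; all nodes of the block to the right of it are then
  \<open>ok\<close>.\<close>

definition block_event :: "nat \<Rightarrow> (nat \<times> nat \<Rightarrow> bool) set" where
  "block_event k = (if k < K then (\<Inter>c\<in>block k. ok c) \<inter> (\<Union>c\<in>left_half k. leader c)
     else (\<Inter>c\<in>block k. ok c \<union> last_one c) \<inter> (\<Union>c\<in>block k. last_one c))"

lemma range_block: "k \<le> K \<Longrightarrow> 2 * h * Suc k < n"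
proof -
  assume "k \<le> K"
  hence "2 * h * Suc k \<le> 2 * h * Suc K" by simp
  also have "\<dots> < n" using range by (simp only: K_def)
  finally show ?thesis .
qed

lemma block_index: "k \<le> K \<Longrightarrow> block k \<subseteq> {1..n}"
  by (auto simp: block_def)

lemma left_half_subset: "left_half k \<subseteq> block k"
  by (auto simp: left_half_def block_def)

lemma card_block: "k \<le> K \<Longrightarrow> card (block k) = 2 * h"
  using range_block[of k] by (simp add: block_def)

lemma card_left_half: "k \<le> K \<Longrightarrow> card (left_half k) = h"
  using range_block[of k] by (simp add: left_half_def)

lemma block_less: "j < k \<Longrightarrow> k \<le> K \<Longrightarrow> x \<in> block j \<Longrightarrow> y \<in> block k \<Longrightarrow> y < x"
proof -
  assume jk: "j < k" "k \<le> K" and x: "x \<in> block j" and y: "y \<in> block k"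
  have "2 * h * Suc j \<le> 2 * h * k" using jk by (intro mult_le_mono2) simp
  thus ?thesis using x y unfolding block_def by auto
qed

lemma depends_on_ok: "depends_on ({c} \<times> UNIV) (ok c)"
  unfolding ok_def act_def early_ok_def late_ok_def
  by (intro depends_on_Int depends_on_INT depends_on_mono[OF depends_on_cnt]) auto

lemma depends_on_leader: "depends_on ({c} \<times> UNIV) (leader c)"
  unfolding leader_def by (intro depends_on_Int depends_on_ok depends_on_mono[OF depends_on_cnt]) auto

lemma depends_on_last_one: "depends_on ({c} \<times> UNIV) (last_one c)"
  unfolding last_one_def by (intro depends_on_Int depends_on_mono[OF depends_on_cnt] depends_on_mono[OF depends_on_late]) auto

lemma depends_on_block: "depends_on (block k \<times> UNIV) (block_event k)"
proof -
  have *: "depends_on (block k \<times> UNIV) E" if "depends_on ({c} \<times> UNIV) E" "c \<in> block k" for c E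
    by (rule depends_on_mono[OF that(1)]) (use that(2) in auto)
  have o: "depends_on (block k \<times> UNIV) (ok c)" "depends_on (block k \<times> UNIV) (leader c)"
      "depends_on (block k \<times> UNIV) (last_one c)" if "c \<in> block k" for c
    using that by (auto intro: * depends_on_ok depends_on_leader depends_on_last_one)
  have l: "depends_on (block k \<times> UNIV) (leader c)" if "c \<in> left_half k" for c
    using that o(2) left_half_subset by blast
  show ?thesis unfolding block_event_def
    by (cases "k < K") (simp_all add: depends_on_Int depends_on_INT depends_on_UN depends_on_Un o l)
qed

lemma prod_block_ge:
  assumes k: "k \<le> K" and U: "\<And>c. c \<in> block k \<Longrightarrow> ok c \<subseteq> U c"
  shows "(1 - 2 * \<epsilon>) ^ (2 * h) \<le> (\<Prod>c\<in>block k. P (U c))"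
proof -
  have "(1 - 2 * \<epsilon>) ^ (2 * h) = (\<Prod>c\<in>block k. 1 - 2 * \<epsilon>)" using card_block[OF k] by simp
  also have "\<dots> \<le> (\<Prod>c\<in>block k. P (U c))"
  proof (intro prod_mono conjI)
    fix c assume c: "c \<in> block k"
    have "1 * \<epsilon> \<le> real (2 * h * (Suc (Suc (A * e) + e'))) * \<epsilon>"
    proof (rule mult_right_mono)
      have "1 \<le> 2 * h * (Suc (Suc (A * e) + e'))" using D by simp
      thus "1 \<le> real (2 * h * (Suc (Suc (A * e) + e')))" unfolding real_of_nat_ge_one_iff .
    qed (use eps_pos in simp)
    thus "0 \<le> 1 - 2 * \<epsilon>" using eps by (simp add: \<epsilon>_def)
    have "1 - 2 * \<epsilon> \<le> P (ok c)" using prob_ok c block_index[OF k] by auto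
    also have "\<dots> \<le> P (U c)" by (intro measure_pmf.finite_measure_mono U c) simp
    finally show "1 - 2 * \<epsilon> \<le> P (U c)" .
  qed
  finally show ?thesis .
qed

lemma prod_compl_le:
  assumes "finite L" and w: "\<And>c. c \<in> L \<Longrightarrow> w \<le> P (V c)" and w0: "0 \<le> w" "w \<le> 1" and h: "real h * w \<le> 1"
    and card: "h \<le> card L"
  shows "real h * w / 2 \<le> 1 - (\<Prod>c\<in>L. 1 - P (V c))"
proof -
  have "(\<Prod>c\<in>L. 1 - P (V c)) \<le> (\<Prod>c\<in>L. 1 - w)"
    using w by (intro prod_mono) auto
  also have "\<dots> = (1 - w) ^ card L" by simp
  also have "\<dots> \<le> (1 - w) ^ h" using w0 card by (intro power_decreasing) auto
  also have "\<dots> \<le> 1 - real h * w / 2" using one_minus_power_ge[OF w0 h] by simp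
  finally show ?thesis by simp
qed

lemma h_eps: "real h * \<epsilon> \<le> 1 / 16"
proof -
  have "real h * \<epsilon> * 2 \<le> real (2 * h * (Suc (Suc (A * e) + e'))) * \<epsilon>"
    using eps_pos by (auto simp: algebra_simps intro!: mult_nonneg_nonneg)
  thus ?thesis using eps by (simp add: \<epsilon>_def)
qed

lemma prob_block_event:
  assumes k: "k \<le> K"
  shows "(1 - 2 * \<epsilon>) ^ (2 * h) * (real h * \<epsilon> * p / 4) \<le> P (block_event k)"
proof -
  have nn: "0 \<le> (\<Prod>c\<in>block k. P (U c))" for U by (intro prod_nonneg) auto
  have ep2: "\<epsilon> * p \<le> \<epsilon>" "0 \<le> \<epsilon> * p" using eps_pos p mult_left_le[of p \<epsilon>] by auto
  hence ep: "\<epsilon> * p / 2 \<le> 1" "\<epsilon> * p \<le> \<epsilon>" "0 \<le> \<epsilon> * p" using eps_pos by linarith+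
  have hep: "real h * (\<epsilon> * p / 2) \<le> 1"
  proof -
    have "real h * (\<epsilon> * p / 2) \<le> real h * \<epsilon>" using ep by (intro mult_left_mono) auto
    thus ?thesis using h_eps by simp
  qed
  have hp: "real h * (\<epsilon> * p / 2) / 2 = real h * \<epsilon> * p / 4" by simp
  have disj: "({i} \<times> UNIV) \<inter> ({j} \<times> UNIV) = {}" if "i \<noteq> j" for i j :: nat using that by auto
  have fin: "finite (block k)" "finite (left_half k)" by (auto simp: block_def left_half_def)
  show ?thesis
  proof (cases "k < K")
    case True
    have "(1 - 2 * \<epsilon>) ^ (2 * h) * (real h * \<epsilon> * p / 4) \<le>
        (\<Prod>c\<in>block k. P (ok c)) * (1 - (\<Prod>c\<in>left_half k. 1 - P (leader c)))"
    proof (intro mult_mono prod_block_ge k nn)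
      show "real h * \<epsilon> * p / 4 \<le> 1 - (\<Prod>c\<in>left_half k. 1 - P (leader c))"
        unfolding hp[symmetric]
      proof (rule prod_compl_le)
        fix c assume "c \<in> left_half k"
        thus "\<epsilon> * p / 2 \<le> P (leader c)" using prob_leader block_index[OF k] left_half_subset by blast
      qed (use fin ep hep card_left_half[OF k] in auto)
    qed (use p eps_pos in auto)
    also have "\<dots> \<le> P ((\<Inter>c\<in>block k. ok c) \<inter> (\<Union>c\<in>left_half k. leader c))"
      unfolding M_def
      by (rule prob_block[OF finite_index fin(1) left_half_subset depends_on_ok depends_on_leader _ disj])
        (auto simp: leader_def)
    finally show ?thesis using True by (simp add: block_event_def)
  next
    case False
    have "(1 - 2 * \<epsilon>) ^ (2 * h) * (real h * \<epsilon> * p / 4) \<le>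
        (\<Prod>c\<in>block k. P (ok c \<union> last_one c)) * (1 - (\<Prod>c\<in>block k. 1 - P (last_one c)))"
    proof (intro mult_mono prod_block_ge k nn)
      show "real h * \<epsilon> * p / 4 \<le> 1 - (\<Prod>c\<in>block k. 1 - P (last_one c))"
        unfolding hp[symmetric]
      proof (rule prod_compl_le)
        fix c assume "c \<in> block k"
        hence "\<epsilon> / 2 \<le> P (last_one c)" using prob_last_one block_index[OF k] by auto
        thus "\<epsilon> * p / 2 \<le> P (last_one c)" using ep by linarith
      qed (use fin ep hep card_block[OF k] in auto)
    qed (use p eps_pos in auto)
    also have "\<dots> \<le> P ((\<Inter>c\<in>block k. ok c \<union> last_one c) \<inter> (\<Union>c\<in>block k. last_one c))"
      unfolding M_def
      by (rule prob_block[OF finite_index fin(1) subset_refl depends_on_Un[OF depends_on_ok depends_on_last_one] depends_on_last_one _ disj])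
        auto
    finally show ?thesis using False by (simp add: block_event_def)
  qed
qed

lemma prob_all_blocks: "3 / 4 * (real h * \<epsilon> * p / 4) ^ Suc K \<le> P (\<Inter>k\<in>{..K}. block_event k)"
proof -
  have eq: "P (\<Inter>k\<in>{..K}. block_event k) = (\<Prod>k\<in>{..K}. P (block_event k))"
    unfolding M_def
  proof (rule bits_indep_INT[OF finite_index _ depends_on_block])
    fix i j assume "i \<in> {..K}" "j \<in> {..K}" "i \<noteq> j"
    thus "block i \<times> UNIV \<inter> block j \<times> UNIV = {}"
      using block_less[of i j] block_less[of j i] by (metis Sigma_Int_distrib1 Sigma_empty1 atMost_iff disjoint_iff less_irrefl linorder_neqE_nat)
  qed simp
  define N where "N = 2 * h * Suc K"
  have N: "real N * \<epsilon> \<le> 1 / 8" using eps by (simp only: N_def K_def \<epsilon>_def)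
  have "1 \<le> N" using D by (simp add: N_def)
  hence "1 * \<epsilon> \<le> real N * \<epsilon>" using eps_pos by (intro mult_right_mono) auto
  hence e2: "2 * \<epsilon> \<le> 1" using N by simp
  \<comment> \<open>The \<open>N\<close> nodes fail to be \<open>ok\<close> with probability at most
    \<open>2 * \<epsilon>\<close> each, and \<open>2 * \<epsilon> * N\<close> is at most
    1/4.\<close>
  have "3 / 4 \<le> 1 + real N * (- 2 * \<epsilon>)" using N by simp
  also have "\<dots> \<le> (1 + (- 2 * \<epsilon>)) ^ N" using e2 by (intro Bernoulli_inequality) auto
  finally have "3 / 4 \<le> (1 - 2 * \<epsilon>) ^ N" by simp
  hence "3 / 4 * (real h * \<epsilon> * p / 4) ^ Suc K \<le> (1 - 2 * \<epsilon>) ^ N * (real h * \<epsilon> * p / 4) ^ Suc K"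
    using p eps_pos by (intro mult_right_mono) auto
  also have "\<dots> = (\<Prod>k\<in>{..K}. (1 - 2 * \<epsilon>) ^ (2 * h) * (real h * \<epsilon> * p / 4))"
    by (simp only: prod_constant card_atMost power_mult_distrib N_def power_mult)
  also have "\<dots> \<le> (\<Prod>k\<in>{..K}. P (block_event k))"
    using p eps_pos e2 prob_block_event by (intro prod_mono) auto
  finally show ?thesis using eq by simp
qed

lemma blocks_survive:
  assumes w: "\<omega> \<in> (\<Inter>k\<in>{..K}. block_event k)" and t: "t \<le> h"
  shows "\<exists>b. b < run n \<omega> t b"
proof -
  have ev: "\<omega> \<in> block_event k" if "k \<le> K" for k using w that by blast
  have "\<exists>c\<in>left_half k. \<omega> \<in> leader c" if "k < K" for k
    using ev[of k] that by (simp add: block_event_def)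
  then obtain a where a: "\<And>k. k < K \<Longrightarrow> a k \<in> left_half k" "\<And>k. k < K \<Longrightarrow> \<omega> \<in> leader (a k)"
    by metis
  \<comment> \<open>The first separator is \<open>n\<close> itself, whose interval never changes;
    the leader of block \<open>k\<close> is separator \<open>k + 1\<close>.\<close>
  define \<alpha> where "\<alpha> k = (if k = 0 then n else a (k - 1))" for k
  define Z where "Z = {c \<in> block K. \<omega> \<in> last_one c}"
  have "Z \<noteq> {}" using ev[of K] unfolding Z_def by (simp add: block_event_def) blast
  moreover have "finite Z" by (auto simp: Z_def block_def)
  ultimately have bZ: "Max Z \<in> Z" by (rule Max_in[rotated])
  define b where "b = Max Z"
  have b: "b \<in> block K" "\<omega> \<in> last_one b" using bZ by (auto simp: b_def Z_def)
  have Kpos: "0 < K" by (simp add: K_def)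
  have okc: "\<omega> \<in> ok c" if c: "b < c" "c \<le> n" for c
  proof -
    have "\<exists>k\<le>K. c \<in> block k"
    proof -
      define k where "k = (n - c) div (2 * h)"
      have h0: "0 < 2 * h" using D by simp
      have 1: "2 * h * k \<le> n - c" "n - c < 2 * h * Suc k"
        unfolding k_def using dividend_less_times_div[OF h0, of "n - c"] by (simp_all add: mult.commute)
      have "n - c < 2 * h * Suc K" using b c by (auto simp: block_def)
      hence "k \<le> K" unfolding k_def using h0 by (metis less_Suc_eq_le less_mult_imp_div_less mult.commute)
      moreover have "c \<in> block k" unfolding block_def using 1 c range_block[OF \<open>k \<le> K\<close>] by auto
      ultimately show ?thesis by auto
    qed
    then obtain k where k: "k \<le> K" "c \<in> block k" by auto
    have wk: "\<omega> \<in> block_event k" using ev k by blast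
    show ?thesis
    proof (cases "k < K")
      case True
      thus ?thesis using wk k by (simp add: block_event_def)
    next
      case False
      hence "k = K" using k by simp
      moreover have "c \<notin> Z" using c(1) Max_ge[OF \<open>finite Z\<close>, of c] by (auto simp: b_def)
      ultimately show ?thesis using wk k by (simp add: block_event_def Z_def) blast
    qed
  qed
  have left: "n - 2 * h * Suc k < a k" "a k + h \<le> n - 2 * h * k" if "k < K" for k
  proof -
    have *: "x < c \<Longrightarrow> c \<le> y - h \<Longrightarrow> c + h \<le> y" for x c y :: nat by simp
    have "n - 2 * h * Suc k < a k" "a k \<le> n - 2 * h * k - h"
      using a(1)[OF that] unfolding left_half_def greaterThanAtMost_iff by blast+
    note 1 = this
    show "n - 2 * h * Suc k < a k" by (rule 1(1))
    show "a k + h \<le> n - 2 * h * k" by (rule *[OF 1])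
  qed
  have "b < run n \<omega> t b"
  proof (rule survival[where \<alpha> = \<alpha> and K = K and h = h and T = T and D = D and A = A and \<sigma> = \<sigma> and e = e and e' = e'])
    show "1 \<le> b" using b block_index[of K] by auto
    show "b < \<alpha> K"
    proof -
      have "n - 2 * h * K < a (K - 1)" using left(1)[of "K - 1"] Kpos by simp
      moreover have "b \<le> n - 2 * h * K" using b by (simp add: block_def)
      ultimately show ?thesis using Kpos by (simp add: \<alpha>_def)
    qed
    show "\<alpha> 0 = n" by (simp add: \<alpha>_def)
    show "\<alpha> (Suc k) + h \<le> \<alpha> k" if "k < K" for k
    proof (cases k)
      case 0
      thus ?thesis using left(2)[of 0] Kpos by (simp add: \<alpha>_def)
    next
      case (Suc j)
      hence "a k + h \<le> n - 2 * h * k" "n - 2 * h * k < a j" using left(2)[of k] left(1)[of j] that by simp_all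
      thus ?thesis using Suc by (simp add: \<alpha>_def)
    qed
    show "\<not> \<omega> (b, s)" if "s < T" for s
      using b(2) that cnt_pos_iff[of \<omega> b 0 T] unfolding last_one_def by fastforce
    show "\<not> \<omega> (\<alpha> k, s)" if "0 < k" "k \<le> K" "Suc s < T" for k s
      proof -
      have "cnt \<omega> (a (k - 1)) 0 (T - 1) = 0" using a(2)[of "k - 1"] that by (simp add: leader_def)
      thus ?thesis using cnt_pos_iff[of \<omega> "a (k - 1)" 0 "T - 1"] that by (simp add: \<alpha>_def)
    qed
    show "\<exists>s<T. \<omega> (c, s)" if "b < c" "c \<le> n" for c
      using okc[OF that] cnt_pos_iff[of \<omega> c 0 T] by (simp add: ok_def act_def)
    show "i + 1 \<le> cnt \<omega> c 0 (T + A * i)" if "b < c" "c \<le> n" "1 \<le> i" "i \<le> 2 * D div A" for c i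
      using okc[OF that(1,2)] that(3,4) by (simp add: ok_def early_ok_def)
    show "i + 1 \<le> cnt \<omega> c T (T + \<sigma> \<mu> i)"
      if "b < c" "c \<le> n" "D \<le> \<mu>" "\<mu> \<le> h" "i \<le> h" "(i + \<mu>) * D \<le> \<mu>\<^sup>2" for c \<mu> i
    proof -
      have "(\<mu>, i) \<in> pairs" using that by (auto simp: pairs_def)
      thus ?thesis using okc[OF that(1,2)] by (fastforce simp: ok_def late_ok_def)
    qed
    show "cnt \<omega> b T (T + \<sigma> \<mu> i) \<le> \<mu> + i"
      if "D \<le> \<mu>" "\<mu> \<le> h" "i \<le> h" "(i + \<mu>) * D \<le> \<mu>\<^sup>2" for \<mu> i
    proof -
      have "(\<mu>, i) \<in> pairs" using that by (auto simp: pairs_def)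
      thus ?thesis using b(2) by (fastforce simp: last_one_def late_ok_def)
    qed
  qed (use A D K_def t in simp_all)
  thus ?thesis by blast
qed

lemma not_bot_prob_ge:
  assumes "t \<le> h"
  shows "3 / 4 * (real h * (1 - p) ^ T * p / 4) ^ (A * e + e' + 2) \<le>
    measure_pmf.prob (ungarian_dist (tamari n) (weak_le n) p t) {x. x \<noteq> lat_bot (tamari n) (weak_le n)}"
proof -
  have "3 / 4 * (real h * (1 - p) ^ T * p / 4) ^ (A * e + e' + 2) = 3 / 4 * (real h * \<epsilon> * p / 4) ^ Suc K"
    by (simp add: K_def \<epsilon>_def)
  also have "\<dots> \<le> P (\<Inter>k\<in>{..K}. block_event k)" by (rule prob_all_blocks)
  also have "\<dots> \<le> P {\<omega>. \<exists>b. b < run n \<omega> t b}"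
    using blocks_survive[OF _ assms] by (intro measure_pmf.finite_measure_mono) auto
  also have "\<dots> = measure_pmf.prob (ungarian_dist (tamari n) (weak_le n) p t) {x. x \<noteq> lat_bot (tamari n) (weak_le n)}"
    unfolding M_def by (rule prob_not_bot[symmetric]) (use assms in \<open>simp add: H_def\<close>)
  finally show ?thesis .
qed

end


section \<open>The expected number of steps\<close>

text \<open>By \<open>run_le_cnt\<close>, a node that is not yet a leaf has at most \<open>n\<close>
  activations. This is at most half of the mean \<open>t * p\<close>, so Hoeffding and a union over
  the nodes give exponential decay.\<close>

lemma not_bot_geometric:
  assumes p: "0 < p" "p < 1" and t: "2 * real n \<le> real t * p" "0 < t"
  shows "measure_pmf.prob (ungarian_dist (tamari n) (weak_le n) p t) {x. x \<noteq> lat_bot (tamari n) (weak_le n)}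
    \<le> real n * exp (- (p\<^sup>2 / 2)) ^ t"
proof -
  let ?M = "bits_pmf p ({1..n} \<times> {..<t})"
  have "measure_pmf.prob (ungarian_dist (tamari n) (weak_le n) p t) {x. x \<noteq> lat_bot (tamari n) (weak_le n)} =
      measure_pmf.prob ?M {\<omega>. \<exists>b. b < run n \<omega> t b}" by (rule prob_not_bot) simp
  also have "\<dots> \<le> measure_pmf.prob ?M (\<Union>b\<in>{1..n}. {\<omega>. cnt \<omega> b 0 t \<le> n})"
  proof (intro measure_pmf.finite_measure_mono subsetI)
    fix \<omega> assume "\<omega> \<in> {\<omega>. \<exists>b. b < run n \<omega> t b}"
    then obtain b where b: "b < run n \<omega> t b" by auto
    hence "b \<in> {1..n}" using bvec_outside[OF run_bvec, of b n \<omega> t] by (metis less_irrefl)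
    moreover have "run n \<omega> t b \<le> max b (n - cnt \<omega> b 0 t)"
      by (rule run_le_cnt) (use calculation in auto)
    hence "cnt \<omega> b 0 t \<le> n" using b by auto
    ultimately show "\<omega> \<in> (\<Union>b\<in>{1..n}. {\<omega>. cnt \<omega> b 0 t \<le> n})" by auto
  qed simp
  also have "\<dots> \<le> (\<Sum>b\<in>{1..n}. measure_pmf.prob ?M {\<omega>. cnt \<omega> b 0 t \<le> n})"
    by (rule measure_pmf.finite_measure_subadditive_finite) auto
  also have "\<dots> \<le> (\<Sum>b\<in>{1..n}. exp (- (p\<^sup>2 / 2)) ^ t)"
  proof (rule sum_mono)
    fix b assume b: "b \<in> {1..n}"
    have "measure_pmf.prob ?M {\<omega>. cnt \<omega> b 0 t \<le> n} = measure_pmf.prob (binomial_pmf (t - 0) p) {k. k \<le> n}"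
      by (rule prob_cnt) (use b p in auto)
    also have "t - 0 = t" by simp
    also have "measure_pmf.prob (binomial_pmf t p) {k. k \<le> n} \<le> measure_pmf.prob (binomial_pmf t p) {k. real k \<le> real t * p - real t * p / 2}"
    proof (intro measure_pmf.finite_measure_mono subsetI)
      fix k assume "k \<in> {k. k \<le> n}"
      hence "real k \<le> real n" by simp
      hence "real k \<le> real t * p - real t * p / 2" using t by linarith
      thus "k \<in> {k. real k \<le> real t * p - real t * p / 2}" by simp
    qed simp
    also have "\<dots> \<le> exp (- 2 * (real t * p / 2)\<^sup>2 / real t)"
      by (rule binomial_distribution.prob_le) (use p t in \<open>auto simp: binomial_distribution_def\<close>)
    also have "- 2 * (real t * p / 2)\<^sup>2 / real t = real t * (- (p\<^sup>2 / 2))"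
      using t by (simp add: power2_eq_square field_simps)
    also have "exp \<dots> = exp (- (p\<^sup>2 / 2)) ^ t" by (rule exp_of_nat_mult)
    finally show "measure_pmf.prob ?M {\<omega>. cnt \<omega> b 0 t \<le> n} \<le> exp (- (p\<^sup>2 / 2)) ^ t" .
  qed
  also have "\<dots> = real n * exp (- (p\<^sup>2 / 2)) ^ t" by simp
  finally show ?thesis .
qed

text \<open>The expectation is defined as a real infinite sum, which bounds its partial sums from
  above only once it is known to converge.\<close>

lemma summable_not_bot:
  assumes p: "0 < p" "p < 1"
  shows "summable (\<lambda>t. measure_pmf.prob (ungarian_dist (tamari n) (weak_le n) p t)
    {x. x \<noteq> lat_bot (tamari n) (weak_le n)})"
proof (rule summable_comparison_test')
  show "summable (\<lambda>t. real n * exp (- (p\<^sup>2 / 2)) ^ t)"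
    using p by (intro summable_mult summable_geometric) auto
  fix t assume "t \<ge> nat \<lceil>2 * real n / p\<rceil> + 1"
  hence "2 * real n / p \<le> real t" "0 < t" by linarith+
  thus "norm (measure_pmf.prob (ungarian_dist (tamari n) (weak_le n) p t)
    {x. x \<noteq> lat_bot (tamari n) (weak_le n)}) \<le> real n * exp (- (p\<^sup>2 / 2)) ^ t"
    using not_bot_geometric[OF p, of n t] p by (simp add: field_simps)
qed

lemma ungarian_expect_ge:
  assumes p: "0 < p" "p < 1"
    and ge: "\<And>t. t < S \<Longrightarrow> c \<le> measure_pmf.prob (ungarian_dist (tamari n) (weak_le n) p t)
      {x. x \<noteq> lat_bot (tamari n) (weak_le n)}"
  shows "real S * c \<le> ungarian_expect (tamari n) (weak_le n) p"
proof -
  let ?f = "\<lambda>t. measure_pmf.prob (ungarian_dist (tamari n) (weak_le n) p t)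
      {x. x \<noteq> lat_bot (tamari n) (weak_le n)}"
  have "real S * c = (\<Sum>t<S. c)" by simp
  also have "\<dots> \<le> (\<Sum>t<S. ?f t)" using ge by (intro sum_mono) auto
  also have "\<dots> \<le> (\<Sum>t. ?f t)" by (rule sum_le_suminf[OF summable_not_bot[OF p]]) auto
  finally show ?thesis by (simp add: ungarian_expect_def)
qed

lemma ungarian_expect_ge_1:
  assumes p: "0 < p" "p < 1" and n: "2 \<le> n"
  shows "1 \<le> ungarian_expect (tamari n) (weak_le n) p"
proof -
  have "{\<omega>. \<exists>b. b < run n \<omega> 0 b} = UNIV" using n by (auto simp: bvec_top_def intro!: exI[of _ 1])
  hence "measure_pmf.prob (ungarian_dist (tamari n) (weak_le n) p 0) {x. x \<noteq> lat_bot (tamari n) (weak_le n)} = 1"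
    using prob_not_bot[of 0 0 n p] by simp
  thus ?thesis using ungarian_expect_ge[OF p, of 1 1 n] by simp
qed


section \<open>An upper bound for the liminf of the uniqueness probabilities\<close>

lemma geom1_tail:
  assumes p: "0 < p" "p < 1"
  shows "measure_pmf.prob (geom1_pmf p) {x. x \<le> T} = 1 - (1 - p) ^ T"
proof -
  have "measure_pmf.prob (geom1_pmf p) {x. x \<le> T} = measure_pmf.prob (geometric_pmf p) {..<T}"
    unfolding geom1_pmf_def by (simp add: vimage_def less_eq_Suc_le lessThan_def)
  also have "\<dots> = (\<Sum>k<T. pmf (geometric_pmf p) k)" by (rule measure_measure_pmf_finite) simp
  also have "\<dots> = (\<Sum>k<T. (1 - p) ^ k) * p" using p by (simp add: geometric_pmf.rep_eq sum_distrib_right)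
  also have "\<dots> = 1 - (1 - p) ^ T" using p by (simp add: sum_gp_strict)
  finally show ?thesis .
qed

text \<open>A unique maximum above \<open>T + 1\<close> gives the first term and one at most
  \<open>T\<close> the second. If the maximum is \<open>T + 1\<close>, uniqueness leaves exactly one
  variable above \<open>T\<close>, which gives the third.\<close>

lemma zeta_le:
  assumes p: "0 < p" "p < 1"
  defines "q \<equiv> 1 - p"
  shows "zeta p m \<le> real m * q ^ Suc T + (1 - q ^ T) ^ m + real m * q ^ T * (1 - q ^ T) ^ (m - 1)"
proof -
  let ?M = "Pi_pmf {..<m} (0::nat) (\<lambda>_. geom1_pmf p)"
  let ?E1 = "\<Union>i\<in>{..<m}. {f. T + 1 < f i}"
  let ?E2 = "{f. \<forall>i<m. f i \<le> T}"
  let ?E3 = "\<Union>i\<in>{..<m}. {f. T < f i \<and> (\<forall>j<m. j \<noteq> i \<longrightarrow> f j \<le> T)}"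
  have q: "0 < q" "q < 1" using p by (auto simp: q_def)
  have sub: "{f. \<exists>!i. i < m \<and> f i = Max (f ` {..<m})} \<subseteq> ?E1 \<union> (?E2 \<union> ?E3)"
  proof
    fix f :: "nat \<Rightarrow> nat" assume "f \<in> {f. \<exists>!i. i < m \<and> f i = Max (f ` {..<m})}"
    then obtain i where i: "i < m" "f i = Max (f ` {..<m})"
      and uniq: "\<And>j. j < m \<Longrightarrow> f j = Max (f ` {..<m}) \<Longrightarrow> j = i" by blast
    have le: "f j \<le> f i" if "j < m" for j unfolding i(2) using that by (intro Max_ge) auto
    show "f \<in> ?E1 \<union> (?E2 \<union> ?E3)"
    proof (cases "f i \<le> T \<or> T + 1 < f i")
      case True
      thus ?thesis using le i(1) by (auto intro: order_trans)
    next
      case False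
      hence fi: "f i = T + 1" by auto
      have "f j \<le> T" if "j < m" "j \<noteq> i" for j
      proof -
        have "f j \<noteq> f i" using uniq[OF that(1)] that(2) i(2) by auto
        thus ?thesis using le[OF that(1)] fi by linarith
      qed
      hence "f \<in> ?E3" using fi i(1) by (intro UN_I[of i]) auto
      thus ?thesis by blast
    qed
  qed
  have E1: "measure_pmf.prob ?M ?E1 \<le> real m * q ^ Suc T"
  proof -
    have "measure_pmf.prob ?M ?E1 \<le> (\<Sum>i\<in>{..<m}. measure_pmf.prob ?M {f. T + 1 < f i})"
      by (rule measure_pmf.finite_measure_subadditive_finite) auto
    also have "\<dots> = (\<Sum>i\<in>{..<m}. q ^ Suc T)"
    proof (rule sum.cong)
      fix i assume i: "i \<in> {..<m}"
      have "measure_pmf.prob ?M {f. T + 1 < f i} = measure_pmf.prob (map_pmf (\<lambda>f. f i) ?M) {x. T + 1 < x}" by simp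
      also have "map_pmf (\<lambda>f. f i) ?M = geom1_pmf p" using i by (subst Pi_pmf_component) auto
      also have "measure_pmf.prob (geom1_pmf p) {x. T + 1 < x} = 1 - measure_pmf.prob (geom1_pmf p) {x. x \<le> T + 1}"
        using measure_pmf.prob_compl[of "{x. x \<le> T + 1}" "geom1_pmf p"]
        by (simp add: Compl_eq_Diff_UNIV[symmetric] Collect_neg_eq[symmetric] not_le)
      finally show "measure_pmf.prob ?M {f. T + 1 < f i} = q ^ Suc T"
        using geom1_tail[OF p, of "T + 1"] by (simp add: q_def)
    qed simp
    finally show ?thesis by simp
  qed
  have E2: "measure_pmf.prob ?M ?E2 = (1 - q ^ T) ^ m"
  proof -
    have "measure_pmf.prob ?M ?E2 = measure_pmf.prob ?M (Pi {..<m} (\<lambda>_. {x. x \<le> T}))"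
      by (intro arg_cong[where f = "measure_pmf.prob ?M"]) (auto simp: Pi_def)
    also have "\<dots> = (1 - q ^ T) ^ m"
      by (subst measure_Pi_pmf_Pi) (simp_all add: geom1_tail[OF p] q_def)
    finally show ?thesis .
  qed
  have E3: "measure_pmf.prob ?M ?E3 \<le> real m * q ^ T * (1 - q ^ T) ^ (m - 1)"
  proof -
    have "measure_pmf.prob ?M ?E3 \<le> (\<Sum>i\<in>{..<m}. measure_pmf.prob ?M {f. T < f i \<and> (\<forall>j<m. j \<noteq> i \<longrightarrow> f j \<le> T)})"
      by (rule measure_pmf.finite_measure_subadditive_finite) auto
    also have "\<dots> = (\<Sum>i\<in>{..<m}. q ^ T * (1 - q ^ T) ^ (m - 1))"
    proof (rule sum.cong)
      fix i assume i: "i \<in> {..<m}"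
      have "measure_pmf.prob ?M {f. T < f i \<and> (\<forall>j<m. j \<noteq> i \<longrightarrow> f j \<le> T)} =
          measure_pmf.prob ?M (Pi {..<m} (\<lambda>j. if j = i then {x. T < x} else {x. x \<le> T}))"
        using i by (intro arg_cong[where f = "measure_pmf.prob ?M"]) (auto simp: Pi_def split: if_splits)
      also have "\<dots> = (\<Prod>j\<in>{..<m}. measure_pmf.prob (geom1_pmf p) (if j = i then {x. T < x} else {x. x \<le> T}))"
        by (rule measure_Pi_pmf_Pi) simp
      also have "\<dots> = measure_pmf.prob (geom1_pmf p) {x. T < x} *
          (\<Prod>j\<in>{..<m} - {i}. measure_pmf.prob (geom1_pmf p) {x. x \<le> T})"
        using i by (subst prod.remove[of _ i]) (auto intro!: prod.cong)
      also have "measure_pmf.prob (geom1_pmf p) {x. T < x} = 1 - measure_pmf.prob (geom1_pmf p) {x. x \<le> T}"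
        using measure_pmf.prob_compl[of "{x. x \<le> T}" "geom1_pmf p"]
        by (simp add: Compl_eq_Diff_UNIV[symmetric] Collect_neg_eq[symmetric] not_le)
      finally show "measure_pmf.prob ?M {f. T < f i \<and> (\<forall>j<m. j \<noteq> i \<longrightarrow> f j \<le> T)} = q ^ T * (1 - q ^ T) ^ (m - 1)"
        using i geom1_tail[OF p, of T] by (simp add: q_def)
    qed simp
    finally show ?thesis by simp
  qed
  have "zeta p m \<le> measure_pmf.prob ?M (?E1 \<union> (?E2 \<union> ?E3))"
    unfolding zeta_def by (rule measure_pmf.finite_measure_mono[OF sub]) simp
  also have "\<dots> \<le> measure_pmf.prob ?M ?E1 + measure_pmf.prob ?M (?E2 \<union> ?E3)" by (rule measure_Un_le) auto
  also have "measure_pmf.prob ?M (?E2 \<union> ?E3) \<le> measure_pmf.prob ?M ?E2 + measure_pmf.prob ?M ?E3"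
    by (rule measure_Un_le) auto
  finally show ?thesis using E1 E2 E3 by simp
qed

text \<open>The values \<open>m \<approx> ln (1/q) / q^T\<close> are those for which typically several variables exceed
  \<open>T\<close> but none exceeds \<open>T + 1\<close>.\<close>

lemma zeta_small_frequently:
  assumes p: "0 < p" "p < 1"
  shows "\<exists>m\<ge>N. zeta p m \<le> 5 * (1 - p) * (1 + ln (1 / (1 - p)))"
proof -
  define q where "q = 1 - p"
  define \<Lambda> where "\<Lambda> = ln (1 / q)"
  have q: "0 < q" "q < 1" using p by (auto simp: q_def)
  have \<Lambda>: "0 < \<Lambda>" "exp (- \<Lambda>) = q" using q by (auto simp: \<Lambda>_def ln_div)
  have "(\<lambda>T. q ^ T) \<longlonglongrightarrow> 0" using q by (intro LIMSEQ_power_zero) auto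
  hence "eventually (\<lambda>T. q ^ T < \<Lambda> / (real N + 1)) sequentially"
    using \<Lambda> by (intro order_tendstoD(2)[where y = 0]) auto
  then obtain T where T: "q ^ T < \<Lambda> / (real N + 1)" by (auto simp: eventually_sequentially)
  define \<epsilon> where "\<epsilon> = q ^ T"
  have \<epsilon>: "0 < \<epsilon>" "\<epsilon> \<le> 1" using q by (auto simp: \<epsilon>_def power_le_one)
  define m where "m = nat \<lceil>\<Lambda> / \<epsilon>\<rceil>"
  have "0 < \<Lambda> / \<epsilon>" using \<Lambda> \<epsilon> by simp
  hence m1: "\<Lambda> / \<epsilon> \<le> real m" and m2: "real m < \<Lambda> / \<epsilon> + 1" unfolding m_def by linarith+
  have "real N + 1 \<le> \<Lambda> / \<epsilon>" using T \<epsilon> by (simp add: \<epsilon>_def field_simps)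
  hence mN: "m \<ge> N" "m \<ge> 1" using m1 by linarith+
  \<comment> \<open>The mean number of variables above \<open>T\<close> is between
    \<open>\<Lambda>\<close> and \<open>\<Lambda> + 1\<close>. So at most one of them is above
    \<open>T\<close> with probability of order q (1 + \<Lambda>), and the mean number above
    \<open>T + 1\<close> is of the same order.\<close>
  have l1: "\<Lambda> \<le> real m * \<epsilon>" using m1 \<epsilon> by (simp add: field_simps)
  have l2: "real m * \<epsilon> \<le> \<Lambda> + 1" using m2 \<epsilon> by (simp add: field_simps)
  have "real m * q ^ Suc T = q * (real m * \<epsilon>)" by (simp add: \<epsilon>_def)
  also have "\<dots> \<le> q * (\<Lambda> + 1)" using l2 q by (intro mult_left_mono) auto
  finally have b1: "real m * q ^ Suc T \<le> q * (\<Lambda> + 1)" .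
  have pow: "(1 - \<epsilon>) ^ k \<le> exp (- (real k * \<epsilon>))" for k
  proof -
    have "(1 - \<epsilon>) ^ k \<le> exp (- \<epsilon>) ^ k" using \<epsilon> exp_ge_add_one_self[of "- \<epsilon>"] by (intro power_mono) auto
    thus ?thesis by (simp add: exp_of_nat_mult[symmetric])
  qed
  have "(1 - \<epsilon>) ^ m \<le> exp (- \<Lambda>)" using pow[of m] l1 by (meson exp_le_cancel_iff neg_le_iff_le order_trans)
  hence b2: "(1 - \<epsilon>) ^ m \<le> q * 1" using \<Lambda> by simp
  have "(1 - \<epsilon>) ^ (m - 1) \<le> exp (1 - \<Lambda>)"
  proof -
    have "real (m - 1) * \<epsilon> = real m * \<epsilon> - \<epsilon>" using mN by (simp add: of_nat_diff algebra_simps)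
    hence "- (real (m - 1) * \<epsilon>) \<le> 1 - \<Lambda>" using l1 \<epsilon> by simp
    thus ?thesis using pow[of "m - 1"] by (meson exp_le_cancel_iff order_trans)
  qed
  also have "exp (1 - \<Lambda>) = exp 1 * q" using \<Lambda> by (simp add: exp_diff exp_minus field_simps)
  also have "\<dots> \<le> 3 * q" using exp_le q by (intro mult_right_mono) auto
  finally have "real m * \<epsilon> * (1 - \<epsilon>) ^ (m - 1) \<le> (\<Lambda> + 1) * (3 * q)"
    using l2 \<epsilon> \<Lambda> by (intro mult_mono) auto
  hence "zeta p m \<le> q * (\<Lambda> + 1) + q * 1 + (\<Lambda> + 1) * (3 * q)"
    using zeta_le[OF p, of m T] b1 b2 unfolding q_def[symmetric] \<epsilon>_def[symmetric] by linarith
  also have "\<dots> \<le> 5 * q * (1 + \<Lambda>)" using q \<Lambda> by (simp add: algebra_simps)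
  finally show ?thesis using mN by (auto simp: q_def \<Lambda>_def)
qed

lemma zeta_minus_le:
  assumes "\<And>N. \<exists>m\<ge>N. zeta p m \<le> B"
  shows "zeta_minus p \<le> B"
proof -
  let ?L = "liminf (\<lambda>n. ereal (zeta p n))"
  have z: "0 \<le> zeta p m" for m by (simp add: zeta_def)
  have "?L \<le> ereal B" unfolding liminf_SUP_INF
  proof (rule SUP_least)
    fix N :: nat
    obtain m where "m \<ge> N" "zeta p m \<le> B" using assms by blast
    thus "(INF m\<in>{N..}. ereal (zeta p m)) \<le> ereal B" by (intro INF_lower2[of m]) auto
  qed
  moreover have "0 \<le> ?L" using z by (intro Liminf_bounded) auto
  ultimately have "real_of_ereal ?L \<le> real_of_ereal (ereal B)" by (intro real_of_ereal_positive_mono) auto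
  thus ?thesis by (simp add: zeta_minus_def)
qed

lemma zeta_minus_bounds:
  assumes p: "0 < p" "p < 1"
  shows "zeta_minus p \<le> 1" "zeta_minus p \<le> 5 * (1 - p) * (1 + ln (1 / (1 - p)))"
proof -
  show "zeta_minus p \<le> 1" by (rule zeta_minus_le) (auto simp: zeta_def)
  show "zeta_minus p \<le> 5 * (1 - p) * (1 + ln (1 / (1 - p)))"
    by (rule zeta_minus_le[OF zeta_small_frequently[OF p]])
qed


section \<open>Choice of the parameters\<close>

text \<open>The eighth root \<open>v\<close> of ln n is the yardstick: since
  \<open>10000 / p \<le> v\<close>, the quantities 1/p, log log n and the parameters are bounded by
  powers of \<open>v\<close>, and most inequalities become comparisons of exponents. The factor
  \<open>5 * (1 - p) * (1 + ln (real n))\<close> stands for \<open>zeta_minus p\<close>.\<close>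

lemma lower_bound_large:
  fixes p \<Gamma> v :: real and n :: nat
  assumes p: "0 < p" "p < 1" and n: "16 \<le> n" and nq: "1 \<le> real n * (1 - p)"
    and v: "v ^ 8 = ln (real n)" "10000 / p \<le> v" and \<Gamma>: "43 / p \<le> \<Gamma>"
  shows "5 * (1 - p) * (1 + ln (real n)) * real n * exp (- (\<Gamma> * ln (ln (real n)) ^ 4))
           \<le> ungarian_expect (tamari n) (weak_le n) p"
proof -
  define q where "q = 1 - p"
  define N where "N = ln (real n)"
  define l where "l = ln N"
  define P where "P = 1 / p"
  define u where "u = ln (1 / q)"
  have q: "0 < q" "q < 1" using p by (auto simp: q_def)
  have P: "1 \<le> P" "p * P = 1" using p by (auto simp: P_def field_simps)
  have vP: "10000 * P \<le> v" using v by (simp add: P_def)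
  have v1: "10000 \<le> v" using vP P by linarith
  have N: "N = v ^ 8" using v by (simp add: N_def)
  have vk: "v ^ j \<le> v ^ k" if "j \<le> k" for j k using that v1 by (intro power_increasing) auto
  have v4: "10000 \<le> v ^ k" if "1 \<le> k" for k using vk[OF that] v1 by simp
  have N0: "10000 \<le> N" using v4[of 8] N by simp
  have n0: "real n = exp N" using n by (simp add: N_def)
  have el: "exp l = N" using N0 by (simp add: l_def)
  have e2l: "exp (2 * l) = N * N" unfolding mult_2 exp_add el ..
  have l8: "l = 8 * ln v" using v1 by (simp add: l_def N ln_realpow)
  have "ln v \<le> v" using ln_bound[of v] v1 by linarith
  hence lv: "l \<le> 8 * v" using l8 by simp
  have l1: "1 \<le> l"
  proof -
    have "exp 1 \<le> N" using exp_le N0 by linarith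
    thus ?thesis using el by (metis exp_le_cancel_iff)
  qed
  have PN: "P \<le> v / 10000" using vP by simp

  have u: "p \<le> u" "0 < u" "u \<le> N"
  proof -
    have "ln q \<le> q - 1" using q by (intro ln_le_minus_one) auto
    thus up: "p \<le> u" using q by (simp add: u_def ln_div q_def)
    thus "0 < u" using p by simp
    have "1 / q \<le> real n" using nq q by (simp add: q_def field_simps)
    thus "u \<le> N" unfolding u_def N_def using q by (intro ln_mono) auto
  qed
  \<comment> \<open>Rounding down places \<open>\<epsilon> = q ^ T\<close> between
    \<open>1 / n\<close> and \<open>1 / (n * q)\<close>. The factor \<open>q\<close> between these
    bounds is the loss that \<open>zeta_minus\<close> makes good.\<close>
  define T where "T = nat \<lfloor>N / u\<rfloor>"
  have Nu: "1 \<le> N / u" using u by simp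
  have T: "1 \<le> T" "real T \<le> N / u" "N / u < real T + 1" unfolding T_def using Nu by linarith+
  define \<epsilon> where "\<epsilon> = q ^ T"
  have eu: "\<epsilon> = exp (- (real T * u))"
    using q by (simp add: \<epsilon>_def u_def ln_div exp_of_nat_mult)
  have \<epsilon>: "0 < \<epsilon>" using q by (simp add: \<epsilon>_def)
  have ne: "1 \<le> real n * \<epsilon>"
  proof -
    have "real T * u \<le> N" using T u by (simp add: field_simps)
    thus ?thesis unfolding n0 eu exp_add[symmetric] by simp
  qed
  have qne: "real n * q * \<epsilon> \<le> 1"
  proof -
    have "q = exp (- u)" using q by (simp add: u_def ln_div)
    moreover have "N \<le> real T * u + u" using T u by (simp add: field_simps)
    ultimately show ?thesis unfolding n0 eu by (simp add: exp_add[symmetric])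
  qed
  have eq: "\<epsilon> \<le> q" unfolding \<epsilon>_def using q power_decreasing[of 1 T q] T by simp
  \<comment> \<open>Since \<open>\<epsilon>\<close> is at most both \<open>q\<close> and
    \<open>1 / (n * q)\<close>, it is at most the inverse square root of \<open>n\<close>, however
    small \<open>q\<close> is.\<close>
  have e2: "exp (N / 2) \<le> 1 / \<epsilon>"
  proof -
    have "real n * \<epsilon> * \<epsilon> \<le> real n * q * \<epsilon>" using eq \<epsilon> by (intro mult_right_mono mult_left_mono) auto
    hence "real n * \<epsilon> * \<epsilon> \<le> 1" using qne by linarith
    hence "exp N \<le> (1 / \<epsilon>)\<^sup>2" using \<epsilon> n0 by (simp add: field_simps power2_eq_square)
    also have "exp N = (exp (N / 2))\<^sup>2" by (simp add: power2_eq_square exp_add[symmetric])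
    finally show ?thesis by (rule power2_le_imp_le) (use \<epsilon> in simp)
  qed

  \<comment> \<open>Then \<open>D * p / 2 \<ge> 4 * N\<close>, so the Hoeffding errors are at most
    n^(-4), which beats both the number of pairs and \<open>\<epsilon>\<close>.\<close>
  define D where "D = nat \<lceil>8 * N * P\<rceil>"
  have NP: "10000 \<le> N * P" using mult_mono[of 10000 N 1 P] N0 P by simp
  have D: "8 * N * P \<le> real D" "real D \<le> 8 * N * P + 1" unfolding D_def using NP by linarith+
  \<comment> \<open>Then \<open>(1 - p) ^ (A - 1)\<close> is at most N^(-6), against
    \<open>T + 2 * D + 1 \<le> N * N\<close>.\<close>
  define A where "A = nat \<lceil>6 * l * P\<rceil> + 1"
  have lP: "1 \<le> l * P" using mult_mono[of 1 l 1 P] l1 P by simp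
  have A: "6 * l * P \<le> real (A - 1)" "real A \<le> 6 * l * P + 2" unfolding A_def using lP by linarith+
  \<comment> \<open>Then \<open>2 ^ e\<close> is at least N^2. This suffices for both phases: it
    exceeds \<open>2 * D\<close>, and \<open>2 ^ 2 ^ e\<close> exceeds \<open>n\<close>.\<close>
  define e where "e = nat \<lceil>3 * l\<rceil>"
  have e: "3 * l \<le> real e" "real e \<le> 3 * l + 1" unfolding e_def using l1 by linarith+
  \<comment> \<open>The number \<open>K + 1\<close> of blocks.\<close>
  define \<kappa> where "\<kappa> = A * e + e + 2"
  have llP: "l \<le> l\<^sup>2 * P" "1 \<le> l\<^sup>2 * P"
    using mult_mono[of l "l\<^sup>2" 1 P] l1 P self_le_power[of l 2] by auto
  have \<kappa>: "real \<kappa> \<le> 40 * l\<^sup>2 * P"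
  proof -
    have "real A * real e \<le> (8 * (l * P)) * (4 * l)" using A e lP l1 by (intro mult_mono) auto
    also have "\<dots> = 32 * (l\<^sup>2 * P)" by (simp add: power2_eq_square)
    finally have "real A * real e \<le> 32 * (l\<^sup>2 * P)" .
    moreover have "real e + 2 \<le> 3 * (l\<^sup>2 * P) + 3 * (l\<^sup>2 * P)" using e llP by linarith
    moreover have "real \<kappa> = real A * real e + (real e + 2)" by (simp add: \<kappa>_def)
    ultimately show ?thesis using llP by linarith
  qed
  have \<kappa>v: "real \<kappa> \<le> v ^ 3"
  proof -
    have "40 * l\<^sup>2 * P \<le> 40 * (8 * v)\<^sup>2 * (v / 10000)"
      using lv l1 PN P v1 by (intro mult_mono power_mono) auto
    also have "\<dots> \<le> v ^ 3" using v1 by (simp add: power2_eq_square power3_eq_cube)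
    finally show ?thesis using \<kappa> by simp
  qed
  have \<kappa>0: "2 \<le> \<kappa>" by (simp add: \<kappa>_def)
  \<comment> \<open>Then the \<open>2 * h * \<kappa>\<close> nodes of all blocks contain at most 1/8
    nodes silent up to \<open>T\<close> on average.\<close>
  define h where "h = nat \<lfloor>1 / (16 * real \<kappa> * \<epsilon>)\<rfloor>"
  have D2: "2 * real D + 2 \<le> v ^ 9"
  proof -
    have "2 * real D + 2 \<le> 20 * (N * P)" using D NP by linarith
    also have "\<dots> \<le> 20 * (v ^ 8 * (v / 10000))" using PN P v1 N by (intro mult_left_mono mult_mono) auto
    also have "\<dots> \<le> v ^ 9" using v1 by (simp add: eval_nat_numeral)
    finally show ?thesis .
  qed
  have big: "2 * real D + 2 \<le> 1 / (16 * real \<kappa> * \<epsilon>)"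
  proof -
    have "16 * real \<kappa> * (2 * real D + 2) \<le> 16 * v ^ 3 * v ^ 9" using \<kappa>v D2 v1 by (intro mult_mono) auto
    also have "\<dots> = 16 * v ^ 12" by (simp add: power_add[symmetric])
    also have "\<dots> \<le> (v ^ 4 / 8) * v ^ 12" using v4[of 4] v1 by (intro mult_right_mono) auto
    also have "\<dots> = (N / 2)\<^sup>2 / 2" unfolding N by (simp add: power_add[symmetric] power_mult[symmetric] power_divide)
    also have "\<dots> \<le> exp (N / 2)" using exp_lower_Taylor_quadratic[of "N / 2"] N0 by linarith
    also note e2
    finally show ?thesis using \<epsilon> \<kappa>0 by (simp add: field_simps)
  qed
  have h: "real h \<le> 1 / (16 * real \<kappa> * \<epsilon>)" "1 / (16 * real \<kappa> * \<epsilon>) < real h + 1"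
    unfolding h_def using big by linarith+
  have hhalf: "1 / (32 * real \<kappa> * \<epsilon>) \<le> real h"
  proof -
    have "1 / (16 * real \<kappa> * \<epsilon>) = 2 * (1 / (32 * real \<kappa> * \<epsilon>))" by simp
    thus ?thesis using big h(2) by linarith
  qed
  have hk: "real h * real \<kappa> * \<epsilon> \<le> 1 / 16" using h(1) \<epsilon> \<kappa>0 by (simp add: field_simps)
  have hn: "16 * real h * real \<kappa> \<le> real n"
  proof -
    have "16 * real h * real \<kappa> \<le> 1 / \<epsilon>" using hk \<epsilon> by (simp add: field_simps)
    also have "\<dots> \<le> real n" using ne \<epsilon> by (simp add: field_simps)
    finally show ?thesis .
  qed

  have epsT: "\<epsilon> = (1 - p) ^ T" by (simp add: \<epsilon>_def q_def)
  interpret survival_parameters p n T A D h e e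
  proof
    show "2 \<le> D" using D NP by linarith
    show "2 * D + 1 \<le> h" using big h(2) by linarith
    have two: "exp (2 * l) \<le> 2 ^ e"
    proof -
      have "2 * l \<le> 3 * l * ln 2" using ln2_ge_two_thirds l1 by simp
      also have "\<dots> \<le> real e * ln 2" using e by (intro mult_right_mono) auto
      finally have "exp (2 * l) \<le> exp (real e * ln 2)" by simp
      also have "\<dots> = 2 ^ e" by (simp add: exp_of_nat_mult)
      finally show ?thesis .
    qed
    have "real (2 * D) \<le> N * N"
    proof -
      have "real (2 * D) \<le> 20 * (N * P)" using D NP by simp
      also have "\<dots> = N * (20 * P)" by simp
      also have "20 * P \<le> N" using PN v1 vk[of 1 8] N by simp
      finally show ?thesis using N0 by simp
    qed
    also have "\<dots> \<le> real (2 ^ e)" using two e2l by simp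
    finally show "2 * D \<le> 2 ^ e" by (simp only: of_nat_le_iff)
    show "h \<le> D * 2 ^ 2 ^ e"
    proof -
      have "real h \<le> exp N" using hn \<kappa>0 n0 mult_mono[of 1 "16 * real \<kappa>" "real h" "real h"] by (simp add: mult_ac)
      also have "N \<le> real (2 ^ e) * ln 2"
      proof -
        have "N * 2 \<le> N * N" using N0 by (intro mult_left_mono) auto
        hence "N \<le> N * N * (1 / 2)" by simp
        also have "\<dots> \<le> real (2 ^ e) * ln 2" using two e2l ln2_ge_two_thirds N0 by (intro mult_mono) auto
        finally show ?thesis .
      qed
      hence "exp N \<le> exp (real (2 ^ e) * ln 2)" by simp
      also have "\<dots> = real (2 ^ 2 ^ e)" by (simp only: exp_of_nat_mult) simp
      finally have "h \<le> 2 ^ 2 ^ e" by (simp only: of_nat_le_iff)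
      also have "\<dots> \<le> D * 2 ^ 2 ^ e" using \<open>2 \<le> D\<close> by simp
      finally show ?thesis .
    qed
    have s: "Suc (Suc (A * e) + e) = \<kappa>" by (simp add: \<kappa>_def)
    show "2 * h * Suc (Suc (A * e) + e) < n"
    proof -
      have "16 * h * \<kappa> \<le> n" using hn by (metis of_nat_le_iff of_nat_mult of_nat_numeral)
      thus ?thesis unfolding s using n by linarith
    qed
    show "real (2 * h * Suc (Suc (A * e) + e)) * (1 - p) ^ T \<le> 1 / 8"
      unfolding s using hk by (simp add: \<epsilon>_def q_def)
    show "(1 - p) ^ (A - 1) * real (T + 2 * D + 1) \<le> 1 / 16"
    proof -
      have "(1 - p) ^ (A - 1) \<le> exp (- p) ^ (A - 1)"
        using p exp_ge_add_one_self[of "- p"] by (intro power_mono) auto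
      also have "\<dots> = exp (- (real (A - 1) * p))" by (simp add: exp_of_nat_mult[symmetric])
      also have "\<dots> \<le> exp (- (6 * l))"
      proof -
        have "6 * l * P * p \<le> real (A - 1) * p" using A p by (intro mult_right_mono) auto
        moreover have "6 * l * P * p = 6 * l" using P by (simp add: mult.assoc mult.commute)
        ultimately show ?thesis by simp
      qed
      also have "\<dots> = 1 / N ^ 6" by (simp add: exp_minus exp_of_nat_mult[of 6 l, simplified] el inverse_eq_divide)
      finally have 1: "(1 - p) ^ (A - 1) \<le> 1 / N ^ 6" .
      have "real T \<le> N * P"
      proof -
        have "N / u \<le> N / p" using u p N0 by (intro divide_left_mono) auto
        thus ?thesis using T by (simp add: P_def)
      qed
      hence "real (T + 2 * D + 1) \<le> 20 * (N * P)" using D NP by simp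
      also have "\<dots> \<le> N * N" 
      proof -
        have "20 * P \<le> N" using PN v1 vk[of 1 8] N by simp
        thus ?thesis using N0 mult_left_mono[of "20 * P" N N] by simp
      qed
      finally have 2: "real (T + 2 * D + 1) \<le> N * N" .
      have "(1 - p) ^ (A - 1) * real (T + 2 * D + 1) \<le> (1 / N ^ 6) * (N * N)"
        using 1 2 p N0 by (intro mult_mono) auto
      also have "\<dots> = 1 / N ^ 4" using N0 by (simp add: eval_nat_numeral)
      also have "\<dots> \<le> 1 / 16"
      proof -
        have "N ^ 1 \<le> N ^ 4" using N0 by (intro power_increasing) auto
        thus ?thesis using N0 by (intro divide_left_mono) auto
      qed
      finally show ?thesis .
    qed
    show "2 * (real h + 1)\<^sup>2 * exp (- (real D * p / 2)) \<le> (1 - p) ^ T / 8"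
    proof -
      have "8 * N * P * p \<le> real D * p" using D p by (intro mult_right_mono) auto
      moreover have "8 * N * P * p = 8 * N" using P by (simp add: mult.assoc mult.commute)
      ultimately have "exp (- (real D * p / 2)) \<le> exp (- (4 * N))" by simp
      also have "\<dots> = 1 / real n ^ 4" unfolding n0 by (simp add: exp_minus exp_of_nat_mult[of 4 N, simplified] inverse_eq_divide)
      finally have 1: "exp (- (real D * p / 2)) \<le> 1 / real n ^ 4" .
      have "real h * 16 * 2 \<le> real h * 16 * real \<kappa>" using \<kappa>0 by (intro mult_left_mono) auto
      hence "real h + 1 \<le> real n" using hn n by (simp add: mult_ac)
      hence "(real h + 1)\<^sup>2 \<le> (real n)\<^sup>2" by (intro power_mono) auto
      hence "2 * (real h + 1)\<^sup>2 * exp (- (real D * p / 2)) \<le> 2 * (real n)\<^sup>2 * (1 / real n ^ 4)"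
        using 1 by (intro mult_mono) auto
      also have "\<dots> = 2 / (real n)\<^sup>2" using n by (simp add: eval_nat_numeral)
      also have "\<dots> \<le> 1 / (8 * real n)" using n by (simp add: divide_simps power2_eq_square)
      also have "\<dots> \<le> \<epsilon> / 8" using ne n by (simp add: field_simps)
      finally show ?thesis by (simp add: \<epsilon>_def q_def)
    qed
  qed (use p T A_def h in auto)

  have "(p / (128 * real \<kappa>)) ^ \<kappa> \<le> (real h * \<epsilon> * p / 4) ^ \<kappa>"
  proof (rule power_mono)
    have "1 / (32 * real \<kappa> * \<epsilon>) * (\<epsilon> * p / 4) \<le> real h * (\<epsilon> * p / 4)"
      using hhalf \<epsilon> p by (intro mult_right_mono) auto
    thus "p / (128 * real \<kappa>) \<le> real h * \<epsilon> * p / 4" using \<epsilon> \<kappa>0 by (simp add: field_simps)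
  qed (use p in simp)
  \<comment> \<open>Each block succeeds with probability at least about
    \<open>1 / N = exp (- l)\<close>; the \<open>\<kappa>\<close> blocks together cost
    \<open>l * \<kappa> \<le> 40 * l ^ 3 * P\<close> in the exponent.\<close>
  moreover have "exp (- (40 * l ^ 3 * P)) \<le> (p / (128 * real \<kappa>)) ^ \<kappa>"
  proof -
    have "128 * real \<kappa> * P \<le> 128 * v ^ 3 * v" using \<kappa>v PN P v1 by (intro mult_mono) auto
    also have "\<dots> \<le> v ^ 4 * v ^ 4"
    proof -
      have "128 * v ^ 4 \<le> v ^ 4 * v ^ 4" using v4[of 4] v1 by (intro mult_right_mono) auto
      thus ?thesis by (simp add: eval_nat_numeral)
    qed
    also have "\<dots> = N" by (simp add: N power_add[symmetric])
    finally have "128 * real \<kappa> * P \<le> N" .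
    hence "1 / N \<le> p / (128 * real \<kappa>)" using P p \<kappa>0 N0 by (simp add: P_def field_simps)
    moreover have "1 / N = exp (- l)" using el by (simp add: exp_minus inverse_eq_divide)
    ultimately have "exp (- l) ^ \<kappa> \<le> (p / (128 * real \<kappa>)) ^ \<kappa>" by (intro power_mono) auto
    moreover have "exp (- (40 * l ^ 3 * P)) \<le> exp (- l) ^ \<kappa>"
    proof -
      have "real \<kappa> * l \<le> 40 * l\<^sup>2 * P * l" using \<kappa> l1 by (intro mult_right_mono) auto
      also have "\<dots> = 40 * l ^ 3 * P" by (simp add: power2_eq_square power3_eq_cube)
      finally show ?thesis by (simp add: exp_of_nat_mult[symmetric])
    qed
    ultimately show ?thesis by linarith
  qed
  ultimately have pw: "exp (- (40 * l ^ 3 * P)) \<le> (real h * \<epsilon> * p / 4) ^ \<kappa>" by linarith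
  \<comment> \<open>One factor \<open>1 / N\<close> pays for cutting the nodes into
    \<open>\<kappa>\<close> blocks.\<close>
  have hq: "real n * q * exp (- l) \<le> real h * (3 / 4)"
  proof -
    have k43: "64 * real \<kappa> \<le> N"
    proof -
      have "64 * real \<kappa> \<le> v * v ^ 3" using \<kappa>v v1 by (intro mult_mono) auto
      also have "\<dots> \<le> v ^ 8" using vk[of 4 8] by (simp add: eval_nat_numeral)
      finally show ?thesis using N by simp
    qed
    have "real n * q \<le> 1 / \<epsilon>" using qne \<epsilon> by (simp add: field_simps)
    hence "real n * q * exp (- l) \<le> (1 / \<epsilon>) * (1 / N)"
      using el N0 \<epsilon> by (intro mult_mono) (auto simp: exp_minus inverse_eq_divide)
    also have "\<dots> \<le> (1 / \<epsilon>) * (1 / (64 * real \<kappa>))"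
      using k43 \<epsilon> \<kappa>0 by (intro mult_left_mono divide_left_mono) auto
    also have "\<dots> \<le> (1 / (32 * real \<kappa> * \<epsilon>)) * (3 / 4)" using \<epsilon> \<kappa>0 by (simp add: field_simps)
    also have "\<dots> \<le> real h * (3 / 4)" by (rule mult_right_mono[OF hhalf]) simp
    finally show ?thesis .
  qed
  have "5 * (1 + N) \<le> exp (2 * l)"
  proof -
    have "N * 10000 \<le> N * N" using N0 by (intro mult_left_mono) auto
    moreover have "5 * (1 + N) \<le> N * 10000" using N0 by simp
    ultimately have "5 * (1 + N) \<le> N * N" by (rule order_trans[rotated])
    thus ?thesis using e2l by simp
  qed
  hence "5 * q * (1 + N) * real n * exp (- (\<Gamma> * l ^ 4)) \<le> (real n * q) * (exp (2 * l) * exp (- (\<Gamma> * l ^ 4)))"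
    using q mult_left_mono[of "5 * (1 + N)" "exp (2 * l)" "real n * q * exp (- (\<Gamma> * l ^ 4))"] by (simp add: mult_ac)
  \<comment> \<open>Here 43 = 40 + 3: the success probability needs 40, and the three powers of
    \<open>N\<close> spent on \<open>5 * (1 + N)\<close> and on \<open>h\<close> need 3.\<close>
  also have "exp (2 * l) * exp (- (\<Gamma> * l ^ 4)) \<le> exp (- l) * exp (- (40 * l ^ 3 * P))"
  proof -
    have "43 * P * l ^ 4 \<le> \<Gamma> * l ^ 4" using \<Gamma> l1 by (intro mult_right_mono) (auto simp: P_def)
    moreover have "l ^ 3 \<le> l ^ 4" "l ^ 1 \<le> l ^ 4" using l1 by (intro power_increasing; simp)+
    hence "P * l ^ 3 \<le> P * l ^ 4" "1 * l ^ 1 \<le> P * l ^ 4" using P l1 by (intro mult_left_mono mult_mono; simp)+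
    ultimately have "3 * l + 40 * l ^ 3 * P \<le> \<Gamma> * l ^ 4" by (simp add: mult_ac)
    thus ?thesis by (simp add: exp_add[symmetric])
  qed
  hence "(real n * q) * (exp (2 * l) * exp (- (\<Gamma> * l ^ 4))) \<le> (real n * q) * (exp (- l) * exp (- (40 * l ^ 3 * P)))"
    using q by (intro mult_left_mono) auto
  also have "\<dots> = (real n * q * exp (- l)) * exp (- (40 * l ^ 3 * P))" by simp
  also have "\<dots> \<le> (real h * (3 / 4)) * (real h * \<epsilon> * p / 4) ^ \<kappa>"
    by (rule mult_mono[OF hq pw]) auto
  also have "\<dots> = real h * (3 / 4 * (real h * (1 - p) ^ T * p / 4) ^ (A * e + e + 2))"
    unfolding epsT \<kappa>_def by simp
  also have "\<dots> \<le> ungarian_expect (tamari n) (weak_le n) p"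
    by (rule ungarian_expect_ge[OF p not_bot_prob_ge]) simp
  finally show ?thesis by (simp add: q_def N_def l_def)
qed


section \<open>The lower bound\<close>

text \<open>With P = 1/p, multiply P^16 \<le> exp(16 P^2) by 16 c^8 \<le> exp(ln(16 c^8) P^2), both
  due to P \<ge> 1, and then by p^8. The exponent 8 matches \<open>v ^ 8 = ln n\<close>, and 16
  makes up for log log n being bounded only by 1/2, since (1/2)^4 = 1/16.\<close>

lemma constant_growth:
  fixes p c :: real
  assumes p: "0 < p" "p < 1" and c: "1 \<le> c"
  shows "16 * (c / p) ^ 8 \<le> p ^ 8 * exp ((16 + ln (16 * c ^ 8)) / p ^ 2)"
proof -
  define P where "P = 1 / p"
  have P: "1 \<le> P" "p * P = 1" using p by (auto simp: P_def field_simps)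
  have c8: "1 \<le> 16 * c ^ 8" using one_le_power[OF c, of 8] by simp
  have P2: "P \<le> P\<^sup>2" "1 \<le> P\<^sup>2" using P self_le_power[of P 2] by auto
  have "P \<le> exp P" using exp_ge_add_one_self[of P] by linarith
  hence "P ^ 16 \<le> exp P ^ 16" using P by (intro power_mono) auto
  also have "\<dots> = exp (16 * P)" by (simp add: exp_of_nat_mult[of 16 P, simplified])
  also have "\<dots> \<le> exp (16 * P\<^sup>2)" using P2 by simp
  finally have 1: "P ^ 16 \<le> exp (16 * P\<^sup>2)" .
  have "16 * c ^ 8 = exp (ln (16 * c ^ 8))" using c by simp
  also have "\<dots> \<le> exp (ln (16 * c ^ 8) * P\<^sup>2)"
    using P2 c8 mult_left_mono[of 1 "P\<^sup>2" "ln (16 * c ^ 8)"] by simp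
  finally have 2: "16 * c ^ 8 \<le> exp (ln (16 * c ^ 8) * P\<^sup>2)" .
  have "P ^ 16 * (16 * c ^ 8) \<le> exp (16 * P\<^sup>2) * exp (ln (16 * c ^ 8) * P\<^sup>2)"
    using 1 2 c by (intro mult_mono) auto
  also have "\<dots> = exp ((16 + ln (16 * c ^ 8)) / p ^ 2)"
    by (simp add: exp_add[symmetric] P_def power_divide add_divide_distrib)
  finally have "p ^ 8 * (P ^ 16 * (16 * c ^ 8)) \<le> p ^ 8 * exp ((16 + ln (16 * c ^ 8)) / p ^ 2)"
    using p by (intro mult_left_mono) auto
  moreover have "p ^ 8 * (P ^ 16 * (16 * c ^ 8)) = 16 * (c / p) ^ 8"
    using p by (simp add: P_def power_divide field_simps flip: power_add)
  ultimately show ?thesis by simp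
qed

theorem theorem1p6:
  shows "\<exists>C1::real. C1 > 0 \<and>
    (\<forall>p::real. 0 < p \<and> p < 1 \<longrightarrow>
      (\<forall>n::nat. n \<ge> 16 \<longrightarrow>
         ungarian_expect (tamari n) (weak_le n) p \<ge>
           zeta_minus p * real n *
             exp (- (p ^ 8 * exp (C1 / p ^ 2) * (ln (ln (real n))) ^ 4))))"
proof -
  define c where "c = (10000 :: real)"
  define C1 where "C1 = 16 + ln (16 * c ^ 8)"
  have "0 < C1" by (simp add: C1_def c_def add_pos_nonneg)
  moreover have "zeta_minus p * real n * exp (- (p ^ 8 * exp (C1 / p ^ 2) * (ln (ln (real n))) ^ 4))
      \<le> ungarian_expect (tamari n) (weak_le n) p" if p: "0 < p" "p < 1" and n: "16 \<le> n" for p n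
  proof -
    define \<Gamma> where "\<Gamma> = p ^ 8 * exp (C1 / p ^ 2)"
    define N where "N = ln (real n)"
    define l where "l = ln N"
    define q where "q = 1 - p"
    define X where "X = exp (- (\<Gamma> * l ^ 4))"
    have q: "0 < q" "q < 1" using p by (auto simp: q_def)
    have X: "0 < X" by (simp add: X_def)
    have E1: "1 \<le> ungarian_expect (tamari n) (weak_le n) p" by (rule ungarian_expect_ge_1[OF p]) (use n in simp)
    have n0: "real n = exp N" using n by (simp add: N_def)
    have \<Gamma>: "16 * (c / p) ^ 8 \<le> \<Gamma>"
      using constant_growth[OF p, of c] by (simp add: \<Gamma>_def C1_def c_def)
    have cp: "10000 \<le> c / p" using p by (simp add: c_def field_simps)
    have N1: "8 / 3 \<le> N"
    proof -
      have "8 / 3 \<le> 4 * ln (2::real)" using ln2_ge_two_thirds by simp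
      also have "\<dots> = ln (2 ^ 4)" by (subst ln_realpow) auto
      also have "\<dots> \<le> N" unfolding N_def using n by (intro ln_mono) auto
      finally show ?thesis .
    qed
    have l1: "1 / 2 \<le> l"
    proof -
      have "exp (1 / 2 :: real) ^ 2 \<le> N ^ 2"
      proof -
        have "exp (1 / 2 :: real) ^ 2 = exp 1" by (simp add: exp_of_nat_mult[symmetric])
        also have "\<dots> \<le> (8 / 3) ^ 2" using exp_le by (simp add: power2_eq_square)
        also have "\<dots> \<le> N ^ 2" using N1 by (intro power_mono) auto
        finally show ?thesis .
      qed
      hence "exp (1 / 2) \<le> N" by (rule power2_le_imp_le) (use N1 in simp)
      hence "ln (exp (1 / 2)) \<le> l" unfolding l_def using N1 by (intro ln_mono) auto
      thus ?thesis by simp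
    qed
    have big: "(c / p) ^ 8 \<le> N" if "\<Gamma> * l ^ 4 < N"
    proof -
      have "(1 / 2) ^ 4 \<le> l ^ 4" using l1 by (intro power_mono) auto
      hence "16 * (c / p) ^ 8 * (1 / 2) ^ 4 \<le> \<Gamma> * l ^ 4"
        using \<Gamma> by (intro mult_mono) (auto simp: \<Gamma>_def)
      thus ?thesis using that by (simp add: power_divide)
    qed
    \<comment> \<open>In the first case the right-hand side is at most 1 and the expectation at
      least 1. The other two have \<open>(c / p) ^ 8 \<le> N\<close>; if moreover
      \<open>n * q < 1\<close>, the bound on \<open>zeta_minus\<close> already brings the right-hand
      side below 1.\<close>
    consider "N \<le> \<Gamma> * l ^ 4" | "\<Gamma> * l ^ 4 < N" "real n * q < 1" | "\<Gamma> * l ^ 4 < N" "1 \<le> real n * q" by linarith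
    hence "zeta_minus p * real n * X \<le> ungarian_expect (tamari n) (weak_le n) p"
    proof cases
      case 1
      have "zeta_minus p * (real n * X) \<le> 1 * (real n * X)"
        using zeta_minus_bounds(1)[OF p] X by (intro mult_right_mono) auto
      also have "\<dots> = exp (N + - (\<Gamma> * l ^ 4))" unfolding n0 X_def exp_add by simp
      also have "\<dots> \<le> 1" using 1 by simp
      finally show ?thesis using E1 by (simp add: mult.assoc)
    next
      case large: 2
      note big = big[OF large(1)]
      have "(c / p) ^ 1 \<le> (c / p) ^ 8" using cp by (intro power_increasing) auto
      hence NN: "10000 \<le> N" "c / p \<le> N" "10000 \<le> \<Gamma>" using big cp \<Gamma> by auto
      have el: "exp l = N" using N1 by (simp add: l_def)
      have l2: "1 \<le> l"
      proof -
        have "exp 1 \<le> N" using exp_le NN by linarith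
        thus ?thesis using el by (metis exp_le_cancel_iff)
      qed
      have nq: "real n * q * (1 + ln (1 / q)) \<le> 1 + N"
      proof -
        \<comment> \<open>Here ln(1/q) = N + ln(1/x), and x ln(1/x) stays below 1, so no lower bound
          on \<open>q\<close> is required.\<close>
        define x where "x = real n * q"
        have x: "0 < x" "x < 1" using large q n by (auto simp: x_def)
        have "1 / q = real n * (1 / x)" using q n by (simp add: x_def)
        hence "ln (1 / q) = ln (real n * (1 / x))" by simp
        also have "\<dots> = N + ln (1 / x)" unfolding N_def by (rule ln_mult_pos) (use x n in auto)
        finally have "ln (1 / q) = N + ln (1 / x)" .
        moreover have "ln (1 / x) \<le> 1 / x - 1" using x by (intro ln_le_minus_one) auto
        ultimately have "x * (1 + ln (1 / q)) \<le> x * (N + 1 / x)" using x by (intro mult_left_mono) auto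
        also have "\<dots> = x * N + 1" using x by (simp add: field_simps)
        also have "\<dots> \<le> 1 * N + 1" using x N1 by (intro add_right_mono mult_right_mono) auto
        finally show ?thesis by (simp add: x_def)
      qed
      have X2: "X \<le> 1 / (N * N)"
      proof -
        have "l ^ 1 \<le> l ^ 4" using l2 by (intro power_increasing) auto
        hence "2 * l \<le> \<Gamma> * l ^ 4" using NN l2 by (intro mult_mono) auto
        hence "X \<le> exp (- (2 * l))" by (simp add: X_def)
        also have "\<dots> = 1 / (N * N)" unfolding exp_minus mult_2 exp_add el by (rule inverse_eq_divide)
        finally show ?thesis .
      qed
      have "zeta_minus p * (real n * X) \<le> 5 * q * (1 + ln (1 / q)) * (real n * X)"
        using zeta_minus_bounds(2)[OF p] X by (intro mult_right_mono) (auto simp: q_def)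
      also have "\<dots> = 5 * (real n * q * (1 + ln (1 / q))) * X" by simp
      also have "\<dots> \<le> 5 * (1 + N) * (1 / (N * N))" by (rule mult_mono) (use nq X2 X NN in auto)
      also have "\<dots> \<le> 1"
      proof -
        have "N * 10000 \<le> N * N" using NN by (intro mult_left_mono) auto
        moreover have "5 * (1 + N) \<le> N * 10000" using NN by simp
        ultimately have "5 * (1 + N) \<le> N * N" by (rule order_trans[rotated])
        thus ?thesis using NN by (simp add: divide_le_eq)
      qed
      finally show ?thesis using E1 by (simp add: mult.assoc)
    next
      case large: 3
      note big = big[OF large(1)]
      define v where "v = root 8 N"
      have v: "v ^ 8 = ln (real n)" using N1 by (simp add: v_def N_def[symmetric])
      have vp: "10000 / p \<le> v"
      proof -
        have "root 8 ((c / p) ^ 8) \<le> v" unfolding v_def using big by (intro real_root_le_mono) auto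
        moreover have "root 8 ((c / p) ^ 8) = c / p" by (rule real_root_power_cancel) (use cp in auto)
        ultimately show ?thesis by (simp add: c_def)
      qed
      have \<Gamma>p: "43 / p \<le> \<Gamma>"
      proof -
        have "(c / p) ^ 1 \<le> (c / p) ^ 8" using cp by (intro power_increasing) auto
        moreover have "43 / p \<le> c / p" using p by (intro divide_right_mono) (auto simp: c_def)
        ultimately show ?thesis using \<Gamma> cp by simp
      qed
      have "1 / q \<le> real n" using large q by (simp add: field_simps)
      hence "ln (1 / q) \<le> N" unfolding N_def using q by (intro ln_mono) auto
      hence "5 * q * (1 + ln (1 / q)) \<le> 5 * q * (1 + N)" using q by (intro mult_left_mono) auto
      hence "zeta_minus p \<le> 5 * q * (1 + N)"
        using zeta_minus_bounds(2)[OF p] by (simp add: q_def)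
      hence "zeta_minus p * (real n * X) \<le> 5 * q * (1 + N) * (real n * X)"
        using X by (intro mult_right_mono) auto
      also have "\<dots> \<le> ungarian_expect (tamari n) (weak_le n) p"
        using lower_bound_large[OF p n _ v vp \<Gamma>p] large(2) by (simp add: q_def N_def l_def X_def mult.assoc)
      finally show ?thesis by (simp add: mult.assoc)
    qed
    thus ?thesis by (simp add: X_def \<Gamma>_def l_def N_def)
  qed
  ultimately show ?thesis by blast
qed

end
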